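(* Let $f_0,f_1,\dots,f_m$ be vector fields on $\mathbb{R}^d$ satisfying the regularity assumptions stated in the context, let $x_t$ be the solution of the Stratonovich SDE $dx_t=f_0(x_t)\,dt+\sum_{j=1}^m f_j(x_t)\circ dW^j_t$ started at $x\in\mathbb{R}^d$, let $v_t$ be the associated matrix solution of the variational equation with $v_0=I$, and suppose that the limit $\Phi(\omega)=\lim_{t\to\infty}\big(v_t(\omega)^Tv_t(\omega)\big)^{1/2t}$ defining the Lyapunov exponents $\lambda_1,\dots,\lambda_d$ exists almost surely. If $\operatorname{trace}(Df_0(y))$ is constant (independent of $y\in\mathbb{R}^d$) and $\operatorname{trace}(Df_j(y))=0$ for all $y\in\mathbb{R}^d$ and all $j\ge 1$, then the sum of the Lyapunov exponents is equal to the trace of $Df_0$; that is, almost surely, $$\sum_{i=1}^d\lambda_i=\operatorname{trace}(Df_0).$$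
   Context: $W^1,\dots,W^m$ are independent standard one-dimensional Brownian motions, $\circ\,dW$ denotes Stratonovich integration, and $Df_j$ is the Jacobian matrix of $f_j$. Regularity assumptions: for some integer $k\ge1$ and some $\delta>0$, $f_0\in\mathcal{C}^{k,\delta}_b$, $f_1,\dots,f_m\in\mathcal{C}^{k+1,\delta}_b$ and $\sum_{j=1}^m\sum_{i=1}^d f_j^i\,\frac{\partial f_j}{\partial x_i}\in\mathcal{C}^{k,\delta}_b$. Here $\mathcal{C}^{k,\delta}_b$ is the Banach space of $\mathcal{C}^k$ vector fields on $\mathbb{R}^d$ with linear growth and bounded derivatives up to order $k$, whose $k$-th derivative is $\delta$-Hölder continuous. Under these assumptions the SDE has unique global solutions and generates a $\mathcal{C}^k$ flow (random dynamical system) $\varphi(t,\omega)$, with $x_t=\varphi(t,\omega)x$. The variational (tangent) equation is the matrix equation $$dv_t=Df_0(x_t)v_t\,dt+\sum_{j=1}^m Df_j(x_t)v_t\circ dW^j_t,\qquad v_0=I\in\mathbb{R}^{d\times d},$$ so that $v_t=D\varphi(t,\omega,x)$. Lyapunov exponents: whenever the limit $\Phi(\omega)=\lim_{t\to\infty}(v_t(\omega)^Tv_t(\omega))^{1/2t}\ge0$ exists (as guaranteed by Oseledets' multiplicative ergodic theorem under its integrability condition), the Lyapunov exponents $\lambda_1,\dots,\lambda_d$ are the logarithms of the eigenvalues of $\Phi(\omega)$, counted with multiplicity. *)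

theory Defs
  imports "HOL-Probability.Probability" "HOL-Computational_Algebra.Polynomial"
begin

section \<open>Regularity of vector fields\<close>

definition partial_deriv ::
  "'d::finite \<Rightarrow> (real^'d \<Rightarrow> real^'d) \<Rightarrow> real^'d \<Rightarrow> real^'d" where
  "partial_deriv i g = (\<lambda>y. frechet_derivative g (at y) (axis i 1))"

definition partial_derivs ::
  "'d::finite list \<Rightarrow> (real^'d \<Rightarrow> real^'d) \<Rightarrow> real^'d \<Rightarrow> real^'d" where
  "partial_derivs is g = fold partial_deriv is g"

text \<open>The space of \<open>C\<^sup>k\<close> vector fields of linear growth with globally bounded
  derivatives of orders \<open>1,\<dots>,k\<close> whose \<open>k\<close>-th derivatives are globally Hoelder continuous
  with exponent \<open>\<delta>\<close>. Derivatives of order \<open>l\<close> are indexed by lists of length \<open>l\<close>.\<close>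

definition C_kb :: "nat \<Rightarrow> real \<Rightarrow> (real^'d::finite \<Rightarrow> real^'d) \<Rightarrow> bool" where
  "C_kb k \<delta> g \<longleftrightarrow>
     (\<forall>is. length is < k \<longrightarrow> (\<forall>y. partial_derivs is g differentiable (at y))) \<and>
     (\<forall>is. length is \<le> k \<longrightarrow> continuous_on UNIV (partial_derivs is g)) \<and>
     (\<exists>K. \<forall>y. norm (g y) \<le> K * (1 + norm y)) \<and>
     (\<forall>is. 1 \<le> length is \<and> length is \<le> k \<longrightarrow> bounded (range (partial_derivs is g))) \<and>
     (\<forall>is. length is = k \<longrightarrow>
        (\<exists>K. \<forall>y z. norm (partial_derivs is g y - partial_derivs is g z)
                     \<le> K * norm (y - z) powr \<delta>))"

section \<open>Filtrations, Brownian motion, semimartingales\<close>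

text \<open>Time is the half-line \<open>t \<ge> 0\<close>; the library's filtrations are indexed by a whole
  type, but the members \<open>F t\<close> with \<open>t < 0\<close> play no role. The usual conditions are not
  assumed.\<close>

definition filtered_prob_space :: "'w measure \<Rightarrow> (real \<Rightarrow> 'w measure) \<Rightarrow> bool" where
  "filtered_prob_space M F \<longleftrightarrow>
     prob_space M \<and> filtration (space M) F \<and> (\<forall>t. subalgebra M (F t))"

definition adapted ::
  "(real \<Rightarrow> 'w measure) \<Rightarrow> (real \<Rightarrow> 'w \<Rightarrow> 'b::topological_space) \<Rightarrow> bool" where
  "adapted F X \<longleftrightarrow> (\<forall>t\<ge>0. X t \<in> borel_measurable (F t))"

definition continuous_paths ::
  "'w measure \<Rightarrow> (real \<Rightarrow> 'w \<Rightarrow> 'b::topological_space) \<Rightarrow> bool" where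
  "continuous_paths M X \<longleftrightarrow> (AE \<omega> in M. continuous_on {0..} (\<lambda>t. X t \<omega>))"

text \<open>Independent standard one-dimensional Brownian motions \<open>W 1, \<dots>, W m\<close> relative to the
  filtration \<open>F\<close>. The last clause says that the \<open>\<sigma>\<close>-algebra \<open>F s\<close> (index \<open>0\<close>) and the
  \<open>m\<close> increments over \<open>[s,t]\<close> (indices \<open>1,\<dots>,m\<close>) are jointly independent; letting \<open>s\<close>
  and \<open>t\<close> vary, this gives the independence of increments of each \<open>W j\<close> as well as the
  independence of the processes \<open>W 1, \<dots>, W m\<close>.\<close>

definition brownian_motions ::
  "'w measure \<Rightarrow> (real \<Rightarrow> 'w measure) \<Rightarrow> nat \<Rightarrow> (nat \<Rightarrow> real \<Rightarrow> 'w \<Rightarrow> real) \<Rightarrow> bool" where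
  "brownian_motions M F m W \<longleftrightarrow>
     (\<forall>j\<in>{1..m}. adapted F (W j) \<and> continuous_paths M (W j) \<and> (AE \<omega> in M. W j 0 \<omega> = 0)) \<and>
     (\<forall>s t. 0 \<le> s \<and> s < t \<longrightarrow>
        (\<forall>j\<in>{1..m}. distributed M lborel (\<lambda>\<omega>. W j t \<omega> - W j s \<omega>)
                      (normal_density 0 (sqrt (t - s)))) \<and>
        prob_space.indep_sets M
          (\<lambda>j. if j = 0 then sets (F s)
               else {(\<lambda>\<omega>. W j t \<omega> - W j s \<omega>) -` A \<inter> space M | A. A \<in> sets borel})
          {0..m})"

definition martingale :: "'w measure \<Rightarrow> (real \<Rightarrow> 'w measure) \<Rightarrow> (real \<Rightarrow> 'w \<Rightarrow> real) \<Rightarrow> bool" where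
  "martingale M F X \<longleftrightarrow>
     adapted F X \<and> (\<forall>t\<ge>0. integrable M (X t)) \<and>
     (\<forall>s t. 0 \<le> s \<and> s \<le> t \<longrightarrow> (AE \<omega> in M. real_cond_exp M (F s) (X t) \<omega> = X s \<omega>))"

text \<open>The localizing stopping times are finite-valued, which is no restriction: infinite values
  are removed by passing from \<open>T n\<close> to \<open>min (T n) n\<close>.\<close>

definition continuous_local_martingale ::
  "'w measure \<Rightarrow> (real \<Rightarrow> 'w measure) \<Rightarrow> (real \<Rightarrow> 'w \<Rightarrow> real) \<Rightarrow> bool" where
  "continuous_local_martingale M F X \<longleftrightarrow>
     adapted F X \<and> continuous_paths M X \<and>
     (\<exists>T :: nat \<Rightarrow> 'w \<Rightarrow> real.
        (\<forall>n. stopping_time F (T n) \<and> (\<forall>\<omega>\<in>space M. 0 \<le> T n \<omega>)) \<and>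
        (AE \<omega> in M. incseq (\<lambda>n. T n \<omega>) \<and> filterlim (\<lambda>n. T n \<omega>) at_top sequentially) \<and>
        (\<forall>n. martingale M F (\<lambda>t \<omega>. X (min t (T n \<omega>)) \<omega> - X 0 \<omega>)))"

definition is_partition :: "real \<Rightarrow> nat \<Rightarrow> (nat \<Rightarrow> real) \<Rightarrow> bool" where
  "is_partition t n p \<longleftrightarrow> p 0 = 0 \<and> p n = t \<and> (\<forall>i<n. p i < p (Suc i))"

definition locally_finite_variation :: "(real \<Rightarrow> real) \<Rightarrow> bool" where
  "locally_finite_variation a \<longleftrightarrow>
     (\<forall>t\<ge>0. \<exists>K. \<forall>n p. is_partition t n p \<longrightarrow> (\<Sum>i<n. \<bar>a (p (Suc i)) - a (p i)\<bar>) \<le> K)"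

definition continuous_semimartingale ::
  "'w measure \<Rightarrow> (real \<Rightarrow> 'w measure) \<Rightarrow> (real \<Rightarrow> 'w \<Rightarrow> real) \<Rightarrow> bool" where
  "continuous_semimartingale M F X \<longleftrightarrow>
     adapted F X \<and> continuous_paths M X \<and>
     (\<exists>N A. continuous_local_martingale M F N \<and>
        adapted F A \<and> continuous_paths M A \<and>
        (AE \<omega> in M. locally_finite_variation (\<lambda>t. A t \<omega>)) \<and>
        (AE \<omega> in M. \<forall>t\<ge>0. X t \<omega> = N t \<omega> + A t \<omega>))"

section \<open>Stratonovich integrals and equations\<close>

text \<open>\<open>I\<close> is the Stratonovich integral of \<open>Y\<close> against \<open>B\<close> over \<open>[0,t]\<close>: the limit in
  probability of the trapezoidal sums as the mesh of the partition tends to \<open>0\<close>. The integrand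
  is not required to be a semimartingale: for \<open>k = 1\<close> the integrand
  \<open>Df\<^sub>j(x\<^sub>s) v\<^sub>s\<close> of the variational equation is only a \<open>C\<^sup>1\<close> function of
  the semimartingale \<open>(x, v)\<close>. Measurability is required because \<open>measure\<close> vanishes on
  non-measurable sets.\<close>

definition has_stratonovich_integral ::
  "'w measure \<Rightarrow> (real \<Rightarrow> 'w \<Rightarrow> 'b::euclidean_space) \<Rightarrow> (real \<Rightarrow> 'w \<Rightarrow> real) \<Rightarrow> real
     \<Rightarrow> ('w \<Rightarrow> 'b) \<Rightarrow> bool" where
  "has_stratonovich_integral M Y B t I \<longleftrightarrow>
     (\<forall>s\<in>{0..t}. Y s \<in> borel_measurable M \<and> B s \<in> borel_measurable M) \<and>
     I \<in> borel_measurable M \<and>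
     (\<forall>\<epsilon>>0. \<forall>\<eta>>0. \<exists>\<rho>>0. \<forall>n p.
        is_partition t n p \<and> (\<forall>i<n. p (Suc i) - p i < \<rho>) \<longrightarrow>
        measure M {\<omega> \<in> space M.
          \<epsilon> < norm ((\<Sum>i<n. (B (p (Suc i)) \<omega> - B (p i) \<omega>) *\<^sub>R
                              ((1/2) *\<^sub>R (Y (p i) \<omega> + Y (p (Suc i)) \<omega>))) - I \<omega>)} < \<eta>)"

text \<open>The continuous semimartingale \<open>Z\<close> satisfies
  \<open>dZ = b dt + \<Sum>\<^sub>j \<sigma>\<^sub>j \<circ> dW\<^sup>j\<close>, \<open>Z\<^sub>0 = z0\<close>; the processes \<open>b\<close> and \<open>\<sigma> j\<close>
  will themselves be functions of the solution.\<close>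

definition stratonovich_solution ::
  "'w measure \<Rightarrow> (real \<Rightarrow> 'w measure) \<Rightarrow> nat \<Rightarrow> (nat \<Rightarrow> real \<Rightarrow> 'w \<Rightarrow> real) \<Rightarrow> 'b::euclidean_space
     \<Rightarrow> (real \<Rightarrow> 'w \<Rightarrow> 'b) \<Rightarrow> (nat \<Rightarrow> real \<Rightarrow> 'w \<Rightarrow> 'b) \<Rightarrow> (real \<Rightarrow> 'w \<Rightarrow> 'b) \<Rightarrow> bool" where
  "stratonovich_solution M F m W z0 b \<sigma> Z \<longleftrightarrow>
     (\<forall>e\<in>Basis. continuous_semimartingale M F (\<lambda>t \<omega>. Z t \<omega> \<bullet> e)) \<and>
     (\<exists>J. \<forall>t\<ge>0.
        (\<forall>j\<in>{1..m}. has_stratonovich_integral M (\<sigma> j) (W j) t (J j t)) \<and>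
        (AE \<omega> in M. Z t \<omega> = z0 + integral {0..t} (\<lambda>s. b s \<omega>) + (\<Sum>j=1..m. J j t \<omega>)))"

section \<open>Lyapunov exponents\<close>

definition diag_matrix :: "('d \<Rightarrow> real) \<Rightarrow> real^'d^'d::finite" where
  "diag_matrix a = (\<chi> i j. if i = j then a i else 0)"

text \<open>The real power of a symmetric positive semidefinite matrix, by the spectral theorem; it does
  not depend on the choice of the diagonalization.\<close>

definition psd_powr :: "real^'d^'d::finite \<Rightarrow> real \<Rightarrow> real^'d^'d" where
  "psd_powr A r = (THE B. \<exists>P a. orthogonal_matrix P \<and> (\<forall>i. 0 \<le> a i) \<and>
      A = P ** diag_matrix a ** transpose P \<and>
      B = P ** diag_matrix (\<lambda>i. a i powr r) ** transpose P)"

definition charpoly :: "real^'d^'d::finite \<Rightarrow> real poly" where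
  "charpoly A = det (\<chi> i j. (if i = j then [:0, 1:] else 0) - [:A $ i $ j:])"

text \<open>Logarithm on \<open>[0,\<infinity>)\<close> with \<open>log 0 = -\<infinity>\<close> (the library has \<open>ln 0 = 0\<close>).\<close>

definition ln_ext :: "real \<Rightarrow> ereal" where
  "ln_ext y = (if y = 0 then -\<infinity> else ereal (ln y))"

definition lyapunov_root :: "(real \<Rightarrow> real^'d^'d::finite) \<Rightarrow> real \<Rightarrow> real^'d^'d" where
  "lyapunov_root V t = psd_powr (transpose (V t) ** V t) (1 / (2 * t))"

text \<open>Logarithms of the eigenvalues of \<open>\<Phi> = lim (V\<^sub>t\<^sup>T V\<^sub>t)\<^bsup>1/2t\<^esup>\<close>, with
  multiplicity. As \<open>\<Phi>\<close> is symmetric, all \<open>d\<close> roots of its characteristic polynomial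
  are real, so the multiset has \<open>d\<close> elements.\<close>

definition lyapunov_exponents :: "(real \<Rightarrow> real^'d^'d::finite) \<Rightarrow> ereal multiset" where
  "lyapunov_exponents V =
     image_mset ln_ext (proots (charpoly (Lim at_top (lyapunov_root V))))"

end

theory Submission
  imports Defs
begin

text \<open>The determinant of the fundamental solution satisfies \<open>det v\<^sub>t = exp (c t)\<close> almost surely
  (Liouville's formula). Given this, \<open>det ((v\<^sub>t\<^sup>T v\<^sub>t)\<^bsup>1/2t\<^esup>) = exp c\<close> for all
  \<open>t > 0\<close>, hence \<open>det \<Phi> = exp c\<close>, and the logarithms of the eigenvalues of \<open>\<Phi>\<close> add up to \<open>c\<close>.

  Liouville's formula is obtained along dyadic partitions, without constructing an Ito integral. By the
  trapezoidal rule, the increment of \<open>det v\<close> is the average of the cofactor matrices \<open>G\<close> at the two endpoints,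
  paired with the increment of \<open>v\<close>, up to a cubic error; this error is negligible because the quadratic
  sums of a continuous semimartingale are bounded in probability. The increments of the Stratonovich
  integrals of \<open>Y\<^sub>j = A\<^sub>j v\<close>, \<open>A\<^sub>j = Df\<^sub>j(x)\<close>, may be replaced by their trapezoidal approximations. Since \<open>\<langle>G, A v\<rangle> = trace A \<cdot> det v\<close>
  and \<open>trace A\<^sub>j = 0\<close>, the resulting terms reduce to sums of triple products of increments of \<open>G\<close>, \<open>Y\<^sub>j\<close>
  and \<open>W\<^sub>j\<close>, which vanish in the limit. What remains is \<open>det v\<^sub>t = 1 + c \<integral>\<^sub>0\<^sup>t det v\<^sub>s ds\<close>.\<close>

section \<open>Lyapunov exponents and the determinant\<close>

text \<open>For k = 1 the matrices \<open>Df_j(x)\<close> are only C^1 functions of the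
  semimartingale \<open>x\<close>, so the integrands \<open>Y_j\<close> need not be semimartingales,
  and neither brackets nor Ito's formula are at hand for them. The substitute is boundedness in
  probability of quadratic sums along dyadic grids, a property that survives locally Lipschitz maps.
  A second obstacle is that the integrals \<open>J_j\<close> are given one time at a time, as limits
  in probability: nothing is known about their paths, and the trapezoidal error on a short interval
  comes without a rate, so the errors of 2^n cells cannot simply be added. Comparison with a much
  finer grid turns these errors into martingale transforms, controlled by second moments, and
  products of increments, which become small only through small weights. Small weights are obtained
  by subtracting values frozen on a coarse grid. Determinant and cofactors are used instead of the
  inverse of \<open>v\<close>, so all identities are polynomial and invertibility of
  \<open>v\<close> is never presupposed.\<close>

lemma inner_symmetric_matrix_vector:
  fixes A :: "real^'n^'n"
  assumes "transpose A = A"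
  shows "(A *v x) \<bullet> y = x \<bullet> (A *v y)"
  by (metis assms dot_lmul_matrix vector_transpose_matrix)

lemma quadratic_nonpos_imp_linear_zero:
  fixes p q :: real
  assumes "\<And>s. 2 * s * p \<le> s\<^sup>2 * q"
  shows "p = 0"
proof (rule ccontr)
  assume "p \<noteq> 0"
  \<comment> \<open>The choice s = e * p makes the quadratic term at most e * p^2, half of the
    linear term 2 * e * p^2; the 1 in the denominator covers q = 0.\<close>
  define e where "e = 1 / (1 + \<bar>q\<bar>)"
  have e: "e > 0" "e * \<bar>q\<bar> \<le> 1"
    unfolding e_def by (auto simp: divide_simps)
  have "2 * (e * p) * p \<le> (e * p)\<^sup>2 * q"
    by (rule assms)
  also have "\<dots> \<le> (e * p)\<^sup>2 * \<bar>q\<bar>"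
    by (intro mult_left_mono) auto
  also have "\<dots> = (e * p\<^sup>2) * (e * \<bar>q\<bar>)"
    by (simp add: power2_eq_square)
  also have "\<dots> \<le> (e * p\<^sup>2) * 1"
    using e by (intro mult_left_mono) auto
  finally have "e * p\<^sup>2 \<le> 0"
    by (simp add: power2_eq_square algebra_simps)
  with e(1) \<open>p \<noteq> 0\<close> show False
    by (simp add: mult_le_0_iff)
qed

text \<open>A maximiser u of the Rayleigh quotient on the unit sphere of \<open>S\<close> works: the
  first variation vanishes in all directions of \<open>S\<close> orthogonal to u, and w = A u - l u
  is such a direction, so w is orthogonal to both A u and u, hence to itself.\<close>

lemma symmetric_matrix_eigenvector_exists:
  fixes A :: "real^'n^'n"
  assumes sym: "transpose A = A" and S: "subspace S" "S \<noteq> {0}"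
    and inv: "\<And>x. x \<in> S \<Longrightarrow> A *v x \<in> S"
  obtains u l where "u \<in> S" "norm u = 1" "A *v u = l *\<^sub>R u"
proof -
  let ?K = "S \<inter> sphere 0 1"
  obtain x where x: "x \<in> S" "x \<noteq> 0"
    using S subspace_0 by blast
  have "x /\<^sub>R norm x \<in> ?K"
    using x S by (simp add: subspace_mul)
  then have ne: "?K \<noteq> {}" by blast
  have comp: "compact ?K"
    using closed_subspace[OF S(1)] by (intro closed_Int_compact) auto
  have cont: "continuous_on ?K (\<lambda>x. (A *v x) \<bullet> x)"
    by (intro continuous_intros)
  obtain u where u: "u \<in> ?K" and max: "\<And>y. y \<in> ?K \<Longrightarrow> (A *v y) \<bullet> y \<le> (A *v u) \<bullet> u"
    using continuous_attains_sup[OF comp ne cont] by blast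
  define l where "l = (A *v u) \<bullet> u"
  have uS: "u \<in> S" and un: "norm u = 1" using u by auto
  have bound: "(A *v y) \<bullet> y \<le> l * (y \<bullet> y)" if "y \<in> S" for y
  proof (cases "y = 0")
    case False
    have "y /\<^sub>R norm y \<in> ?K"
      using that False S by (simp add: subspace_mul)
    from max[OF this] have "(A *v y) \<bullet> y / (norm y)\<^sup>2 \<le> l"
      by (simp add: l_def matrix_vector_mult_scaleR power2_eq_square divide_inverse algebra_simps)
    then show ?thesis
      using False by (simp add: divide_le_eq power2_norm_eq_inner)
  qed simp
  \<comment> \<open>First-order optimality at u: \<open>bound\<close> is applied along the line u +
    s w for every real s, and the terms of order s must vanish.\<close>
  have orth: "(A *v u) \<bullet> w = 0" if w: "w \<in> S" "w \<bullet> u = 0" for w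
  proof (rule quadratic_nonpos_imp_linear_zero)
    fix s :: real
    have "u + s *\<^sub>R w \<in> S"
      using S uS w by (simp add: subspace_add subspace_mul)
    from bound[OF this]
    moreover have "(A *v u) \<bullet> u = l" by (simp add: l_def)
    ultimately
    have "l + 2 * s * ((A *v u) \<bullet> w) + s\<^sup>2 * ((A *v w) \<bullet> w) \<le> l * (1 + s\<^sup>2 * (w \<bullet> w))"
      using un w inner_symmetric_matrix_vector[OF sym, of w u]
      by (simp add: matrix_vector_right_distrib matrix_vector_mult_scaleR inner_simps
          power2_eq_square norm_eq_1 inner_commute algebra_simps)
    then show "2 * s * ((A *v u) \<bullet> w) \<le> s\<^sup>2 * (l * (w \<bullet> w) - (A *v w) \<bullet> w)"
      by (simp add: algebra_simps)
  qed
  define w where "w = A *v u - l *\<^sub>R u"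
  have "w \<in> S" unfolding w_def using S uS inv by (simp add: subspace_diff subspace_mul)
  moreover have "w \<bullet> u = 0" using un by (simp add: w_def inner_simps l_def norm_eq_1)
  ultimately have "(A *v u) \<bullet> w = 0" "u \<bullet> w = 0"
    using orth by (auto simp: inner_commute)
  then have "w \<bullet> w = 0"
    by (metis (no_types) w_def inner_diff_left inner_scaleR_left diff_zero mult_zero_right)
  then have "A *v u = l *\<^sub>R u" by (simp add: w_def)
  with uS un show thesis by (rule that)
qed

text \<open>The formulation for invariant subspaces is what the induction on the dimension requires:
  the complement of an eigenvector inside \<open>S\<close> is again invariant, by symmetry of
  \<open>A\<close>.\<close>

lemma symmetric_matrix_orthonormal_eigenbasis:
  fixes A :: "real^'n^'n"
  assumes sym: "transpose A = A" and S: "subspace S"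
    and inv: "\<And>x. x \<in> S \<Longrightarrow> A *v x \<in> S"
  shows "\<exists>B \<subseteq> S. finite B \<and> card B = dim S \<and> pairwise orthogonal B \<and>
    (\<forall>b\<in>B. norm b = 1 \<and> (\<exists>l. A *v b = l *\<^sub>R b))"
  using S inv
proof (induction "dim S" arbitrary: S)
  case 0
  then show ?case by (intro exI[of _ "{}"]) auto
next
  case (Suc n)
  have "S \<noteq> {0}" using Suc.hyps(2) by auto
  then obtain u l where u: "u \<in> S" "norm u = 1" "A *v u = l *\<^sub>R u"
    using symmetric_matrix_eigenvector_exists[OF sym] Suc.prems by metis
  define T where "T = {y \<in> S. \<forall>x\<in>span {u}. orthogonal x y}"
  have T: "y \<in> T \<longleftrightarrow> y \<in> S \<and> u \<bullet> y = 0" for y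
    by (auto simp: T_def span_singleton orthogonal_def)
  have "dim T + dim (span {u}) = dim S"
    unfolding T_def using u Suc.prems
    by (intro dim_subspace_orthogonal_to_vectors) (auto intro: span_minimal simp: span_minimal)
  moreover have "dim (span {u}) = 1"
    using u(2) by (subst dim_span, subst dim_singleton) auto
  ultimately have dT: "n = dim T" using Suc.hyps(2) by simp
  have "subspace T"
    using Suc.prems(1) by (auto simp: subspace_def T inner_simps)
  moreover have "A *v y \<in> T" if "y \<in> T" for y
    using that Suc.prems(2) u inner_symmetric_matrix_vector[OF sym, of u y] by (auto simp: T)
  ultimately obtain B where B: "B \<subseteq> T" "finite B" "card B = dim T" "pairwise orthogonal B"
      "\<forall>b\<in>B. norm b = 1 \<and> (\<exists>l. A *v b = l *\<^sub>R b)"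
    using Suc.hyps(1)[OF dT] by blast
  have "u \<notin> B" using B(1) u T by (auto simp: norm_eq_1)
  then show ?case
    using B u Suc.hyps(2) dT T
    by (intro exI[of _ "insert u B"])
       (auto simp: pairwise_insert orthogonal_def inner_commute subset_iff)
qed

lemma diag_matrix_mult_nth:
  "(U ** diag_matrix a) $ i $ j = U $ i $ j * a j"
  "(diag_matrix a ** U) $ i $ j = a i * U $ i $ j"
  by (simp_all add: matrix_matrix_mult_def diag_matrix_def if_distrib[of "\<lambda>x. _ * x"]
      if_distrib[of "\<lambda>x. x * _"] cong: if_cong)

lemma symmetric_matrix_diagonalizable:
  fixes A :: "real^'n^'n"
  assumes sym: "transpose A = A"
  obtains P a where "orthogonal_matrix P" "A = P ** diag_matrix a ** transpose P"
proof -
  obtain B where B: "finite B" "card B = CARD('n)" "pairwise orthogonal B"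
      "\<And>b. b \<in> B \<Longrightarrow> norm b = 1 \<and> (\<exists>l. A *v b = l *\<^sub>R b)"
    using symmetric_matrix_orthonormal_eigenbasis[OF sym subspace_UNIV] by auto
  obtain g :: "'n \<Rightarrow> real^'n" where g: "bij_betw g UNIV B"
    using finite_same_card_bij[OF finite B(1)] B(2) by auto
  then have gB: "g i \<in> B" for i by (rule bij_betwE[THEN bspec]) simp
  then have "\<forall>i. \<exists>l. A *v g i = l *\<^sub>R g i" using B(4) by blast
  then obtain a where a: "\<And>i. A *v g i = a i *\<^sub>R g i" by metis
  define P where "P = (\<chi> i j. g j $ i)"
  have col: "column j P = g j" for j by (simp add: P_def column_def)
  have "orthogonal (g i) (g j)" if "i \<noteq> j" for i j
    using B(3) gB that bij_betw_imp_inj_on[OF g] by (metis UNIV_I inj_onD pairwiseD)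
  then have P: "orthogonal_matrix P"
    unfolding orthogonal_matrix_orthonormal_columns col by (simp add: B(4) gB)
  have "A ** P = P ** diag_matrix a"
  proof -
    have "(A ** P) $ i $ j = (P ** diag_matrix a) $ i $ j" for i j
    proof -
      have "(A ** P) $ i $ j = (A *v g j) $ i"
        by (simp add: matrix_matrix_mult_def matrix_vector_mult_def P_def)
      also have "\<dots> = P $ i $ j * a j" by (simp add: a P_def)
      also have "\<dots> = (P ** diag_matrix a) $ i $ j"
        by (simp add: diag_matrix_mult_nth)
      finally show ?thesis .
    qed
    then show ?thesis by (simp add: vec_eq_iff)
  qed
  then have "A ** (P ** transpose P) = P ** diag_matrix a ** transpose P"
    by (simp add: matrix_mul_assoc)
  then have "A = P ** diag_matrix a ** transpose P"
    using P by (simp add: orthogonal_matrix_def)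
  with P show thesis by (rule that)
qed

text \<open>The change of basis between two diagonalizations intertwines the diagonal matrices, hence
  also every function of them.\<close>

lemma spectral_function_unique:
  fixes P Q :: "real^'n^'n"
  assumes P: "orthogonal_matrix P" and Q: "orthogonal_matrix Q"
    and eq: "P ** diag_matrix a ** transpose P = Q ** diag_matrix b ** transpose Q"
  shows "P ** diag_matrix (\<lambda>i. h (a i)) ** transpose P = Q ** diag_matrix (\<lambda>i. h (b i)) ** transpose Q"
proof -
  define U where "U = transpose Q ** P"
  have conj: "U ** diag_matrix a' = diag_matrix b' ** U \<longleftrightarrow>
      P ** diag_matrix a' ** transpose P = Q ** diag_matrix b' ** transpose Q" for a' b'
  proof
    assume "U ** diag_matrix a' = diag_matrix b' ** U"
    then have "Q ** (U ** diag_matrix a') ** transpose P = Q ** (diag_matrix b' ** U) ** transpose P"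
      by simp
    moreover have "Q ** (U ** diag_matrix a') ** transpose P
        = (Q ** transpose Q) ** (P ** diag_matrix a' ** transpose P)"
      by (simp add: U_def matrix_mul_assoc)
    moreover have "Q ** (diag_matrix b' ** U) ** transpose P
        = (Q ** diag_matrix b' ** transpose Q) ** (P ** transpose P)"
      by (simp add: U_def matrix_mul_assoc)
    ultimately show "P ** diag_matrix a' ** transpose P = Q ** diag_matrix b' ** transpose Q"
      using P Q by (simp add: orthogonal_matrix_def)
  next
    assume "P ** diag_matrix a' ** transpose P = Q ** diag_matrix b' ** transpose Q"
    then have "transpose Q ** (P ** diag_matrix a' ** transpose P) ** P
        = transpose Q ** (Q ** diag_matrix b' ** transpose Q) ** P" by simp
    moreover have "transpose Q ** (P ** diag_matrix a' ** transpose P) ** P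
        = U ** diag_matrix a' ** (transpose P ** P)"
      by (simp add: U_def matrix_mul_assoc)
    moreover have "transpose Q ** (Q ** diag_matrix b' ** transpose Q) ** P
        = (transpose Q ** Q) ** (diag_matrix b' ** U)"
      by (simp add: U_def matrix_mul_assoc)
    ultimately show "U ** diag_matrix a' = diag_matrix b' ** U"
      using P Q by (simp add: orthogonal_matrix_def)
  qed
  have "U ** diag_matrix a = diag_matrix b ** U" using conj eq by blast
  then have "U $ i $ j * a j = b i * U $ i $ j" for i j
    by (metis diag_matrix_mult_nth)
  \<comment> \<open>In each entry either U_ij = 0 or a_j = b_i, and both alternatives persist after
    applying h.\<close>
  then have "U $ i $ j * h (a j) = h (b i) * U $ i $ j" for i j
    by (metis mult.commute mult_right_cancel mult_zero_right)
  then have "U ** diag_matrix (\<lambda>i. h (a i)) = diag_matrix (\<lambda>i. h (b i)) ** U"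
    by (simp add: vec_eq_iff diag_matrix_mult_nth)
  then show ?thesis using conj by blast
qed

text \<open>The definite description is legitimate because any two diagonalizations yield the same
  power, by \<open>spectral_function_unique\<close> with the function
  \<open>\<lambda>y. y powr r\<close>.\<close>

lemma psd_powr_eq:
  fixes P :: "real^'n^'n"
  assumes "orthogonal_matrix P" "\<And>i. 0 \<le> a i"
  shows "psd_powr (P ** diag_matrix a ** transpose P) r
    = P ** diag_matrix (\<lambda>i. a i powr r) ** transpose P"
  unfolding psd_powr_def
proof (rule the_equality)
  show "\<exists>P' a'. orthogonal_matrix P' \<and> (\<forall>i. 0 \<le> a' i) \<and>
      P ** diag_matrix a ** transpose P = P' ** diag_matrix a' ** transpose P' \<and>
      P ** diag_matrix (\<lambda>i. a i powr r) ** transpose P =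
      P' ** diag_matrix (\<lambda>i. a' i powr r) ** transpose P'"
    using assms by blast
next
  fix B assume "\<exists>P' a'. orthogonal_matrix P' \<and> (\<forall>i. 0 \<le> a' i) \<and>
      P ** diag_matrix a ** transpose P = P' ** diag_matrix a' ** transpose P' \<and>
      B = P' ** diag_matrix (\<lambda>i. a' i powr r) ** transpose P'"
  then show "B = P ** diag_matrix (\<lambda>i. a i powr r) ** transpose P"
    using spectral_function_unique[OF assms(1), of _ a _ "\<lambda>y. y powr r"] by metis
qed

lemma det_diag_matrix: "det (diag_matrix a) = prod a UNIV"
  by (subst det_diagonal) (auto simp: diag_matrix_def)

lemma det_orthogonal_conjugate:
  fixes P :: "real^'n^'n"
  assumes "orthogonal_matrix P"
  shows "det (P ** D ** transpose P) = det D"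
proof -
  have "det P * det (transpose P) = det (P ** transpose P)" by (simp add: det_mul)
  also have "\<dots> = 1" using assms by (simp add: orthogonal_matrix_def)
  finally show ?thesis by (simp add: det_mul)
qed

lemma transpose_diag_matrix: "transpose (diag_matrix a) = diag_matrix a"
  by (auto simp: diag_matrix_def transpose_def vec_eq_iff)

lemma inner_conj_diag_matrix:
  fixes P :: "real^'n^'n"
  shows "(P ** diag_matrix a ** transpose P *v x) \<bullet> x = (\<Sum>i\<in>UNIV. a i * ((transpose P *v x) $ i)\<^sup>2)"
proof -
  have "(P ** diag_matrix a ** transpose P *v x) \<bullet> x
      = (P *v (diag_matrix a *v (transpose P *v x))) \<bullet> x"
    by (simp add: matrix_vector_mul_assoc matrix_mul_assoc del: transpose_matrix_vector)
  also have "\<dots> = (diag_matrix a *v (transpose P *v x)) \<bullet> (transpose P *v x)"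
    by (metis dot_lmul_matrix inner_commute vector_transpose_matrix transpose_transpose)
  also have "\<dots> = (\<Sum>i\<in>UNIV. a i * ((transpose P *v x) $ i)\<^sup>2)"
    by (simp add: inner_vec_def matrix_vector_mult_def diag_matrix_def power2_eq_square
        if_distrib[of "\<lambda>x. x * _"] mult.assoc cong: if_cong)
  finally show ?thesis .
qed

lemma symmetric_psd_diagonalizable:
  fixes A :: "real^'n^'n"
  assumes sym: "transpose A = A" and psd: "\<And>x. 0 \<le> (A *v x) \<bullet> x"
  obtains P a where "orthogonal_matrix P" "A = P ** diag_matrix a ** transpose P" "\<And>i. 0 \<le> a i"
proof -
  obtain P a where P: "orthogonal_matrix P" and A: "A = P ** diag_matrix a ** transpose P"
    using symmetric_matrix_diagonalizable[OF sym] .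
  have "0 \<le> a i" for i
  proof -
    \<comment> \<open>The vector \<open>P *v axis i 1\<close> is the i-th column of
      \<open>P\<close>, at which the quadratic form takes the value \<open>a i\<close>.\<close>
    have "transpose P *v (P *v axis i 1) = axis i 1"
      using P by (simp add: matrix_vector_mul_assoc orthogonal_matrix_def)
    then have "(A *v (P *v axis i 1)) \<bullet> (P *v axis i 1) = (\<Sum>j\<in>UNIV. a j * (axis i 1 $ j)\<^sup>2)"
      unfolding A inner_conj_diag_matrix by simp
    also have "\<dots> = a i"
      by (simp add: axis_def if_distrib[of "\<lambda>x. x\<^sup>2"] if_distrib[of "\<lambda>x. _ * x"] cong: if_cong)
    finally show ?thesis using psd by metis
  qed
  with P A show thesis by (rule that)
qed

text \<open>Symmetry, semidefiniteness and the determinant are the features of the power that pass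
  to a limit of matrices. The determinant follows from prod a = (det V)^2 and multiplicativity of
  \<open>powr\<close> on nonnegative factors.\<close>

lemma psd_powr_gram:
  fixes V :: "real^'n^'n" and r :: real
  assumes "det V \<noteq> 0"
  defines "B \<equiv> psd_powr (transpose V ** V) r"
  shows "transpose B = B" "0 \<le> (B *v x) \<bullet> x" "det B = \<bar>det V\<bar> powr (2 * r)"
proof -
  have "transpose (transpose V ** V) = transpose V ** V"
    by (simp add: matrix_transpose_mul)
  moreover have "0 \<le> (transpose V ** V *v x) \<bullet> x" for x
    by (metis dot_lmul_matrix inner_ge_zero matrix_vector_mul_assoc transpose_matrix_vector)
  ultimately obtain P a where P: "orthogonal_matrix P"
    and A: "transpose V ** V = P ** diag_matrix a ** transpose P" and a: "\<And>i. 0 \<le> a i"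
    using symmetric_psd_diagonalizable by blast
  have B: "B = P ** diag_matrix (\<lambda>i. a i powr r) ** transpose P"
    unfolding B_def A by (rule psd_powr_eq[OF P a])
  show "transpose B = B"
    by (simp add: B matrix_transpose_mul transpose_diag_matrix matrix_mul_assoc)
  show "0 \<le> (B *v x) \<bullet> x"
    unfolding B inner_conj_diag_matrix by (intro sum_nonneg) auto
  have "prod a UNIV = det (transpose V ** V)"
    by (simp add: A det_orthogonal_conjugate[OF P] det_diag_matrix)
  then have "prod a UNIV = \<bar>det V\<bar> powr 2"
    using assms by (simp add: det_mul power2_eq_square)
  then show "det B = \<bar>det V\<bar> powr (2 * r)"
    by (simp add: B det_orthogonal_conjugate[OF P] det_diag_matrix prod_powr_distrib[symmetric] powr_powr
        del: powr_numeral)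
qed

section \<open>Characteristic polynomials under orthogonal conjugation\<close>

definition const_poly_matrix :: "real^'n^'n \<Rightarrow> real poly^'n^'n" where
  "const_poly_matrix A = (\<chi> i j. [:A $ i $ j:])"

lemma const_poly_matrix_mult: "const_poly_matrix (A ** B) = const_poly_matrix A ** const_poly_matrix B"
  by (simp add: const_poly_matrix_def matrix_matrix_mult_def vec_eq_iff sum_to_poly mult.commute)

lemma const_poly_matrix_1: "const_poly_matrix (mat 1) = mat 1"
  by (auto simp: const_poly_matrix_def mat_def vec_eq_iff)

lemma charpoly_alt: "charpoly A = det (mat [:0, 1:] - const_poly_matrix A)"
  unfolding charpoly_def
  by (intro arg_cong[of _ _ det]) (simp add: const_poly_matrix_def mat_def vec_eq_iff)

lemma mat_mult_commute:
  fixes A :: "'a::comm_semiring_1^'n^'n"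
  shows "mat c ** A = A ** mat c"
  by (simp add: matrix_matrix_mult_def mat_def vec_eq_iff if_distrib[of "\<lambda>x. x * _"] 
      if_distrib[of "\<lambda>x. _ * x"] mult.commute cong: if_cong)

text \<open>Since constants embed multiplicatively into polynomials, X - P D P^T factors as P (X -
  D) P^T over the polynomial ring, where the scalar matrix X commutes with P; determinants are
  multiplicative there as well.\<close>

lemma charpoly_orthogonal_conjugate:
  fixes P :: "real^'n^'n"
  assumes "orthogonal_matrix P"
  shows "charpoly (P ** D ** transpose P) = charpoly D"
proof -
  let ?P = "const_poly_matrix P" and ?Q = "const_poly_matrix (transpose P)"
  have PQ: "?P ** ?Q = mat 1"
    using assms by (simp add: const_poly_matrix_mult[symmetric] orthogonal_matrix_def const_poly_matrix_1)
  have sub: "X ** (Y - Z) = X ** Y - X ** Z" "(Y - Z) ** X = Y ** X - Z ** X"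
    for X Y Z :: "real poly^'n^'n"
    by (simp_all add: matrix_matrix_mult_def vec_eq_iff algebra_simps sum_subtractf)
  have "?P ** (mat [:0, 1:] - const_poly_matrix D) ** ?Q
      = mat [:0, 1:] ** (?P ** ?Q) - ?P ** const_poly_matrix D ** ?Q"
    by (simp only: sub mat_mult_commute[symmetric] matrix_mul_assoc)
  then have "mat [:0, 1:] - const_poly_matrix (P ** D ** transpose P)
      = ?P ** (mat [:0, 1:] - const_poly_matrix D) ** ?Q"
    by (simp only: PQ matrix_mul_rid const_poly_matrix_mult)
  moreover have "det ?P * det ?Q = 1" by (simp add: det_mul[symmetric] PQ)
  ultimately show ?thesis
    by (simp add: charpoly_alt det_mul mult.commute mult.left_commute)
qed

lemma proots_charpoly_diag_matrix: "proots (charpoly (diag_matrix a)) = image_mset a (mset_set UNIV)"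
proof -
  have "charpoly (diag_matrix a) = (\<Prod>i\<in>UNIV. [:- a i, 1:])"
    unfolding charpoly_def
    by (subst det_diagonal) (auto simp: diag_matrix_def)
  then have "proots (charpoly (diag_matrix a)) = (\<Sum>i\<in>UNIV. {#a i#})"
    by (simp add: proots_prod)
  also have "\<dots> = image_mset a (mset_set UNIV)"
    by (simp add: sum_unfold_sum_mset)
  finally show ?thesis .
qed

text \<open>A positive determinant excludes the eigenvalue 0, so \<open>ln_ext\<close> never takes
  the value -\<infinity> and the extended sum is the logarithm of the product of the
  eigenvalues.\<close>

lemma sum_ln_ext_charpoly:
  fixes A :: "real^'n^'n"
  assumes "transpose A = A" "\<And>x. 0 \<le> (A *v x) \<bullet> x" "det A = exp c"
  shows "(\<Sum>l\<in>#image_mset ln_ext (proots (charpoly A)). l) = ereal c"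
proof -
  obtain P a where P: "orthogonal_matrix P" and A: "A = P ** diag_matrix a ** transpose P"
    and a: "\<And>i. 0 \<le> a i"
    using symmetric_psd_diagonalizable[OF assms(1,2)] by blast
  have pa: "prod a UNIV = exp c"
    using assms(3) by (simp add: A det_orthogonal_conjugate[OF P] det_diag_matrix)
  have "a i \<noteq> 0" for i
  proof
    assume "a i = 0"
    then have "prod a UNIV = 0" by (intro prod_zero) auto
    with pa show False by simp
  qed
  then have pos: "a i > 0" for i using a[of i] by (metis less_le)
  have "(\<Sum>l\<in>#image_mset ln_ext (proots (charpoly A)). l) = (\<Sum>i\<in>UNIV. ln_ext (a i))"
    by (simp add: A charpoly_orthogonal_conjugate[OF P] proots_charpoly_diag_matrix
        image_mset.compositionality comp_def sum_unfold_sum_mset)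
  also have "\<dots> = (\<Sum>i\<in>UNIV. ereal (ln (a i)))"
    using \<open>\<And>i. a i \<noteq> 0\<close> by (simp add: ln_ext_def)
  also have "\<dots> = ereal (ln (prod a UNIV))"
    using \<open>\<And>i. a i \<noteq> 0\<close> by (simp add: ln_prod)
  finally show ?thesis by (simp add: pa)
qed

section \<open>Passage to the limit in time\<close>

lemma continuous_det: "continuous_on UNIV (det :: real^'n^'n \<Rightarrow> real)"
  unfolding det_def by (intro continuous_intros)

text \<open>Being symmetric, positive semidefinite and of determinant exp c are closed conditions
  that hold at every positive time, hence for the limit \<Phi>.\<close>

lemma sum_lyapunov_exponents:
  fixes V :: "real \<Rightarrow> real^'n^'n"
  assumes det: "\<And>t. t > 0 \<Longrightarrow> det (V t) = exp (c * t)"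
    and lim: "(lyapunov_root V \<longlongrightarrow> \<Phi>) at_top"
  shows "(\<Sum>l\<in>#lyapunov_exponents V. l) = ereal c"
proof -
  have ev: "\<forall>\<^sub>F t in at_top. transpose (lyapunov_root V t) = lyapunov_root V t \<and>
      (\<forall>x. 0 \<le> (lyapunov_root V t *v x) \<bullet> x) \<and> det (lyapunov_root V t) = exp c"
    using eventually_gt_at_top[of "0::real"]
  proof eventually_elim
    case (elim t)
    \<comment> \<open>For r = 1 / (2 t) the exponent 2 r of \<open>psd_powr_gram\<close> is 1 / t,
      which cancels the factor t in exp (c t).\<close>
    have "det (V t) \<noteq> 0" "\<bar>det (V t)\<bar> powr (2 * (1 / (2 * t))) = exp c"
      using elim by (simp_all add: det powr_def)
    with psd_powr_gram[of "V t" "1 / (2 * t)"] show ?case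
      by (simp add: lyapunov_root_def)
  qed
  have "((\<lambda>t. transpose (lyapunov_root V t)) \<longlongrightarrow> transpose \<Phi>) at_top"
    unfolding transpose_def by (intro tendsto_intros lim)
  moreover have "((\<lambda>t. transpose (lyapunov_root V t)) \<longlongrightarrow> \<Phi>) at_top"
    by (rule Lim_transform_eventually[OF lim]) (use ev in eventually_elim, simp)
  ultimately have 1: "transpose \<Phi> = \<Phi>"
    by (intro tendsto_unique) auto
  have 2: "0 \<le> (\<Phi> *v x) \<bullet> x" for x
  proof (rule tendsto_lowerbound)
    show "((\<lambda>t. (lyapunov_root V t *v x) \<bullet> x) \<longlongrightarrow> (\<Phi> *v x) \<bullet> x) at_top"
      unfolding matrix_vector_mult_def by (intro tendsto_intros lim)
    show "\<forall>\<^sub>F t in at_top. 0 \<le> (lyapunov_root V t *v x) \<bullet> x"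
      using ev by eventually_elim auto
  qed auto
  have "((\<lambda>t. det (lyapunov_root V t)) \<longlongrightarrow> det \<Phi>) at_top"
    using continuous_det lim
    by (intro continuous_on_tendsto_compose[where s = UNIV and f = det]) auto
  moreover have "((\<lambda>t. det (lyapunov_root V t)) \<longlongrightarrow> exp c) at_top"
    by (rule tendsto_eventually) (use ev in eventually_elim, simp)
  ultimately have 3: "det \<Phi> = exp c"
    by (intro tendsto_unique) auto
  have "Lim at_top (lyapunov_root V) = \<Phi>"
    by (intro tendsto_Lim lim) auto
  with sum_ln_ext_charpoly[OF 1 2 3] show ?thesis
    by (simp add: lyapunov_exponents_def)
qed

section \<open>Convergence and boundedness in probability\<close>

text \<open>Exceptional sets are only required to be contained in a small measurable set, so that neither
  the event \<open>Q\<close> nor the variables \<open>X n\<close> below need to be measurable.\<close>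

definition whp :: "'w measure \<Rightarrow> real \<Rightarrow> ('w \<Rightarrow> bool) \<Rightarrow> bool" where
  "whp M \<eta> Q \<longleftrightarrow> (\<exists>B\<in>sets M. measure M B \<le> \<eta> \<and> (\<forall>w\<in>space M - B. Q w))"

definition conv0 :: "'w measure \<Rightarrow> (nat \<Rightarrow> 'w \<Rightarrow> real) \<Rightarrow> bool" where
  "conv0 M X \<longleftrightarrow> (\<forall>\<epsilon>>0. \<forall>\<eta>>0. \<forall>\<^sub>F n in sequentially. whp M \<eta> (\<lambda>w. \<bar>X n w\<bar> \<le> \<epsilon>))"

definition stoch_bounded :: "'w measure \<Rightarrow> (nat \<Rightarrow> 'w \<Rightarrow> real) \<Rightarrow> bool" where
  "stoch_bounded M X \<longleftrightarrow> (\<forall>\<eta>>0. \<exists>K. \<forall>n. whp M \<eta> (\<lambda>w. \<bar>X n w\<bar> \<le> K))"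

section \<open>Calculus of events of high probability\<close>

lemma whp_mono:
  assumes "whp M \<eta> P" "\<eta> \<le> \<eta>'" "\<And>w. w \<in> space M \<Longrightarrow> P w \<Longrightarrow> Q w"
  shows "whp M \<eta>' Q"
  using assms unfolding whp_def by (meson DiffD1 order_trans)

lemma whp_AE:
  assumes "AE w in M. Q w" "0 \<le> \<eta>"
  shows "whp M \<eta> Q"
proof -
  obtain N where "N \<in> null_sets M" "{w \<in> space M. \<not> Q w} \<subseteq> N"
    using assms(1) by (auto simp: eventually_ae_filter)
  with assms(2) show ?thesis
    unfolding whp_def by (intro bexI[of _ N]) (auto simp: measure_eq_0_null_sets)
qed

lemma pred_countable_Ball:
  assumes "countable I" "\<And>i. i \<in> I \<Longrightarrow> Measurable.pred M (P i)"
  shows "Measurable.pred M (\<lambda>w. \<forall>i\<in>I. P i w)"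
proof (cases "I = {}")
  case False
  then have "(\<lambda>w. \<forall>i\<in>I. P i w) = (\<lambda>w. \<forall>n. P (from_nat_into I n) w)"
    by (subst range_from_nat_into[OF False assms(1), symmetric]) auto
  moreover have "Measurable.pred M (\<lambda>w. \<forall>n. P (from_nat_into I n) w)"
    using assms(2) from_nat_into[OF False] by (intro pred_intros_countable) auto
  ultimately show ?thesis by simp
qed simp

lemma conv0D: "conv0 M X \<Longrightarrow> \<epsilon> > 0 \<Longrightarrow> \<eta> > 0 \<Longrightarrow> \<forall>\<^sub>F n in sequentially. whp M \<eta> (\<lambda>w. \<bar>X n w\<bar> \<le> \<epsilon>)"
  by (simp add: conv0_def)

lemma stoch_boundedE:
  assumes "stoch_bounded M X" "\<eta> > 0"
  obtains K where "K > 0" "\<And>n. whp M \<eta> (\<lambda>w. \<bar>X n w\<bar> \<le> K)"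
proof -
  obtain K where "\<And>n. whp M \<eta> (\<lambda>w. \<bar>X n w\<bar> \<le> K)"
    using assms unfolding stoch_bounded_def by blast
  then have "whp M \<eta> (\<lambda>w. \<bar>X n w\<bar> \<le> max K 1)" for n
    by (rule whp_mono[where P = "\<lambda>w. \<bar>X n w\<bar> \<le> K"]) auto
  then show thesis by (intro that[of "max K 1"]) auto
qed

context prob_space
begin

lemma whp_conj:
  assumes "whp M \<eta>1 P" "whp M \<eta>2 Q" "\<eta>1 + \<eta>2 \<le> \<eta>"
  shows "whp M \<eta> (\<lambda>w. P w \<and> Q w)"
proof -
  obtain A B where A: "A \<in> events" "prob A \<le> \<eta>1" "\<forall>w\<in>space M - A. P w"
    and B: "B \<in> events" "prob B \<le> \<eta>2" "\<forall>w\<in>space M - B. Q w"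
    using assms unfolding whp_def by metis
  have "prob (A \<union> B) \<le> \<eta>"
    using measure_Un_le[OF A(1) B(1)] A(2) B(2) assms(3) by linarith
  with A B show ?thesis unfolding whp_def by (intro bexI[of _ "A \<union> B"]) auto
qed

lemma whp_AE_mp:
  assumes "whp M \<eta> P" "AE w in M. P w \<longrightarrow> Q w"
  shows "whp M \<eta> Q"
  by (rule whp_mono[OF whp_conj[OF assms(1) whp_AE[OF assms(2) order_refl]], of \<eta>]) auto

lemma whp_ball:
  assumes "finite I" "\<And>i. i \<in> I \<Longrightarrow> whp M (\<eta> i) (Q i)"
  shows "whp M (\<Sum>i\<in>I. \<eta> i) (\<lambda>w. \<forall>i\<in>I. Q i w)"
  using assms
proof (induction I rule: finite_induct)
  case empty
  then show ?case by (intro whp_AE) auto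
next
  case (insert i I)
  then have "whp M (\<eta> i + sum \<eta> I) (\<lambda>w. Q i w \<and> (\<forall>i\<in>I. Q i w))"
    by (intro whp_conj) auto
  then show ?case
    using insert by (auto elim!: whp_mono)
qed

lemma AE_I_whp:
  assumes "\<And>\<eta>. \<eta> > 0 \<Longrightarrow> whp M \<eta> Q"
  shows "AE w in M. Q w"
proof -
  have "\<forall>n. \<exists>B\<in>events. prob B \<le> 1 / real (Suc n) \<and> (\<forall>w\<in>space M - B. Q w)"
    using assms unfolding whp_def by (intro allI) (auto simp del: of_nat_Suc)
  then obtain B where B: "\<And>n. B n \<in> events" "\<And>n. prob (B n) \<le> 1 / real (Suc n)"
      "\<And>n w. w \<in> space M - B n \<Longrightarrow> Q w"
    by metis
  have "prob (\<Inter>n. B n) \<le> 1 / real (Suc n)" for n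
    by (rule order_trans[OF finite_measure_mono B(2)]) (use B(1) in auto)
  then have "prob (\<Inter>n. B n) \<le> 0"
    by (intro LIMSEQ_le_const[OF LIMSEQ_Suc[OF lim_1_over_n]]) auto
  then have "(\<Inter>n. B n) \<in> null_sets M"
    using B(1) by (intro null_setsI) (auto simp: emeasure_eq_measure measure_le_0_iff)
  then show ?thesis
    by (rule AE_I') (use B(3) in auto)
qed

text \<open>Passes from a random threshold index to a deterministic one: the events that
  \<open>Q\<close> fails at some index beyond n decrease to a null set, so their probabilities tend
  to 0.\<close>

lemma whp_AE_eventually:
  assumes meas: "\<And>n. Measurable.pred M (Q n)"
    and ev: "AE w in M. \<forall>\<^sub>F n in sequentially. Q n w" and "\<eta> > 0"
  shows "\<forall>\<^sub>F n in sequentially. whp M \<eta> (Q n)"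
proof -
  note [measurable] = meas
  define A where "A n = {w \<in> space M. \<exists>m\<ge>n. \<not> Q m w}" for n
  have A [measurable]: "A n \<in> events" for n unfolding A_def by measurable
  have "decseq A" by (auto simp: decseq_def A_def) (meson order_trans)
  then have "(\<lambda>n. prob (A n)) \<longlonglongrightarrow> prob (\<Inter>n. A n)"
    using A by (intro finite_Lim_measure_decseq) auto
  moreover have "AE w in M. w \<notin> (\<Inter>n. A n)"
    using ev by eventually_elim (auto simp: A_def eventually_sequentially)
  then have "prob (\<Inter>n. A n) = 0"
    using A by (subst prob_eq_0) auto
  ultimately have "\<forall>\<^sub>F n in sequentially. prob (A n) < \<eta>"
    using \<open>\<eta> > 0\<close> by (intro order_tendstoD) auto
  then show ?thesis
  proof eventually_elim
    case (elim n)
    then show ?case unfolding whp_def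
      by (intro bexI[of _ "A n"]) (auto simp: A_def)
  qed
qed

section \<open>Convergence to 0 in probability\<close>

lemma conv0_add:
  assumes "conv0 M X" "conv0 M Y"
  shows "conv0 M (\<lambda>n w. X n w + Y n w)"
  unfolding conv0_def
proof (intro allI impI)
  fix \<epsilon> \<eta> :: real assume "\<epsilon> > 0" "\<eta> > 0"
  then have "\<forall>\<^sub>F n in sequentially. whp M (\<eta>/2) (\<lambda>w. \<bar>X n w\<bar> \<le> \<epsilon>/2)"
      "\<forall>\<^sub>F n in sequentially. whp M (\<eta>/2) (\<lambda>w. \<bar>Y n w\<bar> \<le> \<epsilon>/2)"
    by (auto intro!: conv0D assms simp del: divide_le_eq_numeral1 le_divide_eq_numeral1)
  then show "\<forall>\<^sub>F n in sequentially. whp M \<eta> (\<lambda>w. \<bar>X n w + Y n w\<bar> \<le> \<epsilon>)"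
  proof eventually_elim
    case (elim n)
    show ?case by (rule whp_mono[OF whp_conj[OF elim, where \<eta> = \<eta>]]) auto
  qed
qed

lemma conv0_sum:
  assumes "\<And>i. i \<in> I \<Longrightarrow> conv0 M (X i)"
  shows "conv0 M (\<lambda>n w. \<Sum>i\<in>I. X i n w)"
  using assms
proof (induction I rule: infinite_finite_induct)
  case (insert i I)
  then show ?case by (simp add: conv0_add)
qed (auto simp: conv0_def intro!: always_eventually whp_AE)

text \<open>As the bound may fail on a null set depending on n, this also serves to replace a
  sequence by one that agrees with it almost surely for each n.\<close>

lemma conv0_dominated:
  assumes "conv0 M X" "\<And>n. AE w in M. \<bar>Y n w\<bar> \<le> \<bar>X n w\<bar>"
  shows "conv0 M Y"
  unfolding conv0_def
proof (intro allI impI)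
  fix \<epsilon> \<eta> :: real assume "\<epsilon> > 0" "\<eta> > 0"
  from conv0D[OF assms(1) this] show "\<forall>\<^sub>F n in sequentially. whp M \<eta> (\<lambda>w. \<bar>Y n w\<bar> \<le> \<epsilon>)"
  proof eventually_elim
    case (elim n)
    show ?case by (rule whp_AE_mp[OF elim]) (use assms(2)[of n] in auto)
  qed
qed

lemma conv0_minus: "conv0 M X \<Longrightarrow> conv0 M (\<lambda>n w. - X n w)"
  by (erule conv0_dominated) auto

lemma conv0_diff: "conv0 M X \<Longrightarrow> conv0 M Y \<Longrightarrow> conv0 M (\<lambda>n w. X n w - Y n w)"
  using conv0_add[of X "\<lambda>n w. - Y n w"] conv0_minus[of Y] by simp

lemma conv0_mult_bounded:
  assumes "conv0 M X" "stoch_bounded M Y"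
  shows "conv0 M (\<lambda>n w. X n w * Y n w)"
  unfolding conv0_def
proof (intro allI impI)
  fix \<epsilon> \<eta> :: real assume pos: "\<epsilon> > 0" "\<eta> > 0"
  obtain K where K: "K > 0" "\<And>n. whp M (\<eta>/2) (\<lambda>w. \<bar>Y n w\<bar> \<le> K)"
    using stoch_boundedE[OF assms(2), of "\<eta>/2"] pos by auto
  have "\<forall>\<^sub>F n in sequentially. whp M (\<eta>/2) (\<lambda>w. \<bar>X n w\<bar> \<le> \<epsilon> / K)"
    using pos K by (intro conv0D assms) auto
  then show "\<forall>\<^sub>F n in sequentially. whp M \<eta> (\<lambda>w. \<bar>X n w * Y n w\<bar> \<le> \<epsilon>)"
  proof eventually_elim
    case (elim n)
    show ?case
    proof (rule whp_mono[OF whp_conj[OF elim K(2), where \<eta> = \<eta>]])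
      fix w assume "\<bar>X n w\<bar> \<le> \<epsilon> / K \<and> \<bar>Y n w\<bar> \<le> K"
      then have "\<bar>X n w\<bar> * \<bar>Y n w\<bar> \<le> (\<epsilon> / K) * K"
        using K(1) pos by (intro mult_mono) auto
      then show "\<bar>X n w * Y n w\<bar> \<le> \<epsilon>" using K(1) by (simp add: abs_mult)
    qed auto
  qed
qed

lemma conv0_const_imp_AE_zero:
  assumes "conv0 M (\<lambda>n. X)"
  shows "AE w in M. X w = 0"
proof -
  have "AE w in M. \<forall>k. \<bar>X w\<bar> \<le> 1 / real (Suc k)"
    unfolding AE_all_countable
  proof
    fix k show "AE w in M. \<bar>X w\<bar> \<le> 1 / real (Suc k)"
      by (rule AE_I_whp) (use conv0D[OF assms, of "1 / real (Suc k)"] in auto)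
  qed
  then show ?thesis
  proof eventually_elim
    case (elim w)
    have "\<bar>X w\<bar> \<le> 0"
      by (rule LIMSEQ_le_const[OF LIMSEQ_Suc[OF lim_1_over_n]]) (use elim in auto)
    then show ?case by simp
  qed
qed

section \<open>Boundedness in probability\<close>

lemma stoch_bounded_dominated:
  assumes "stoch_bounded M X" "\<And>n. AE w in M. \<bar>Y n w\<bar> \<le> \<bar>X n w\<bar>"
  shows "stoch_bounded M Y"
  unfolding stoch_bounded_def
proof (intro allI impI)
  fix \<eta> :: real assume "\<eta> > 0"
  then obtain K where K: "\<And>n. whp M \<eta> (\<lambda>w. \<bar>X n w\<bar> \<le> K)"
    using assms(1) unfolding stoch_bounded_def by blast
  have "whp M \<eta> (\<lambda>w. \<bar>Y n w\<bar> \<le> K)" for n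
    by (rule whp_AE_mp[OF K[of n]]) (use assms(2)[of n] in auto)
  then show "\<exists>K. \<forall>n. whp M \<eta> (\<lambda>w. \<bar>Y n w\<bar> \<le> K)" by blast
qed

lemma stoch_bounded_add:
  assumes "stoch_bounded M X" "stoch_bounded M Y"
  shows "stoch_bounded M (\<lambda>n w. X n w + Y n w)"
  unfolding stoch_bounded_def
proof (intro allI impI)
  fix \<eta> :: real assume "\<eta> > 0"
  then have h: "\<eta>/2 > 0" by simp
  obtain K where K: "\<And>n. whp M (\<eta>/2) (\<lambda>w. \<bar>X n w\<bar> \<le> K)"
    using assms(1) h unfolding stoch_bounded_def by blast
  obtain L where L: "\<And>n. whp M (\<eta>/2) (\<lambda>w. \<bar>Y n w\<bar> \<le> L)"
    using assms(2) h unfolding stoch_bounded_def by blast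
  have "whp M \<eta> (\<lambda>w. \<bar>X n w + Y n w\<bar> \<le> K + L)" for n
    by (rule whp_mono[OF whp_conj[OF K[of n] L[of n], where \<eta> = \<eta>]]) auto
  then show "\<exists>K. \<forall>n. whp M \<eta> (\<lambda>w. \<bar>X n w + Y n w\<bar> \<le> K)" by blast
qed

lemma stoch_bounded_sum:
  assumes "\<And>i. i \<in> I \<Longrightarrow> stoch_bounded M (X i)"
  shows "stoch_bounded M (\<lambda>n w. \<Sum>i\<in>I. X i n w)"
  using assms
proof (induction I rule: infinite_finite_induct)
  case (insert i I)
  then show ?case by (simp add: stoch_bounded_add)
qed (auto simp: stoch_bounded_def intro!: exI[of _ 0] whp_AE)

lemma stoch_bounded_cmult:
  assumes "stoch_bounded M X"
  shows "stoch_bounded M (\<lambda>n w. c * X n w)"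
  unfolding stoch_bounded_def
proof (intro allI impI)
  fix \<eta> :: real assume "\<eta> > 0"
  then obtain K where K: "\<And>n. whp M \<eta> (\<lambda>w. \<bar>X n w\<bar> \<le> K)"
    using assms(1) unfolding stoch_bounded_def by blast
  have "whp M \<eta> (\<lambda>w. \<bar>c * X n w\<bar> \<le> \<bar>c\<bar> * K)" for n
    by (rule whp_mono[OF K[of n]]) (auto simp: abs_mult mult_left_mono)
  then show "\<exists>K. \<forall>n. whp M \<eta> (\<lambda>w. \<bar>c * X n w\<bar> \<le> K)" by blast
qed

text \<open>The supremum over n is almost surely finite, so a deterministic level exceeds it with
  probability close to 1.\<close>

lemma stoch_bounded_pathwise:
  assumes [measurable]: "\<And>n. X n \<in> borel_measurable M"
    and "AE w in M. \<exists>K. \<forall>n. \<bar>X n w\<bar> \<le> K"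
  shows "stoch_bounded M X"
  unfolding stoch_bounded_def
proof (intro allI impI)
  fix \<eta> :: real assume "\<eta> > 0"
  have "\<forall>\<^sub>F k in sequentially. whp M \<eta> (\<lambda>w. \<forall>n. \<bar>X n w\<bar> \<le> real k)"
  proof (rule whp_AE_eventually)
    show "AE w in M. \<forall>\<^sub>F k in sequentially. \<forall>n. \<bar>X n w\<bar> \<le> real k"
      using assms(2)
    proof eventually_elim
      case (elim w)
      then obtain K where K: "\<And>n. \<bar>X n w\<bar> \<le> K" by blast
      show ?case
        using eventually_ge_at_top[of "nat \<lceil>K\<rceil>"]
        by eventually_elim (use K in \<open>auto intro: order_trans simp: nat_le_iff ceiling_le_iff\<close>)
    qed
  qed (use \<open>\<eta> > 0\<close> in measurable)
  then obtain k :: nat where "whp M \<eta> (\<lambda>w. \<forall>n. \<bar>X n w\<bar> \<le> real k)"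
    by (auto simp: eventually_sequentially)
  then show "\<exists>K. \<forall>n. whp M \<eta> (\<lambda>w. \<bar>X n w\<bar> \<le> K)"
    by (intro exI[of _ "real k"] allI) (erule whp_mono, auto)
qed

lemma stoch_bounded_expectation:
  assumes "\<And>n. integrable M (X n)" "\<And>n. AE w in M. 0 \<le> X n w" "\<And>n. expectation (X n) \<le> C"
  shows "stoch_bounded M X"
  unfolding stoch_bounded_def
proof (intro allI impI)
  fix \<eta> :: real assume "\<eta> > 0"
  \<comment> \<open>Chosen so that Markov's inequality gives at most \<eta>; the added 1 keeps
    \<open>K\<close> positive when C = 0.\<close>
  define K where "K = (\<bar>C\<bar> + 1) / \<eta>"
  have K: "K > 0" using \<open>\<eta> > 0\<close> by (simp add: K_def)
  have "whp M \<eta> (\<lambda>w. \<bar>X n w\<bar> \<le> K)" for n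
  proof -
    have [measurable]: "X n \<in> borel_measurable M" using assms(1) by auto
    have "prob {w \<in> space M. K \<le> X n w} \<le> expectation (X n) / K"
      by (rule integral_Markov_inequality_measure[where A = "{}"]) (use assms K in auto)
    also have "\<dots> \<le> (\<bar>C\<bar> + 1) / K"
      using K assms(3)[of n] by (intro divide_right_mono) auto
    also have "\<dots> = \<eta>" using \<open>\<eta> > 0\<close> by (auto simp: K_def)
    finally have "whp M \<eta> (\<lambda>w. X n w < K)"
      unfolding whp_def by (intro bexI[of _ "{w \<in> space M. K \<le> X n w}"]) auto
    then show ?thesis
      by (rule whp_AE_mp) (use assms(2)[of n] in auto)
  qed
  then show "\<exists>K. \<forall>n. whp M \<eta> (\<lambda>w. \<bar>X n w\<bar> \<le> K)" by blast
qed

text \<open>A continuous path is uniformly continuous on the compact interval, but with a random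
  \<delta>. Restricted to a countable dense set of times the condition is a measurable event, so
  \<open>whp_AE_eventually\<close> supplies a deterministic \<delta>; continuity of the path returns
  to all times.\<close>

lemma whp_paths_modulus:
  fixes X :: "real \<Rightarrow> 'a \<Rightarrow> 'b::euclidean_space"
  assumes meas: "\<And>s. s \<in> {0..t} \<Longrightarrow> X s \<in> borel_measurable M"
    and cont: "continuous_paths M X" and pos: "\<epsilon> > 0" "\<eta> > 0"
  obtains \<delta> where "\<delta> > 0"
    "whp M \<eta> (\<lambda>w. \<forall>s\<in>{0..t}. \<forall>u\<in>{0..t}. \<bar>s - u\<bar> < \<delta> \<longrightarrow> norm (X s w - X u w) \<le> \<epsilon>)"
proof -
  obtain T where T: "countable T" "T \<subseteq> {0..t}" "{0..t} \<subseteq> closure T"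
    using separable[of "{0..t}"] by blast
  define Q where "Q n w \<longleftrightarrow> (\<forall>s\<in>T. \<forall>u\<in>T. \<bar>s - u\<bar> < 1 / real (Suc n) \<longrightarrow> norm (X s w - X u w) \<le> \<epsilon>)"
    for n w
  have cont': "AE w in M. continuous_on {0..t} (\<lambda>s. X s w)"
    using cont unfolding continuous_paths_def
    by eventually_elim (rule continuous_on_subset, auto)
  have "\<forall>\<^sub>F n in sequentially. whp M \<eta> (Q n)"
  proof (rule whp_AE_eventually[OF _ _ pos(2)])
    show "Measurable.pred M (Q n)" for n
      unfolding Q_def
    proof (intro pred_countable_Ball T(1))
      fix s u assume su: "s \<in> T" "u \<in> T"
      then have [measurable]: "X s \<in> borel_measurable M" "X u \<in> borel_measurable M"
        using T(2) meas by auto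
      show "Measurable.pred M (\<lambda>w. \<bar>s - u\<bar> < 1 / real (Suc n) \<longrightarrow> norm (X s w - X u w) \<le> \<epsilon>)"
        by measurable
    qed
    show "AE w in M. \<forall>\<^sub>F n in sequentially. Q n w"
      using cont'
    proof eventually_elim
      case (elim w)
      then have "uniformly_continuous_on {0..t} (\<lambda>s. X s w)"
        by (rule compact_uniformly_continuous) auto
      then obtain d where d: "d > 0"
        "\<And>s u. s \<in> {0..t} \<Longrightarrow> u \<in> {0..t} \<Longrightarrow> dist u s < d \<Longrightarrow> dist (X u w) (X s w) < \<epsilon>"
        using pos(1) unfolding uniformly_continuous_on_def by metis
      have "\<forall>\<^sub>F n in sequentially. 1 / real (Suc n) < d"
        using order_tendstoD(2)[OF LIMSEQ_Suc[OF lim_1_over_n] d(1)] by simp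
      then show ?case
      proof eventually_elim
        case (elim n)
        have "dist (X s w) (X u w) < \<epsilon>" if "s \<in> T" "u \<in> T" "\<bar>s - u\<bar> < 1 / real (Suc n)" for s u
          using that elim T(2) by (intro d(2)) (auto simp: dist_real_def simp del: of_nat_Suc)
        then show ?case unfolding Q_def dist_norm by (meson less_imp_le)
      qed
    qed
  qed
  then obtain n where n: "whp M \<eta> (Q n)" by (auto simp: eventually_sequentially)
  show thesis
  proof (rule that)
    show "1 / real (Suc n) > 0" by simp
    show "whp M \<eta> (\<lambda>w. \<forall>s\<in>{0..t}. \<forall>u\<in>{0..t}. \<bar>s - u\<bar> < 1 / real (Suc n) \<longrightarrow> norm (X s w - X u w) \<le> \<epsilon>)"
    proof (rule whp_mono[OF whp_conj[OF n whp_AE[OF cont' order_refl], where \<eta> = \<eta>]])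
      fix w assume *: "Q n w \<and> continuous_on {0..t} (\<lambda>s. X s w)"
      show "\<forall>s\<in>{0..t}. \<forall>u\<in>{0..t}. \<bar>s - u\<bar> < 1 / real (Suc n) \<longrightarrow> norm (X s w - X u w) \<le> \<epsilon>"
      proof (intro ballI impI)
        fix s u assume su: "s \<in> {0..t}" "u \<in> {0..t}" "\<bar>s - u\<bar> < 1 / real (Suc n)"
        obtain a b where ab: "\<And>k. a k \<in> T" "a \<longlonglongrightarrow> s" "\<And>k. b k \<in> T" "b \<longlonglongrightarrow> u"
          using su T(3) by (metis closure_sequential subsetD)
        have lim: "(\<lambda>k. norm (X (a k) w - X (b k) w)) \<longlonglongrightarrow> norm (X s w - X u w)"
        proof (intro tendsto_intros continuous_on_tendsto_compose[where f = "\<lambda>s. X s w"])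
          show "\<forall>\<^sub>F k in sequentially. a k \<in> {0..t}" "\<forall>\<^sub>F k in sequentially. b k \<in> {0..t}"
            using ab T(2) by (blast intro: always_eventually)+
        qed (use * ab su in auto)
        have "(\<lambda>k. \<bar>a k - b k\<bar>) \<longlonglongrightarrow> \<bar>s - u\<bar>" by (intro tendsto_intros ab)
        from order_tendstoD(2)[OF this su(3)]
        have "\<forall>\<^sub>F k in sequentially. norm (X (a k) w - X (b k) w) \<le> \<epsilon>"
          by eventually_elim (use * ab in \<open>auto simp: Q_def\<close>)
        then show "norm (X s w - X u w) \<le> \<epsilon>"
          by (intro tendsto_upperbound[OF lim]) auto
      qed
    qed auto
  qed
qed

text \<open>With a deterministic modulus of continuity, finitely many balls of radius \<delta> cover
  [0,t], and every value of the path is within 1 of its value at one of the centres.\<close>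

lemma whp_paths_bounded:
  fixes X :: "real \<Rightarrow> 'a \<Rightarrow> 'b::euclidean_space"
  assumes meas: "\<And>s. s \<in> {0..t} \<Longrightarrow> X s \<in> borel_measurable M"
    and cont: "continuous_paths M X" and pos: "\<eta> > 0"
  obtains R where "R > 0" "whp M \<eta> (\<lambda>w. \<forall>s\<in>{0..t}. norm (X s w) \<le> R)"
proof -
  obtain \<delta> where \<delta>: "\<delta> > 0"
    "whp M (\<eta>/2) (\<lambda>w. \<forall>s\<in>{0..t}. \<forall>u\<in>{0..t}. \<bar>s - u\<bar> < \<delta> \<longrightarrow> norm (X s w - X u w) \<le> 1)"
    using whp_paths_modulus[of t X 1 "\<eta>/2"] assms by (auto simp: field_simps)
  obtain T where T: "T \<subseteq> {0..t}" "finite T" "{0..t} \<subseteq> (\<Union>s\<in>T. ball s \<delta>)"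
  proof (rule compactE_image[of "{0..t}" "{0..t}" "\<lambda>s. ball s \<delta>"])
    show "{0..t} \<subseteq> (\<Union>s\<in>{0..t}. ball s \<delta>)" using \<delta>(1) by auto
  qed auto
  have "stoch_bounded M (\<lambda>n w. \<Sum>s\<in>T. norm (X s w))"
  proof (rule stoch_bounded_pathwise)
    have [measurable]: "X s \<in> borel_measurable M" if "s \<in> T" for s using T meas that by auto
    show "(\<lambda>w. \<Sum>s\<in>T. norm (X s w)) \<in> borel_measurable M" by measurable
  qed auto
  then obtain K where K: "K > 0" "whp M (\<eta>/2) (\<lambda>w. \<bar>\<Sum>s\<in>T. norm (X s w)\<bar> \<le> K)"
    using pos by (auto elim: stoch_boundedE[of _ _ "\<eta>/2"])
  show thesis
  proof (rule that)
    show "K + 1 > 0" using K by simp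
    show "whp M \<eta> (\<lambda>w. \<forall>s\<in>{0..t}. norm (X s w) \<le> K + 1)"
    proof (rule whp_mono[OF whp_conj[OF \<delta>(2) K(2), where \<eta> = \<eta>]])
      fix w assume *: "(\<forall>s\<in>{0..t}. \<forall>u\<in>{0..t}. \<bar>s - u\<bar> < \<delta> \<longrightarrow> norm (X s w - X u w) \<le> 1) \<and>
          \<bar>\<Sum>s\<in>T. norm (X s w)\<bar> \<le> K"
      show "\<forall>s\<in>{0..t}. norm (X s w) \<le> K + 1"
      proof
        fix s assume s: "s \<in> {0..t}"
        then obtain u where u: "u \<in> T" "\<bar>s - u\<bar> < \<delta>"
          using T(3) by (auto simp: dist_real_def abs_minus_commute)
        have "norm (X u w) \<le> (\<Sum>s\<in>T. norm (X s w))"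
          using T(2) u(1) by (intro member_le_sum) auto
        moreover have "norm (X s w - X u w) \<le> 1" using * s u T(1) by auto
        ultimately show "norm (X s w) \<le> K + 1"
          using * norm_triangle_sub[of "X s w" "X u w"] by linarith
      qed
    qed auto
  qed
qed

end

section \<open>Quadratic sums of continuous semimartingales\<close>

text \<open>The levels are nested: cell i of level n is the block of cells i * 2^m, ..., i * 2^m +
  2^m - 1 of level n + m. The formula is not cut off at t, so for t > 0 the grid increases strictly
  in all indices.\<close>

definition dyad :: "real \<Rightarrow> nat \<Rightarrow> nat \<Rightarrow> real" where
  "dyad t n i = t * real i / 2 ^ n"

definition incr :: "real \<Rightarrow> (real \<Rightarrow> 'w \<Rightarrow> 'b::real_normed_vector) \<Rightarrow> nat \<Rightarrow> nat \<Rightarrow> 'w \<Rightarrow> 'b" where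
  "incr t X n i w = X (dyad t n (Suc i)) w - X (dyad t n i) w"

definition dyad_qv :: "real \<Rightarrow> (real \<Rightarrow> 'w \<Rightarrow> 'b::real_normed_vector) \<Rightarrow> nat \<Rightarrow> 'w \<Rightarrow> real" where
  "dyad_qv t X n w = (\<Sum>i<2^n. (norm (incr t X n i w))\<^sup>2)"

lemma dyad_0 [simp]: "dyad t n 0 = 0"
  and dyad_last [simp]: "dyad t n (2 ^ n) = t"
  by (simp_all add: dyad_def)

lemma dyad_mono: "0 \<le> t \<Longrightarrow> i \<le> j \<Longrightarrow> dyad t n i \<le> dyad t n j"
  by (auto simp: dyad_def intro!: divide_right_mono mult_left_mono)

lemma dyad_less: "0 < t \<Longrightarrow> i < j \<Longrightarrow> dyad t n i < dyad t n j"
  by (auto simp: dyad_def intro!: divide_strict_right_mono mult_strict_left_mono)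

lemma dyad_nonneg [simp]: "0 \<le> t \<Longrightarrow> 0 \<le> dyad t n i"
  by (simp add: dyad_def)

lemma dyad_le: "0 \<le> t \<Longrightarrow> i \<le> 2 ^ n \<Longrightarrow> dyad t n i \<le> t"
  using dyad_mono[of t i "2^n" n] by simp

lemma dyad_in: "0 \<le> t \<Longrightarrow> i \<le> 2 ^ n \<Longrightarrow> dyad t n i \<in> {0..t}"
  by (simp add: dyad_le)

lemma dyad_Suc_diff: "dyad t n (Suc i) - dyad t n i = t / 2 ^ n"
  by (simp add: dyad_def field_simps)

lemma dyad_refine: "dyad t (k + m) (i * 2 ^ m) = dyad t k i"
  by (simp add: dyad_def power_add)

lemma is_partition_dyad: "0 < t \<Longrightarrow> is_partition (dyad t n i) i (dyad t n)"
  by (auto simp: is_partition_def dyad_less)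

lemma dyad_mesh_tendsto: "(\<lambda>n. t / 2 ^ n) \<longlonglongrightarrow> (0::real)"
proof -
  have "(\<lambda>n. t * (1/2) ^ n) \<longlonglongrightarrow> t * 0"
    by (intro tendsto_intros LIMSEQ_power_zero) auto
  then show ?thesis by (simp add: power_one_over)
qed

lemma eventually_dyad_mesh:
  fixes t \<delta> :: real
  assumes "\<delta> > 0"
  shows "\<forall>\<^sub>F n in sequentially. t / 2 ^ n < \<delta>"
  using order_tendstoD(2)[OF dyad_mesh_tendsto assms] .

text \<open>The convex C^1 function that equals x^2 on [-R,R] and is continued by its tangents, of
  slopes -2R and 2R; \<open>huber_deriv\<close> is its derivative.\<close>

definition huber :: "real \<Rightarrow> real \<Rightarrow> real" where
  "huber R x = (if \<bar>x\<bar> \<le> R then x\<^sup>2 else 2 * R * \<bar>x\<bar> - R\<^sup>2)"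

definition huber_deriv :: "real \<Rightarrow> real \<Rightarrow> real" where
  "huber_deriv R x = 2 * max (- R) (min R x)"

lemma huber_nonneg: "0 \<le> R \<Longrightarrow> 0 \<le> huber R x"
proof -
  assume R: "0 \<le> R"
  have "R * R \<le> 2 * (R * \<bar>x\<bar>)" if "R < \<bar>x\<bar>"
    using mult_left_mono[of R "\<bar>x\<bar>" R] R that by (smt (verit) mult_nonneg_nonneg)
  then show ?thesis by (auto simp: huber_def power2_eq_square mult.assoc)
qed

lemma huber_le: "0 \<le> R \<Longrightarrow> huber R x \<le> 2 * R * \<bar>x\<bar>"
proof -
  assume R: "0 \<le> R"
  have "x\<^sup>2 \<le> 2 * R * \<bar>x\<bar>" if "\<bar>x\<bar> \<le> R"
    using mult_mono[of "\<bar>x\<bar>" "2 * R" "\<bar>x\<bar>" "\<bar>x\<bar>"] that R by (simp add: power2_eq_square)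
  with R show ?thesis by (auto simp: huber_def)
qed

lemma huber_deriv_bounded: "0 \<le> R \<Longrightarrow> \<bar>huber_deriv R x\<bar> \<le> 2 * R"
  by (auto simp: huber_deriv_def)

text \<open>The right-hand side is the gap between a convex function and its tangent at x: it is
  nonnegative throughout and equals (y - x)^2 while both points lie on the quadratic piece.\<close>

lemma huber_taylor:
  assumes "0 \<le> R"
  shows "(if \<bar>x\<bar> \<le> R \<and> \<bar>y\<bar> \<le> R then (y - x)\<^sup>2 else 0) \<le> huber R y - huber R x - huber_deriv R x * (y - x)"
proof -
  consider "\<bar>x\<bar> \<le> R" "\<bar>y\<bar> \<le> R" | "\<bar>x\<bar> \<le> R" "y > R" | "\<bar>x\<bar> \<le> R" "y < - R" | "x > R" "\<bar>y\<bar> \<le> R"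
    | "x > R" "y > R" | "x > R" "y < - R" | "x < - R" "\<bar>y\<bar> \<le> R" | "x < - R" "y > R" | "x < - R" "y < - R"
    by linarith
  then show ?thesis
  proof cases
    case 1
    then show ?thesis by (simp add: huber_def huber_deriv_def power2_eq_square algebra_simps)
  next
    case 2
    then have "0 \<le> (R - x) * (2 * y - R - x)" by (intro mult_nonneg_nonneg) auto
    with 2 assms show ?thesis
      by (simp add: huber_def huber_deriv_def power2_eq_square algebra_simps)
  next
    case 3
    then have "0 \<le> (R + x) * (- 2 * y - R + x)" by (intro mult_nonneg_nonneg) auto
    with 3 assms show ?thesis
      by (simp add: huber_def huber_deriv_def power2_eq_square algebra_simps)
  next
    case 4
    have "0 \<le> (R - y)\<^sup>2" by simp
    with 4 assms show ?thesis
      by (simp add: huber_def huber_deriv_def power2_eq_square algebra_simps)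
  next
    case 7
    have "0 \<le> (R + y)\<^sup>2" by simp
    with 7 assms show ?thesis
      by (simp add: huber_def huber_deriv_def power2_eq_square algebra_simps)
  next
    case 6
    then have "0 \<le> R * - y" using assms by (intro mult_nonneg_nonneg) auto
    with 6 assms show ?thesis
      by (simp add: huber_def huber_deriv_def power2_eq_square algebra_simps)
  next
    case 8
    then have "0 \<le> R * y" using assms by (intro mult_nonneg_nonneg) auto
    with 8 assms show ?thesis
      by (simp add: huber_def huber_deriv_def power2_eq_square algebra_simps)
  qed (use assms in \<open>simp_all add: huber_def huber_deriv_def power2_eq_square algebra_simps\<close>)
qed

lemma huber_measurable [measurable]: "huber R \<in> borel_measurable borel"
  unfolding huber_def by measurable

lemma huber_deriv_measurable [measurable]: "huber_deriv R \<in> borel_measurable borel"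
  unfolding huber_deriv_def by measurable

section \<open>Martingales and semimartingales on a filtered space\<close>

locale filtered_prob = prob_space M for M :: "'w measure" +
  fixes F :: "real \<Rightarrow> 'w measure"
  assumes filtered: "filtered_prob_space M F"
begin

lemma subalg: "subalgebra M (F s)"
  using filtered by (simp add: filtered_prob_space_def)

lemma space_F [simp]: "space (F s) = space M"
  using subalg[of s] by (simp add: subalgebra_def)

lemma measurable_F_M: "X \<in> borel_measurable (F s) \<Longrightarrow> X \<in> borel_measurable M"
  using measurable_from_subalg[OF subalg] .

lemma measurable_F_mono: "X \<in> borel_measurable (F s) \<Longrightarrow> s \<le> u \<Longrightarrow> X \<in> borel_measurable (F u)"
proof -
  assume X: "X \<in> borel_measurable (F s)" and "s \<le> u"
  have "filtration (space M) F" using filtered by (simp add: filtered_prob_space_def)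
  from filtration.sets_F_mono[OF this \<open>s \<le> u\<close>] have "subalgebra (F u) (F s)"
    by (simp add: subalgebra_def)
  from measurable_from_subalg[OF this X] show ?thesis .
qed

lemma adapted_measurable: "adapted F X \<Longrightarrow> 0 \<le> s \<Longrightarrow> s \<le> u \<Longrightarrow> X s \<in> borel_measurable (F u)"
  by (auto simp: adapted_def intro: measurable_F_mono)

lemma adapted_measurable_M: "adapted F X \<Longrightarrow> 0 \<le> s \<Longrightarrow> X s \<in> borel_measurable M"
  by (auto simp: adapted_def intro: measurable_F_M)

text \<open>The weight \<xi>, known at time s, moves into the conditional expectation. Its
  boundedness makes the products integrable although \<open>X\<close> has first moments
  only.\<close>

lemma martingale_increment_orthogonal:
  assumes X: "martingale M F X" and su: "0 \<le> s" "s \<le> u"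
    and \<xi>: "\<xi> \<in> borel_measurable (F s)" "\<And>w. \<bar>\<xi> w\<bar> \<le> C"
  shows "integrable M (\<lambda>w. \<xi> w * (X u w - X s w))"
    and "expectation (\<lambda>w. \<xi> w * (X u w - X s w)) = 0"
proof -
  interpret S: finite_measure_subalgebra M "F s"
    by unfold_locales (rule subalg)
  have int: "integrable M (X s)" "integrable M (X u)" using X su by (auto simp: martingale_def)
  have [measurable]: "X s \<in> borel_measurable M" "X u \<in> borel_measurable M"
    using int by auto
  have \<xi>M [measurable]: "\<xi> \<in> borel_measurable M" using \<xi>(1) by (rule measurable_F_M)
  have mult: "integrable M (\<lambda>w. \<xi> w * X v w)" if "integrable M (X v)" for v
  proof (rule Bochner_Integration.integrable_bound[of M "\<lambda>w. C * X v w"])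
    show "integrable M (\<lambda>w. C * X v w)" using that by simp
    have "\<bar>\<xi> w\<bar> * \<bar>X v w\<bar> \<le> \<bar>C\<bar> * \<bar>X v w\<bar>" for w
      using \<xi>(2)[of w] by (intro mult_right_mono) auto
    then show "AE w in M. norm (\<xi> w * X v w) \<le> norm (C * X v w)"
      by (simp add: abs_mult)
  qed (use that in measurable)
  have "expectation (\<lambda>w. \<xi> w * X u w) = expectation (\<lambda>w. \<xi> w * real_cond_exp M (F s) (X u) w)"
    by (rule S.real_cond_exp_intg(2)[symmetric]) (use \<xi> mult int in auto)
  also have "\<dots> = expectation (\<lambda>w. \<xi> w * X s w)"
  proof (rule integral_cong_AE)
    have "AE w in M. real_cond_exp M (F s) (X u) w = X s w"
      using X su by (auto simp: martingale_def)
    then show "AE w in M. \<xi> w * real_cond_exp M (F s) (X u) w = \<xi> w * X s w"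
      by eventually_elim simp
  qed auto
  finally have eq: "expectation (\<lambda>w. \<xi> w * X u w) = expectation (\<lambda>w. \<xi> w * X s w)" .
  show "integrable M (\<lambda>w. \<xi> w * (X u w - X s w))"
    using mult int by (simp add: algebra_simps)
  show "expectation (\<lambda>w. \<xi> w * (X u w - X s w)) = 0"
    using mult int eq by (simp add: algebra_simps)
qed

text \<open>A weak-type bound for the square function of a martingale that is merely integrable: the
  increments of the Huber function dominate the squared increments as long as the path stays in
  \<open>[-R,R]\<close>, while the Huber function itself grows only linearly.\<close>

lemma martingale_truncated_qv:
  fixes n :: nat
  assumes X: "martingale M F X" and R: "0 \<le> R" and p: "0 \<le> p 0" "\<And>i. p i \<le> p (Suc i)"
  defines "Z \<equiv> \<lambda>w. \<Sum>i<n. if \<bar>X (p i) w\<bar> \<le> R \<and> \<bar>X (p (Suc i)) w\<bar> \<le> R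
      then (X (p (Suc i)) w - X (p i) w)\<^sup>2 else 0"
  shows "integrable M Z" and "expectation Z \<le> 2 * R * expectation (\<lambda>w. \<bar>X (p n) w\<bar>)"
proof -
  have p0: "0 \<le> p i" for i by (induction i) (use p order_trans in auto)
  have int: "integrable M (X (p i))" for i using X p0 by (auto simp: martingale_def)
  have [measurable]: "X (p i) \<in> borel_measurable M" for i using int by auto
  have ad: "X (p i) \<in> borel_measurable (F (p i))" for i
    using X p0 by (auto simp: martingale_def adapted_def)
  have inth: "integrable M (\<lambda>w. huber R (X (p i) w))" for i
  proof (rule Bochner_Integration.integrable_bound[of M "\<lambda>w. 2 * R * X (p i) w"])
    show "AE w in M. norm (huber R (X (p i) w)) \<le> norm (2 * R * X (p i) w)"
      using huber_nonneg[OF R] huber_le[OF R] R by (auto simp: abs_mult)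
  qed (use int in auto)
  \<comment> \<open>The derivative term of \<open>d\<close> has mean zero by the martingale
    property, so the expectations of \<open>d\<close> telescope to a difference of Huber values at
    the end points.\<close>
  define d where "d i w = huber R (X (p (Suc i)) w) - huber R (X (p i) w)
      - huber_deriv R (X (p i) w) * (X (p (Suc i)) w - X (p i) w)" for i w
  have orth: "integrable M (\<lambda>w. huber_deriv R (X (p i) w) * (X (p (Suc i)) w - X (p i) w))"
    "expectation (\<lambda>w. huber_deriv R (X (p i) w) * (X (p (Suc i)) w - X (p i) w)) = 0" for i
    by (rule martingale_increment_orthogonal[OF X p0 p(2), where C = "2 * R"],
        rule measurable_compose[OF ad huber_deriv_measurable], rule huber_deriv_bounded[OF R])+
  have intd: "integrable M (d i)" for i
    unfolding d_def using orth(1) inth by (intro Bochner_Integration.integrable_diff) auto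
  have Ed: "expectation (d i) = expectation (\<lambda>w. huber R (X (p (Suc i)) w)) - expectation (\<lambda>w. huber R (X (p i) w))" for i
    unfolding d_def using orth inth by simp
  have Zle: "Z w \<le> (\<Sum>i<n. d i w)" for w
    unfolding Z_def d_def by (intro sum_mono huber_taylor R)
  have Z0: "0 \<le> Z w" for w unfolding Z_def by (intro sum_nonneg) auto
  show intZ: "integrable M Z"
  proof (rule Bochner_Integration.integrable_bound[of M "\<lambda>w. \<Sum>i<n. d i w"])
    show "AE w in M. norm (Z w) \<le> norm (\<Sum>i<n. d i w)"
      using Zle Z0 by (auto intro!: order_trans[OF Zle] simp del: sum.lessThan_Suc)
    show "Z \<in> borel_measurable M" unfolding Z_def by measurable
  qed (use intd in auto)
  have "expectation Z \<le> expectation (\<lambda>w. \<Sum>i<n. d i w)"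
    using Zle intZ intd by (intro integral_mono) auto
  also have "\<dots> = (\<Sum>i<n. expectation (d i))" using intd by simp
  also have "\<dots> = expectation (\<lambda>w. huber R (X (p n) w)) - expectation (\<lambda>w. huber R (X (p 0) w))"
    unfolding Ed by (rule sum_lessThan_telescope)
  also have "\<dots> \<le> expectation (\<lambda>w. huber R (X (p n) w))"
    using huber_nonneg[OF R] by simp
  also have "\<dots> \<le> expectation (\<lambda>w. 2 * R * \<bar>X (p n) w\<bar>)"
    using inth int huber_le[OF R] by (intro integral_mono) auto
  finally show "expectation Z \<le> 2 * R * expectation (\<lambda>w. \<bar>X (p n) w\<bar>)" by simp
qed

text \<open>Three events share the budget \<eta>: a localizing time exceeds t, the path stays in
  [-R,R], and the truncated quadratic sum is below K. On the first two the truncation is inactive.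
  The expectation bound involves the stopped martingale only at time t, so it is uniform in the
  level n.\<close>

lemma local_martingale_qv_bounded:
  assumes N: "continuous_local_martingale M F N" and t: "0 \<le> t"
  shows "stoch_bounded M (dyad_qv t N)"
  unfolding stoch_bounded_def
proof (intro allI impI)
  fix \<eta> :: real assume "\<eta> > 0"
  then have \<eta>: "\<eta>/3 > 0" by simp
  obtain T where T: "\<And>n. stopping_time F (T n)" "\<And>n w. w \<in> space M \<Longrightarrow> 0 \<le> T n w"
    "AE w in M. filterlim (\<lambda>n. T n w) at_top sequentially"
    "\<And>n. martingale M F (\<lambda>t w. N (min t (T n w)) w - N 0 w)"
    using N unfolding continuous_local_martingale_def by (auto simp: AE_conj_iff)
  have "\<forall>\<^sub>F n in sequentially. whp M (\<eta>/3) (\<lambda>w. t \<le> T n w)"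
  proof (rule whp_AE_eventually[OF _ _ \<eta>])
    show "Measurable.pred M (\<lambda>w. t \<le> T n w)" for n
    proof -
      have [measurable]: "T n \<in> borel_measurable M"
        using subalg by (intro measurable_stopping_time[OF T(1)]) (auto simp: subalgebra_def)
      show ?thesis by measurable
    qed
    show "AE w in M. \<forall>\<^sub>F n in sequentially. t \<le> T n w"
      using T(3) by eventually_elim (simp add: filterlim_at_top)
  qed
  then obtain m where m: "whp M (\<eta>/3) (\<lambda>w. t \<le> T m w)" by (auto simp: eventually_sequentially)
  have "adapted F N" "continuous_paths M N" using N by (auto simp: continuous_local_martingale_def)
  then obtain R where R: "R > 0" "whp M (\<eta>/3) (\<lambda>w. \<forall>s\<in>{0..t}. norm (N s w) \<le> R)"
    using adapted_measurable_M \<eta> by (auto elim!: whp_paths_bounded[where X = N and t = t and \<eta> = "\<eta>/3", rotated])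
  define X where "X s w = N (min s (T m w)) w - N 0 w" for s w
  have X: "martingale M F X" unfolding X_def by (rule T(4))
  \<comment> \<open>The cut-off is 2 * R because \<open>X\<close> subtracts the initial value
    \<open>N 0\<close>, itself of size up to R.\<close>
  define Z where "Z n w = (\<Sum>i<2^n. if \<bar>X (dyad t n i) w\<bar> \<le> 2 * R \<and> \<bar>X (dyad t n (Suc i)) w\<bar> \<le> 2 * R
      then (X (dyad t n (Suc i)) w - X (dyad t n i) w)\<^sup>2 else 0)" for n w
  have Z: "integrable M (Z n)" "expectation (Z n) \<le> 2 * (2 * R) * expectation (\<lambda>w. \<bar>X t w\<bar>)" for n
    unfolding Z_def
    using martingale_truncated_qv[OF X, of "2 * R" "dyad t n" "2 ^ n"] R t by (auto simp: dyad_mono)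
  have "stoch_bounded M Z"
    by (rule stoch_bounded_expectation[OF Z(1) _ Z(2)]) (auto simp: Z_def intro!: sum_nonneg)
  then obtain K where K: "\<And>n. whp M (\<eta>/3) (\<lambda>w. \<bar>Z n w\<bar> \<le> K)"
    using \<eta> unfolding stoch_bounded_def by blast
  have "whp M \<eta> (\<lambda>w. \<bar>dyad_qv t N n w\<bar> \<le> K)" for n
  proof (rule whp_mono[OF whp_conj[OF whp_conj[OF m R(2) order_refl] K[of n] order_refl]])
    fix w assume *: "(t \<le> T m w \<and> (\<forall>s\<in>{0..t}. norm (N s w) \<le> R)) \<and> \<bar>Z n w\<bar> \<le> K"
    have Xi: "X (dyad t n i) w = N (dyad t n i) w - N 0 w" if "i \<le> 2 ^ n" for i
      using * dyad_le[OF t that] by (simp add: X_def min_absorb1)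
    have Xb: "\<bar>X (dyad t n i) w\<bar> \<le> 2 * R" if "i \<le> 2 ^ n" for i
    proof -
      have "\<bar>N (dyad t n i) w\<bar> \<le> R" "\<bar>N 0 w\<bar> \<le> R"
        using * dyad_in[OF t that] t by auto
      then show ?thesis unfolding Xi[OF that] by linarith
    qed
    have "dyad_qv t N n w = Z n w"
      unfolding dyad_qv_def Z_def incr_def
    proof (rule sum.cong)
      fix i assume "i \<in> {..<2 ^ n :: nat}"
      then have i: "i \<le> 2 ^ n" "Suc i \<le> 2 ^ n" by auto
      show "(norm (N (dyad t n (Suc i)) w - N (dyad t n i) w))\<^sup>2 =
          (if \<bar>X (dyad t n i) w\<bar> \<le> 2 * R \<and> \<bar>X (dyad t n (Suc i)) w\<bar> \<le> 2 * R
           then (X (dyad t n (Suc i)) w - X (dyad t n i) w)\<^sup>2 else 0)"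
        using Xb[OF i(1)] Xb[OF i(2)] by (simp add: Xi[OF i(1)] Xi[OF i(2)])
    qed simp
    then show "\<bar>dyad_qv t N n w\<bar> \<le> K" using * by simp
  qed (use \<eta> in auto)
  then show "\<exists>K. \<forall>n. whp M \<eta> (\<lambda>w. \<bar>dyad_qv t N n w\<bar> \<le> K)" by blast
qed

text \<open>The finite variation part contributes at most the square of its total variation, path by
  path, since a sum of squares is at most the square of the sum of absolute values; the two parts
  combine by (a + b)^2 \<le> 2 a^2 + 2 b^2.\<close>

lemma semimartingale_qv_bounded:
  assumes X: "continuous_semimartingale M F X" and t: "0 < t"
  shows "stoch_bounded M (dyad_qv t X)"
proof -
  obtain N A where N: "continuous_local_martingale M F N" and A: "adapted F A"
    "AE w in M. locally_finite_variation (\<lambda>t. A t w)"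
    and XNA: "AE w in M. \<forall>t\<ge>0. X t w = N t w + A t w"
    using X unfolding continuous_semimartingale_def by blast
  have "stoch_bounded M (dyad_qv t A)"
  proof (rule stoch_bounded_pathwise)
    fix n
    have [measurable]: "A (dyad t n i) \<in> borel_measurable M" for i
      using A(1) t by (auto intro: adapted_measurable_M)
    show "dyad_qv t A n \<in> borel_measurable M"
      unfolding dyad_qv_def incr_def by measurable
  next
    show "AE w in M. \<exists>K. \<forall>n. \<bar>dyad_qv t A n w\<bar> \<le> K"
      using A(2)
    proof eventually_elim
      case (elim w)
      then obtain K where K: "\<And>n p. is_partition t n p \<Longrightarrow> (\<Sum>i<n. \<bar>A (p (Suc i)) w - A (p i) w\<bar>) \<le> K"
        using t unfolding locally_finite_variation_def by (meson less_imp_le)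
      have "dyad_qv t A n w \<le> K\<^sup>2" for n
      proof -
        have "(\<Sum>i<2^n. \<bar>incr t A n i w\<bar>) \<le> K"
          unfolding incr_def using K is_partition_dyad[OF t, of n "2^n"] by simp
        moreover have "dyad_qv t A n w \<le> (\<Sum>i<2^n. \<bar>incr t A n i w\<bar>)\<^sup>2"
        proof -
          have "(L2_set (\<lambda>i. \<bar>incr t A n i w\<bar>) {..<2^n})\<^sup>2 \<le> (\<Sum>i<2^n. \<bar>incr t A n i w\<bar>)\<^sup>2"
            by (intro power_mono L2_set_le_sum) (auto simp: L2_set_nonneg)
          then show ?thesis
            by (simp add: L2_set_def dyad_qv_def sum_nonneg)
        qed
        ultimately show ?thesis
          by (meson order_trans power_mono sum_nonneg abs_ge_zero)
      qed
      moreover have "0 \<le> dyad_qv t A n w" for n by (simp add: dyad_qv_def sum_nonneg)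
      ultimately show ?case by (intro exI[of _ "K\<^sup>2"]) auto
    qed
  qed
  then have "stoch_bounded M (\<lambda>n w. 2 * dyad_qv t N n w + 2 * dyad_qv t A n w)"
    using local_martingale_qv_bounded[OF N] t by (intro stoch_bounded_add stoch_bounded_cmult) auto
  then show ?thesis
  proof (rule stoch_bounded_dominated)
    fix n
    show "AE w in M. \<bar>dyad_qv t X n w\<bar> \<le> \<bar>2 * dyad_qv t N n w + 2 * dyad_qv t A n w\<bar>"
      using XNA
    proof eventually_elim
      case (elim w)
      have "(incr t X n i w)\<^sup>2 \<le> 2 * (incr t N n i w)\<^sup>2 + 2 * (incr t A n i w)\<^sup>2" for i
      proof -
        have "incr t X n i w = incr t N n i w + incr t A n i w"
          using elim t by (simp add: incr_def)
        then show ?thesis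
          using sum_squares_bound[of "incr t N n i w" "incr t A n i w"]
          by (simp add: power2_sum)
      qed
      then have "dyad_qv t X n w \<le> 2 * dyad_qv t N n w + 2 * dyad_qv t A n w"
        unfolding dyad_qv_def by (simp add: sum_distrib_left sum.distrib[symmetric] sum_mono)
      moreover have "0 \<le> dyad_qv t X n w" by (simp add: dyad_qv_def sum_nonneg)
      ultimately show ?case by linarith
    qed
  qed
qed

end

section \<open>Sums against Brownian increments\<close>

locale brownian = filtered_prob +
  fixes W :: "real \<Rightarrow> 'a \<Rightarrow> real"
  assumes adapted_W: "adapted F W"
    and cont_W: "continuous_paths M W"
    and distr_W: "\<And>s u. 0 \<le> s \<Longrightarrow> s < u \<Longrightarrow>
      distributed M lborel (\<lambda>w. W u w - W s w) (normal_density 0 (sqrt (u - s)))"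
    and indep_W: "\<And>s u. 0 \<le> s \<Longrightarrow> s < u \<Longrightarrow>
      indep_set (sets (F s)) {(\<lambda>w. W u w - W s w) -` A \<inter> space M | A. A \<in> sets borel}"
begin

lemma W_measurable: "0 \<le> s \<Longrightarrow> W s \<in> borel_measurable M"
  using adapted_measurable_M[OF adapted_W] .

lemma indep_var_increment:
  assumes su: "0 \<le> s" "s < u" and \<xi>: "\<xi> \<in> borel_measurable (F s)"
  shows "indep_var borel \<xi> borel (\<lambda>w. W u w - W s w)"
  unfolding indep_var_eq
proof (intro conjI)
  show "random_variable borel \<xi>" using \<xi> by (rule measurable_F_M)
  have [measurable]: "W s \<in> borel_measurable M" "W u \<in> borel_measurable M"
    using su by (auto intro: W_measurable)
  show "random_variable borel (\<lambda>w. W u w - W s w)" by measurable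
  let ?B = "{(\<lambda>w. W u w - W s w) -` A \<inter> space M | A. A \<in> sets borel}"
  \<comment> \<open>The preimages of Borel sets under a single map already form a \<sigma>-algebra,
    so independence on \<open>?B\<close> is the independence required.\<close>
  have B: "sigma_sets (space M) ?B = ?B"
    using sets.sigma_sets_eq[of "vimage_algebra (space M) (\<lambda>w. W u w - W s w) (borel :: real measure)"]
    by (simp add: sets_vimage_algebra2 cong: conj_cong)
  have sub: "sigma_sets (space M) {\<xi> -` A \<inter> space M | A. A \<in> sets borel} \<subseteq> sets (F s)"
    using measurable_sets[OF \<xi>] sets.sigma_sets_subset[of "{\<xi> -` A \<inter> space M | A. A \<in> sets borel}" "F s"]
    by auto
  note ind = indep_W[OF su]
  show "indep_set (sigma_sets (space M) {\<xi> -` A \<inter> space M | A. A \<in> sets borel}) (sigma_sets (space M) ?B)"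
    unfolding B
  proof (rule indep_setI)
    show "sigma_sets (space M) {\<xi> -` A \<inter> space M | A. A \<in> sets borel} \<subseteq> events"
      using sub indep_setD_ev1[OF ind] by blast
    show "?B \<subseteq> events" using indep_setD_ev2[OF ind] .
  qed (use sub indep_setD[OF ind] in blast)
qed

lemma increment_moments:
  assumes su: "0 \<le> s" "s < u"
  shows "integrable M (\<lambda>w. W u w - W s w)" "expectation (\<lambda>w. W u w - W s w) = 0"
    "integrable M (\<lambda>w. (W u w - W s w)\<^sup>2)" "expectation (\<lambda>w. (W u w - W s w)\<^sup>2) = u - s"
proof -
  note d = distr_W[OF su]
  have pos: "0 < sqrt (u - s)" using su by simp
  show "integrable M (\<lambda>w. W u w - W s w)"
    using integrable_normal_moment[OF pos, of 0 1]
    by (subst distributed_integrable[OF d, of "\<lambda>x. x", symmetric]) auto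
  show e0: "expectation (\<lambda>w. W u w - W s w) = 0"
    by (rule normal_distributed_expectation[OF pos d])
  show "integrable M (\<lambda>w. (W u w - W s w)\<^sup>2)"
    using integrable_normal_moment[OF pos, of 0 2]
    by (subst distributed_integrable[OF d, of "\<lambda>x. x\<^sup>2", symmetric]) auto
  show "expectation (\<lambda>w. (W u w - W s w)\<^sup>2) = u - s"
    using normal_distributed_variance[OF pos d] e0 su by simp
qed

text \<open>An inequality form of the discrete Ito isometry. The partial sum and the next weight
  involve only the past of \<open>p b\<close>, hence are independent of the next increment; as that
  has mean zero, the cross term vanishes.\<close>

lemma transform_second_moment:
  assumes p: "0 \<le> p 0" "\<And>i. p i < p (Suc i)"
    and h: "\<And>i. h i \<in> borel_measurable (F (p i))" "\<And>i w. \<bar>h i w\<bar> \<le> c"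
    and ab: "a \<le> b"
  defines "S \<equiv> \<lambda>b w. \<Sum>i=a..<b. h i w * (W (p (Suc i)) w - W (p i) w)"
  shows "integrable M (\<lambda>w. (S b w)\<^sup>2) \<and> expectation (\<lambda>w. (S b w)\<^sup>2) \<le> c\<^sup>2 * (p b - p a)"
  using ab
proof (induction b rule: dec_induct)
  case base
  show ?case by (simp add: S_def)
next
  case (step b)
  have p0: "0 \<le> p i" for i by (induction i) (use p less_imp_le order_trans in blast)+
  have pm: "i \<le> j \<Longrightarrow> p i \<le> p j" for i j
    using lift_Suc_mono_le[of p i j] p(2) by (simp add: less_imp_le)
  have [measurable]: "W (p i) \<in> borel_measurable M" for i by (intro W_measurable p0)
  have hM [measurable]: "h i \<in> borel_measurable M" for i by (rule measurable_F_M[OF h(1)])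
  let ?D = "\<lambda>w. W (p (Suc b)) w - W (p b) w"
  note mom = increment_moments[OF p0 p(2), of b]
  have SF: "S b \<in> borel_measurable (F (p b))"
  proof -
    have "(\<lambda>w. h i w * (W (p (Suc i)) w - W (p i) w)) \<in> borel_measurable (F (p b))" if "i \<in> {a..<b}" for i
    proof -
      have [measurable]: "h i \<in> borel_measurable (F (p b))"
        using that by (intro measurable_F_mono[OF h(1) pm]) auto
      have [measurable]: "W (p i) \<in> borel_measurable (F (p b))" "W (p (Suc i)) \<in> borel_measurable (F (p b))"
        using that pm p0 adapted_measurable[OF adapted_W] by auto
      show ?thesis by measurable
    qed
    then show ?thesis unfolding S_def by (rule borel_measurable_sum)
  qed
  have SM [measurable]: "S b \<in> borel_measurable M" by (rule measurable_F_M[OF SF])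
  have intS: "integrable M (S b)"
    by (rule square_integrable_imp_integrable[OF SM conjunct1[OF step.IH]])
  have intSh: "integrable M (\<lambda>w. S b w * h b w)"
  proof (rule Bochner_Integration.integrable_bound[of M "\<lambda>w. c * S b w"])
    have "\<bar>S b w\<bar> * \<bar>h b w\<bar> \<le> \<bar>S b w\<bar> * \<bar>c\<bar>" for w
      using h(2)[of b w] by (intro mult_left_mono) auto
    then show "AE w in M. norm (S b w * h b w) \<le> norm (c * S b w)"
      by (simp add: abs_mult mult.commute)
  qed (use intS in auto)
  have inth2: "integrable M (\<lambda>w. (h b w)\<^sup>2)" and h2le: "(h b w)\<^sup>2 \<le> c\<^sup>2" for w
  proof -
    show *: "(h b w)\<^sup>2 \<le> c\<^sup>2" for w
      using h(2)[of b w] by (simp add: abs_le_square_iff[symmetric])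
    show "integrable M (\<lambda>w. (h b w)\<^sup>2)"
      by (rule integrable_const_bound[where B = "c\<^sup>2"]) (use * in auto)
  qed
  have ind1: "indep_var borel (\<lambda>w. S b w * h b w) borel ?D"
    using SF h(1) by (intro indep_var_increment p0 p) auto
  have "indep_var borel (\<lambda>w. (h b w)\<^sup>2) borel ?D"
    using h(1) by (intro indep_var_increment p0 p) auto
  then have ind2: "indep_var borel (\<lambda>w. (h b w)\<^sup>2) borel (\<lambda>w. (?D w)\<^sup>2)"
    using indep_var_compose[of borel _ borel ?D "\<lambda>x. x" borel "\<lambda>x. x\<^sup>2" borel] by (simp add: comp_def)
  have cross: "integrable M (\<lambda>w. (S b w * h b w) * ?D w)" "expectation (\<lambda>w. (S b w * h b w) * ?D w) = 0"
    using indep_var_integrable[OF ind1 intSh mom(1)] indep_var_lebesgue_integral[OF ind1 intSh mom(1)] mom(2)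
    by auto
  have sq: "integrable M (\<lambda>w. (h b w)\<^sup>2 * (?D w)\<^sup>2)"
    "expectation (\<lambda>w. (h b w)\<^sup>2 * (?D w)\<^sup>2) \<le> c\<^sup>2 * (p (Suc b) - p b)"
  proof -
    show "integrable M (\<lambda>w. (h b w)\<^sup>2 * (?D w)\<^sup>2)"
      using indep_var_integrable[OF ind2 inth2 mom(3)] .
    have "expectation (\<lambda>w. (h b w)\<^sup>2) \<le> c\<^sup>2"
      using integral_mono[OF inth2 integrable_const[of "c\<^sup>2"] h2le] by (simp add: prob_space)
    then show "expectation (\<lambda>w. (h b w)\<^sup>2 * (?D w)\<^sup>2) \<le> c\<^sup>2 * (p (Suc b) - p b)"
      unfolding indep_var_lebesgue_integral[OF ind2 inth2 mom(3)] mom(4)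
      using p(2)[of b] by (intro mult_right_mono) auto
  qed
  have eq: "(S (Suc b) w)\<^sup>2 = (S b w)\<^sup>2 + 2 * ((S b w * h b w) * ?D w) + (h b w)\<^sup>2 * (?D w)\<^sup>2" for w
    using step.hyps by (simp add: S_def power2_eq_square algebra_simps)
  have "expectation (\<lambda>w. (S (Suc b) w)\<^sup>2) = expectation (\<lambda>w. (S b w)\<^sup>2) + 2 * 0 + expectation (\<lambda>w. (h b w)\<^sup>2 * (?D w)\<^sup>2)"
    unfolding eq using step.IH cross sq(1) by simp
  also have "\<dots> \<le> c\<^sup>2 * (p (Suc b) - p a)"
    using step.IH sq(2) by (simp add: algebra_simps)
  finally show ?case
    unfolding eq using step.IH cross sq(1) by auto
qed

text \<open>Integrands that are small only with high probability are truncated, which does not affect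
  adaptedness.\<close>

lemma transform_whp:
  assumes p: "0 \<le> p 0" "\<And>i. p i < p (Suc i)" and c: "0 \<le> c" and l: "0 < l"
    and h: "\<And>i. i < n * m \<Longrightarrow> h i \<in> borel_measurable (F (p i))"
    and small: "whp M \<eta> (\<lambda>w. \<forall>i<n * m. \<bar>h i w\<bar> \<le> c)"
  shows "whp M (\<eta> + c\<^sup>2 * (p (n * m) - p 0) / l)
    (\<lambda>w. (\<Sum>k<n. (\<Sum>i=k*m..<k*m+m. h i w * (W (p (Suc i)) w - W (p i) w))\<^sup>2) \<le> l)"
proof -
  \<comment> \<open>The truncated weight is set to 0 from index n * m on, because the measurability
    of \<open>h\<close> is given only below it.\<close>
  define g where "g i w = (if i < n * m \<and> \<bar>h i w\<bar> \<le> c then h i w else 0)" for i w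
  have gb: "\<bar>g i w\<bar> \<le> c" for i w using c by (simp add: g_def)
  have gF: "g i \<in> borel_measurable (F (p i))" for i
  proof (cases "i < n * m")
    case True
    then have [measurable]: "h i \<in> borel_measurable (F (p i))" by (rule h)
    show ?thesis unfolding g_def by measurable
  next
    case False
    then have "g i = (\<lambda>w. 0)" by (auto simp: g_def)
    then show ?thesis by simp
  qed
  define S where "S k w = (\<Sum>i=k*m..<k*m+m. g i w * (W (p (Suc i)) w - W (p i) w))" for k w
  have S: "integrable M (\<lambda>w. (S k w)\<^sup>2)" "expectation (\<lambda>w. (S k w)\<^sup>2) \<le> c\<^sup>2 * (p (k*m+m) - p (k*m))" for k
    unfolding S_def using transform_second_moment[OF p gF gb, of "k*m" "k*m+m"] by auto
  have int: "integrable M (\<lambda>w. \<Sum>k<n. (S k w)\<^sup>2)" using S(1) by auto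
  then have [measurable]: "(\<lambda>w. \<Sum>k<n. (S k w)\<^sup>2) \<in> borel_measurable M" by auto
  have "expectation (\<lambda>w. \<Sum>k<n. (S k w)\<^sup>2) = (\<Sum>k<n. expectation (\<lambda>w. (S k w)\<^sup>2))"
    using S(1) by (intro Bochner_Integration.integral_sum) auto
  also have "\<dots> \<le> (\<Sum>k<n. c\<^sup>2 * (p (Suc k*m) - p (k*m)))"
    using S(2) by (intro sum_mono) (simp add: add.commute)
  also have "\<dots> = c\<^sup>2 * (p (n * m) - p 0)"
    unfolding sum_distrib_left[symmetric]
    by (subst sum_lessThan_telescope[of "\<lambda>k. p (k * m)"]) simp
  finally have E: "expectation (\<lambda>w. \<Sum>k<n. (S k w)\<^sup>2) \<le> c\<^sup>2 * (p (n * m) - p 0)" .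
  have "prob {w \<in> space M. l \<le> (\<Sum>k<n. (S k w)\<^sup>2)} \<le> expectation (\<lambda>w. \<Sum>k<n. (S k w)\<^sup>2) / l"
    by (rule integral_Markov_inequality_measure[where A = "{}"]) (use int l in \<open>auto intro!: AE_I2 sum_nonneg\<close>)
  also have "\<dots> \<le> c\<^sup>2 * (p (n * m) - p 0) / l"
    using E l by (intro divide_right_mono) auto
  finally have "whp M (c\<^sup>2 * (p (n * m) - p 0) / l) (\<lambda>w. (\<Sum>k<n. (S k w)\<^sup>2) \<le> l)"
    unfolding whp_def by (intro bexI[of _ "{w \<in> space M. l \<le> (\<Sum>k<n. (S k w)\<^sup>2)}"]) auto
  then show ?thesis
  proof (rule whp_mono[OF whp_conj[OF small _ order_refl] order_refl])
    fix w assume *: "(\<forall>i<n * m. \<bar>h i w\<bar> \<le> c) \<and> (\<Sum>k<n. (S k w)\<^sup>2) \<le> l"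
    have "S k w = (\<Sum>i=k*m..<k*m+m. h i w * (W (p (Suc i)) w - W (p i) w))" if "k < n" for k
    proof -
      have "i < n * m" if "i \<in> {k*m..<k*m+m}" for i
      proof -
        have "k * m + m \<le> n * m"
          using \<open>k < n\<close> mult_le_mono1[of "Suc k" n m] by simp
        with that show ?thesis by auto
      qed
      then show ?thesis unfolding S_def using * by (intro sum.cong) (auto simp: g_def)
    qed
    with * show "(\<Sum>k<n. (\<Sum>i=k*m..<k*m+m. h i w * (W (p (Suc i)) w - W (p i) w))\<^sup>2) \<le> l"
      by simp
  qed
qed

lemma W_qv_bounded:
  assumes "0 < t"
  shows "stoch_bounded M (dyad_qv t W)"
proof (rule stoch_bounded_expectation)
  fix n
  note mom = increment_moments[of "dyad t n i" "dyad t n (Suc i)" for i]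
  show "integrable M (dyad_qv t W n)"
    unfolding dyad_qv_def incr_def using mom(3) assms by (auto simp: dyad_less)
  have "expectation (dyad_qv t W n) = (\<Sum>i<2^n. dyad t n (Suc i) - dyad t n i)"
    unfolding dyad_qv_def incr_def using mom(3,4) assms
    by (subst Bochner_Integration.integral_sum) (auto simp: dyad_less)
  also have "\<dots> = t" by (subst sum_lessThan_telescope) simp
  finally show "expectation (dyad_qv t W n) \<le> t" by simp
qed (auto simp: dyad_qv_def sum_nonneg)

end

section \<open>Associativity of the Stratonovich integral\<close>

definition avg :: "real \<Rightarrow> (real \<Rightarrow> 'w \<Rightarrow> 'b::real_vector) \<Rightarrow> nat \<Rightarrow> nat \<Rightarrow> 'w \<Rightarrow> 'b" where
  "avg t X n i w = (1/2) *\<^sub>R (X (dyad t n i) w + X (dyad t n (Suc i)) w)"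

text \<open>Here \<open>a\<close> numbers a dyadic interval of level \<open>k\<close>, and the trapezoidal sum is of level \<open>k + m\<close>.\<close>

definition trap_err :: "real \<Rightarrow> (real \<Rightarrow> 'w \<Rightarrow> real) \<Rightarrow> (real \<Rightarrow> 'w \<Rightarrow> real) \<Rightarrow> (real \<Rightarrow> 'w \<Rightarrow> real)
    \<Rightarrow> nat \<Rightarrow> nat \<Rightarrow> nat \<Rightarrow> 'w \<Rightarrow> real" where
  "trap_err t Y W J k m a w = incr t J k a w
     - (\<Sum>i=a*2^m..<a*2^m+2^m. avg t Y (k+m) i w * incr t W (k+m) i w)"

lemma dyad_block:
  assumes "0 \<le> t" "q \<in> {i * 2 ^ m..<i * 2 ^ m + 2 ^ m}"
  shows "dyad t n i \<le> dyad t (n + m) q" "dyad t (n + m) q \<le> dyad t n (Suc i)"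
    "dyad t n i \<le> dyad t (n + m) (Suc q)" "dyad t (n + m) (Suc q) \<le> dyad t n (Suc i)"
  using assms by (auto simp: dyad_refine[of t n m, symmetric] intro!: dyad_mono)

lemma block_div: "q \<in> {i * 2 ^ m..<i * 2 ^ m + 2 ^ m} \<Longrightarrow> q div 2 ^ m = (i::nat)"
  by (intro div_nat_eqI) (auto simp: algebra_simps)

lemma sum_blocks:
  fixes f :: "nat \<Rightarrow> real"
  shows "(\<Sum>i<2^n. \<Sum>q=i*2^m..<i*2^m+2^m. f q) = (\<Sum>q<2^(n+m). f q)"
  using sum.nat_group[of f "2^m" "2^n"] by (simp add: power_add)

lemma sum_incr_block:
  "(\<Sum>q=i*2^m..<i*2^m+2^m. incr t X (n+m) q w) = incr t X n i w"
proof -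
  have "(\<Sum>q=i*2^m..<i*2^m+2^m. incr t X (n+m) q w)
      = X (dyad t (n+m) (Suc i * 2^m)) w - X (dyad t (n+m) (i * 2^m)) w"
    unfolding incr_def by (subst sum_Suc_diff') (auto simp: add.commute)
  then show ?thesis unfolding dyad_refine incr_def .
qed

lemma trap_err_0:
  "trap_err t Y W J n 0 i w = incr t J n i w - avg t Y n i w * incr t W n i w"
  by (simp add: trap_err_def)

lemma sum_trap_err_block:
  "(\<Sum>i=a*2^m..<a*2^m+2^m. trap_err t Y W J (k+m) 0 i w) = trap_err t Y W J k m a w"
  by (simp add: trap_err_0 trap_err_def[of t Y W J k m] sum_subtractf sum_incr_block)

text \<open>A trapezoidal term is the left-point term plus half a product of increments. Splitting
  both levels in this way leaves a left-point sum over the fine grid, which is a martingale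
  transform, and two half-sums of products of increments.\<close>

lemma trap_err_refine:
  "trap_err t Y W J n 0 i w = trap_err t Y W J n m i w
    + (\<Sum>q=i*2^m..<i*2^m+2^m. (Y (dyad t (n+m) q) w - Y (dyad t n i) w) * incr t W (n+m) q w)
    + (1/2) * (\<Sum>q=i*2^m..<i*2^m+2^m. incr t Y (n+m) q w * incr t W (n+m) q w)
    - (1/2) * (incr t Y n i w * incr t W n i w)"
proof -
  let ?B = "{i*2^m..<i*2^m+2^m}"
  have "avg t Y n i w * incr t W n i w
      = Y (dyad t n i) w * incr t W n i w + (1/2) * (incr t Y n i w * incr t W n i w)"
    by (simp add: avg_def incr_def field_simps)
  also have "Y (dyad t n i) w * incr t W n i w
      = (\<Sum>q\<in>?B. Y (dyad t n i) w * incr t W (n+m) q w)"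
    by (simp add: sum_distrib_left[symmetric] sum_incr_block)
  finally have 1: "avg t Y n i w * incr t W n i w
      = (\<Sum>q\<in>?B. Y (dyad t n i) w * incr t W (n+m) q w)
        + (1/2) * (incr t Y n i w * incr t W n i w)" .
  have 2: "(\<Sum>q\<in>?B. avg t Y (n+m) q w * incr t W (n+m) q w)
     = (\<Sum>q\<in>?B. Y (dyad t (n+m) q) w * incr t W (n+m) q w)
        + (1/2) * (\<Sum>q\<in>?B. incr t Y (n+m) q w * incr t W (n+m) q w)"
    unfolding sum_distrib_left sum.distrib[symmetric]
    by (intro sum.cong) (auto simp: avg_def incr_def field_simps)
  show ?thesis
    unfolding trap_err_def
    using 1 2 by (simp add: left_diff_distrib sum_subtractf)
qed

lemma sum_abs_mult_le_qv:
  fixes X Y :: "real \<Rightarrow> 'w \<Rightarrow> real"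
  shows "(\<Sum>i<2^n. \<bar>incr t X n i w * incr t Y n i w\<bar>) \<le> (dyad_qv t X n w + dyad_qv t Y n w) / 2"
proof -
  have "\<bar>incr t X n i w * incr t Y n i w\<bar>
      \<le> ((norm (incr t X n i w))\<^sup>2 + (norm (incr t Y n i w))\<^sup>2) / 2" for i
    using sum_squares_bound[of "\<bar>incr t X n i w\<bar>" "\<bar>incr t Y n i w\<bar>"]
    by (simp add: abs_mult)
  then have "(\<Sum>i<2^n. \<bar>incr t X n i w * incr t Y n i w\<bar>)
      \<le> (\<Sum>i<2^n. ((norm (incr t X n i w))\<^sup>2 + (norm (incr t Y n i w))\<^sup>2) / 2)"
    by (rule sum_mono)
  also have "\<dots> = (dyad_qv t X n w + dyad_qv t Y n w) / 2"
    by (simp add: dyad_qv_def sum_divide_distrib[symmetric] sum.distrib)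
  finally show ?thesis .
qed

text \<open>The last two hypotheses bound martingale transforms; they are provided by
  \<open>transform_whp\<close>. The remaining part of the error is a sum of products of increments, for which
  only the smallness of the weights is available.\<close>

lemma weighted_trap_err_bound:
  fixes Y W J G :: "real \<Rightarrow> 'w \<Rightarrow> real" and H :: "nat \<Rightarrow> real"
  assumes c: "0 < c" "c \<le> 1" and K: "0 < K" and L: "0 < L"
    and osc: "\<And>i. i < 2^n \<Longrightarrow> \<bar>avg t G n i w - H i\<bar> \<le> c"
    and err: "\<And>i. i < 2^n \<Longrightarrow> \<bar>trap_err t Y W J n m i w\<bar> \<le> c / 2^n"
    and qv: "dyad_qv t Y n w \<le> K" "dyad_qv t W n w \<le> K" "dyad_qv t G n w \<le> K"
      "dyad_qv t Y (n+m) w \<le> K" "dyad_qv t W (n+m) w \<le> K"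
    and A: "A = (\<lambda>i. \<Sum>q=i*2^m..<i*2^m+2^m. (Y (dyad t (n+m) q) w - Y (dyad t n i) w) * incr t W (n+m) q w)"
    and small: "(\<Sum>i<2^n. (A i)\<^sup>2) \<le> c\<^sup>2 * L"
      "(\<Sum>i<2^n. (G (dyad t n i) w - H i) * A i)\<^sup>2 \<le> c\<^sup>2 * L"
  shows "\<bar>\<Sum>i<2^n. (avg t G n i w - H i) * trap_err t Y W J n 0 i w\<bar>
    \<le> c * (1 + 2 * K + sqrt L + L)"
proof -
  let ?g = "\<lambda>i. avg t G n i w - H i"
  define E where "E i = trap_err t Y W J n m i w" for i
  define B where "B i = (\<Sum>q=i*2^m..<i*2^m+2^m. incr t Y (n+m) q w * incr t W (n+m) q w)" for i
  define C where "C i = incr t Y n i w * incr t W n i w" for i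
  \<comment> \<open>The averaged weight looks into the future of the cell. Only its left-end part
    may multiply the transform \<open>A i\<close> without destroying adaptedness; the remaining half
    increment of \<open>G\<close> is estimated separately in \<open>b4\<close>.\<close>
  have avg: "?g i = (G (dyad t n i) w - H i) + (1/2) * incr t G n i w" for i
    by (simp add: avg_def incr_def field_simps)
  have T: "(\<Sum>i<2^n. ?g i * trap_err t Y W J n 0 i w)
      = (\<Sum>i<2^n. ?g i * E i) + (\<Sum>i<2^n. ?g i * ((1/2) * (B i - C i)))
        + (\<Sum>i<2^n. (G (dyad t n i) w - H i) * A i) + (1/2) * (\<Sum>i<2^n. incr t G n i w * A i)"
  proof -
    have "?g i * trap_err t Y W J n 0 i w = ?g i * E i + ?g i * ((1/2) * (B i - C i))
        + (G (dyad t n i) w - H i) * A i + (1/2) * (incr t G n i w * A i)" for i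
    proof -
      have r: "trap_err t Y W J n 0 i w = E i + A i + (1/2) * (B i - C i)"
        unfolding trap_err_refine[of t Y W J n i w m] E_def B_def C_def A by (simp add: algebra_simps)
      have "?g i * (E i + A i + (1/2) * (B i - C i)) = ?g i * E i + ?g i * ((1/2) * (B i - C i)) + ?g i * A i"
        by (simp only: distrib_left)
      also have "?g i * A i = (G (dyad t n i) w - H i) * A i + (1/2) * (incr t G n i w * A i)"
        unfolding avg by (simp add: algebra_simps)
      finally show ?thesis unfolding r by simp
    qed
    then show ?thesis by (simp add: sum.distrib sum_distrib_left)
  qed
  have b1: "\<bar>\<Sum>i<2^n. ?g i * E i\<bar> \<le> c"
  proof -
    have "\<bar>\<Sum>i<2^n. ?g i * E i\<bar> \<le> (\<Sum>i<2^n. \<bar>?g i\<bar> * \<bar>E i\<bar>)"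
      by (rule order_trans[OF sum_abs]) (simp add: abs_mult)
    also have "\<dots> \<le> (\<Sum>i<(2::nat)^n. 1 * (c / 2^n))"
      using osc err c by (intro sum_mono mult_mono) (auto simp: E_def intro: order_trans)
    finally show ?thesis by simp
  qed
  have b2: "\<bar>\<Sum>i<2^n. ?g i * ((1/2) * (B i - C i))\<bar> \<le> c * K"
  proof -
    have "\<bar>\<Sum>i<2^n. ?g i * ((1/2) * (B i - C i))\<bar> \<le> (\<Sum>i<2^n. \<bar>?g i\<bar> * ((1/2) * (\<bar>B i\<bar> + \<bar>C i\<bar>)))"
      by (rule order_trans[OF sum_abs]) (auto simp: abs_mult intro!: sum_mono mult_left_mono)
    also have "\<dots> \<le> (\<Sum>i<2^n. c * ((1/2) * (\<bar>B i\<bar> + \<bar>C i\<bar>)))"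
      using osc by (intro sum_mono mult_right_mono) auto
    also have "\<dots> = c * ((1/2) * ((\<Sum>i<2^n. \<bar>B i\<bar>) + (\<Sum>i<2^n. \<bar>C i\<bar>)))"
      by (simp add: sum_distrib_left sum.distrib distrib_left)
    also have "\<dots> \<le> c * ((1/2) * (K + K))"
    proof (intro mult_left_mono add_mono)
      have "(\<Sum>i<2^n. \<bar>B i\<bar>) \<le> (\<Sum>i<2^n. \<Sum>q=i*2^m..<i*2^m+2^m. \<bar>incr t Y (n+m) q w * incr t W (n+m) q w\<bar>)"
        unfolding B_def by (intro sum_mono sum_abs)
      also have "\<dots> \<le> K"
        unfolding sum_blocks by (rule order_trans[OF sum_abs_mult_le_qv]) (use qv in simp)
      finally show "(\<Sum>i<2^n. \<bar>B i\<bar>) \<le> K" .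
      show "(\<Sum>i<2^n. \<bar>C i\<bar>) \<le> K"
        unfolding C_def by (rule order_trans[OF sum_abs_mult_le_qv]) (use qv in simp)
    qed (use c in auto)
    finally show ?thesis by simp
  qed
  have b3: "\<bar>\<Sum>i<2^n. (G (dyad t n i) w - H i) * A i\<bar> \<le> c * sqrt L"
    using real_sqrt_le_mono[OF small(2)] c by (simp add: real_sqrt_mult)
  have b4: "\<bar>(1/2) * (\<Sum>i<2^n. incr t G n i w * A i)\<bar> \<le> c * K + c * L"
  proof -
    have "\<bar>\<Sum>i<2^n. incr t G n i w * A i\<bar> \<le> (\<Sum>i<2^n. \<bar>incr t G n i w\<bar> * \<bar>A i\<bar>)"
      by (rule order_trans[OF sum_abs]) (simp add: abs_mult)
    \<comment> \<open>Young's inequality with parameter c: the quadratic sum of \<open>G\<close>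
      gets the small factor c, and dividing the sum of the (A i)^2, of order c^2, by c still leaves
      order c.\<close>
    also have "\<dots> \<le> (\<Sum>i<2^n. c * (norm (incr t G n i w))\<^sup>2 + (A i)\<^sup>2 / c)"
    proof (rule sum_mono)
      fix i
      let ?x = "\<bar>incr t G n i w\<bar>" and ?y = "\<bar>A i\<bar>"
      have "0 \<le> (c * ?x - ?y)\<^sup>2" by simp
      then have "2 * (c * (?x * ?y)) \<le> c\<^sup>2 * ?x\<^sup>2 + ?y\<^sup>2"
        by (simp add: power2_eq_square algebra_simps)
      moreover have "0 \<le> c * (?x * ?y)" using c by simp
      ultimately have "c * (?x * ?y) \<le> c\<^sup>2 * ?x\<^sup>2 + ?y\<^sup>2" by linarith
      also have "\<dots> = c * (c * ?x\<^sup>2 + ?y\<^sup>2 / c)" using c by (simp add: power2_eq_square algebra_simps)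
      finally show "?x * ?y \<le> c * (norm (incr t G n i w))\<^sup>2 + (A i)\<^sup>2 / c"
        using c by simp
    qed
    also have "\<dots> = c * dyad_qv t G n w + (\<Sum>i<2^n. (A i)\<^sup>2) / c"
      by (simp add: sum.distrib sum_distrib_left sum_divide_distrib dyad_qv_def)
    also have "\<dots> \<le> c * K + c\<^sup>2 * L / c"
      using c qv small(1) by (intro add_mono mult_left_mono divide_right_mono) auto
    also have "\<dots> = c * K + c * L" using c by (simp add: power2_eq_square)
    finally have 1: "\<bar>\<Sum>i<2^n. incr t G n i w * A i\<bar> \<le> c * K + c * L" .
    have "\<bar>(1/2) * z\<bar> \<le> \<bar>z\<bar>" for z :: real by simp
    from order_trans[OF this 1] show ?thesis .
  qed
  have tri: "\<bar>a + b + d + e\<bar> \<le> a' + b' + d' + e'"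
    if "\<bar>a\<bar> \<le> a'" "\<bar>b\<bar> \<le> b'" "\<bar>d\<bar> \<le> d'" "\<bar>e\<bar> \<le> e'" for a b d e a' b' d' e' :: real
    using that by linarith
  have "c + c * K + c * sqrt L + (c * K + c * L) = c * (1 + 2 * K + sqrt L + L)"
    by (simp add: algebra_simps)
  then show ?thesis
    unfolding T using tri[OF b1 b2 b3 b4] by (simp only:)
qed

definition trapezoid_sum :: "(real \<Rightarrow> 'w \<Rightarrow> 'b::real_vector) \<Rightarrow> (real \<Rightarrow> 'w \<Rightarrow> real) \<Rightarrow> nat \<Rightarrow> (nat \<Rightarrow> real) \<Rightarrow> 'w \<Rightarrow> 'b" where
  "trapezoid_sum Y B n p w = (\<Sum>i<n. (B (p (Suc i)) w - B (p i) w) *\<^sub>R ((1/2) *\<^sub>R (Y (p i) w + Y (p (Suc i)) w)))"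

lemma has_stratonovich_integralE:
  assumes "has_stratonovich_integral M Y B t I" "\<epsilon> > 0" "\<eta> > 0"
  obtains \<rho> where "\<rho> > 0" "\<And>n p. is_partition t n p \<Longrightarrow> \<forall>i<n. p (Suc i) - p i < \<rho> \<Longrightarrow>
    measure M {w \<in> space M. \<epsilon> < norm (trapezoid_sum Y B n p w - I w)} < \<eta>"
proof -
  have "\<exists>\<rho>>0. \<forall>n p. is_partition t n p \<and> (\<forall>i<n. p (Suc i) - p i < \<rho>) \<longrightarrow>
      measure M {w \<in> space M. \<epsilon> < norm (trapezoid_sum Y B n p w - I w)} < \<eta>"
    using assms by (simp only: has_stratonovich_integral_def trapezoid_sum_def)
  then show thesis using that by blast
qed

context brownian
begin

text \<open>The integrals are defined over intervals starting at 0, so the error on a cell is the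
  difference of the errors over [0, left end] and [0, right end]; dyadic points of the finer levels
  partition both.\<close>

lemma trap_err_conv0:
  assumes t: "0 < t" and Y: "adapted F Y"
    and J: "\<And>s. s \<in> {0..t} \<Longrightarrow> has_stratonovich_integral M Y W s (J s)" and a: "a < 2 ^ k"
  shows "conv0 M (\<lambda>m. trap_err t Y W J k m a)"
proof -
  define S where "S m b w = (\<Sum>i<b * 2 ^ m. avg t Y (k+m) i w * incr t W (k+m) i w)" for m b w
  have S: "conv0 M (\<lambda>m w. S m b w - J (dyad t k b) w)" if b: "b \<le> 2 ^ k" for b
    unfolding conv0_def
  proof (intro allI impI)
    fix \<epsilon> \<eta> :: real assume pos: "\<epsilon> > 0" "\<eta> > 0"
    have str: "has_stratonovich_integral M Y W (dyad t k b) (J (dyad t k b))"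
      using J dyad_in[of t b k] t b by simp
    then have [measurable]: "J (dyad t k b) \<in> borel_measurable M"
      by (simp add: has_stratonovich_integral_def)
    have [measurable]: "Y (dyad t n i) \<in> borel_measurable M" "W (dyad t n i) \<in> borel_measurable M" for n i
      using adapted_measurable_M[OF Y] W_measurable t by auto
    obtain \<rho> where \<rho>: "\<rho> > 0" "\<And>n p. is_partition (dyad t k b) n p \<Longrightarrow> \<forall>i<n. p (Suc i) - p i < \<rho> \<Longrightarrow>
        prob {w \<in> space M. \<epsilon> < norm (trapezoid_sum Y W n p w - J (dyad t k b) w)} < \<eta>"
      using has_stratonovich_integralE[OF str pos] by blast
    have "\<forall>\<^sub>F n in sequentially. t / 2 ^ n < \<rho>" by (rule eventually_dyad_mesh[OF \<rho>(1)])
    then have "\<forall>\<^sub>F m in sequentially. t / 2 ^ (k + m) < \<rho>"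
      by (subst (asm) eventually_sequentially_seg[of _ k, symmetric]) (simp add: add.commute)
    then show "\<forall>\<^sub>F m in sequentially. whp M \<eta> (\<lambda>w. \<bar>S m b w - J (dyad t k b) w\<bar> \<le> \<epsilon>)"
    proof eventually_elim
      case (elim m)
      have part: "is_partition (dyad t k b) (b * 2 ^ m) (dyad t (k + m))"
        using is_partition_dyad[OF t, of "k + m" "b * 2 ^ m"] by (simp add: dyad_refine)
      have eq: "trapezoid_sum Y W (b * 2 ^ m) (dyad t (k + m)) w = S m b w" for w
        by (simp add: S_def trapezoid_sum_def avg_def incr_def mult.commute)
      have "prob {w \<in> space M. \<epsilon> < norm (S m b w - J (dyad t k b) w)} < \<eta>"
        using \<rho>(2)[OF part] elim unfolding dyad_Suc_diff eq by simp
      then show ?case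
        unfolding whp_def
        by (intro bexI[of _ "{w \<in> space M. \<epsilon> < norm (S m b w - J (dyad t k b) w)}"])
           (auto simp: S_def avg_def incr_def)
    qed
  qed
  have eq: "trap_err t Y W J k m a w = (S m a w - J (dyad t k a) w) - (S m (Suc a) w - J (dyad t k (Suc a)) w)" for m w
  proof -
    have "S m (Suc a) w = S m a w + (\<Sum>i=a*2^m..<a*2^m+2^m. avg t Y (k+m) i w * incr t W (k+m) i w)"
      unfolding S_def lessThan_atLeast0
      by (subst sum.atLeastLessThan_concat) (auto simp: add.commute)
    then show ?thesis by (simp add: trap_err_def incr_def)
  qed
  show ?thesis unfolding eq using a by (intro conv0_diff S) auto
qed

text \<open>The order of the choices matters: c depends on \<epsilon>, the coarse level k on the
  modulus of continuity for oscillation c, and this k serves every l. The finer level m, absent from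
  the statement, may depend on n = k + l and makes the error of each of the 2^n cells
  negligible.\<close>

lemma weighted_trap_err_small:
  assumes t: "0 < t"
    and Y: "adapted F Y" "continuous_paths M Y" "stoch_bounded M (dyad_qv t Y)"
    and G: "adapted F G" "continuous_paths M G" "stoch_bounded M (dyad_qv t G)"
    and J: "\<And>s. s \<in> {0..t} \<Longrightarrow> has_stratonovich_integral M Y W s (J s)"
    and pos: "\<epsilon> > 0" "\<eta> > 0"
  shows "\<exists>k. \<forall>l. whp M \<eta> (\<lambda>w. \<bar>\<Sum>i<2^(k+l). (avg t G (k+l) i w - G (dyad t k (i div 2^l)) w)
      * trap_err t Y W J (k+l) 0 i w\<bar> \<le> \<epsilon>)"
proof -
  \<comment> \<open>The 14 shares: 3 + 3 for the two transforms, 2 for the oscillations, 1 for the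
    cell errors, and 2 + 1 + 2 for the quadratic sums of \<open>Y\<close>, \<open>G\<close> and
    \<open>W\<close>.\<close>
  define \<theta> where "\<theta> = \<eta> / 14"
  have \<theta>: "\<theta> > 0" using pos by (simp add: \<theta>_def)
  obtain KY where KY: "KY > 0" "\<And>n. whp M \<theta> (\<lambda>w. \<bar>dyad_qv t Y n w\<bar> \<le> KY)"
    using stoch_boundedE[OF Y(3) \<theta>] by blast
  obtain KG where KG: "KG > 0" "\<And>n. whp M \<theta> (\<lambda>w. \<bar>dyad_qv t G n w\<bar> \<le> KG)"
    using stoch_boundedE[OF G(3) \<theta>] by blast
  obtain KW where KW: "KW > 0" "\<And>n. whp M \<theta> (\<lambda>w. \<bar>dyad_qv t W n w\<bar> \<le> KW)"
    using stoch_boundedE[OF W_qv_bounded[OF t] \<theta>] by blast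
  define K where "K = KY + KG + KW"
  have K: "K > 0" "KY \<le> K" "KG \<le> K" "KW \<le> K" using KY(1) KG(1) KW(1) by (auto simp: K_def)
  \<comment> \<open>With this \<open>L\<close> the Chebyshev bound c^2 * t / (c^2 * L) for the
    transforms is exactly \<theta>; see \<open>budget\<close>.\<close>
  define L where "L = t / \<theta>"
  have L: "L > 0" using t \<theta> by (simp add: L_def)
  \<comment> \<open>The factor of c in the conclusion of \<open>weighted_trap_err_bound\<close>, so
    that c \<le> \<epsilon> / Q gives the claim.\<close>
  define Q where "Q = 1 + 2 * K + sqrt L + L"
  have Q: "Q > 0" using K L by (simp add: Q_def add_pos_pos)
  define c where "c = min 1 (\<epsilon> / Q)"
  have c: "0 < c" "c \<le> 1" and cQ: "c * Q \<le> \<epsilon>"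
  proof -
    show "0 < c" "c \<le> 1" using pos Q by (auto simp: c_def)
    have "c * Q \<le> (\<epsilon> / Q) * Q" using Q by (intro mult_right_mono) (auto simp: c_def)
    then show "c * Q \<le> \<epsilon>" using Q by simp
  qed
  obtain \<delta>Y where \<delta>Y: "\<delta>Y > 0"
    "whp M \<theta> (\<lambda>w. \<forall>s\<in>{0..t}. \<forall>u\<in>{0..t}. \<bar>s - u\<bar> < \<delta>Y \<longrightarrow> norm (Y s w - Y u w) \<le> c)"
    using whp_paths_modulus[OF _ Y(2) c(1) \<theta>, of t] adapted_measurable_M[OF Y(1)] by auto
  obtain \<delta>G where \<delta>G: "\<delta>G > 0"
    "whp M \<theta> (\<lambda>w. \<forall>s\<in>{0..t}. \<forall>u\<in>{0..t}. \<bar>s - u\<bar> < \<delta>G \<longrightarrow> norm (G s w - G u w) \<le> c)"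
    using whp_paths_modulus[OF _ G(2) c(1) \<theta>, of t] adapted_measurable_M[OF G(1)] by auto
  define \<delta> where "\<delta> = min \<delta>Y \<delta>G"
  define Osc where "Osc w \<longleftrightarrow> (\<forall>s\<in>{0..t}. \<forall>u\<in>{0..t}. \<bar>s - u\<bar> < \<delta> \<longrightarrow>
      \<bar>Y s w - Y u w\<bar> \<le> c \<and> \<bar>G s w - G u w\<bar> \<le> c)" for w
  have Osc: "whp M (2 * \<theta>) Osc"
    by (rule whp_mono[OF whp_conj[OF \<delta>Y(2) \<delta>G(2) order_refl]]) (auto simp: Osc_def \<delta>_def)
  have "\<delta> > 0" using \<delta>Y(1) \<delta>G(1) by (simp add: \<delta>_def)
  from eventually_dyad_mesh[OF this] obtain k where k: "t / 2 ^ k < \<delta>"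
    by (auto simp: eventually_sequentially)
  have t0: "0 \<le> t" using t by simp
  have mesh: "t / 2 ^ (k + l) \<le> t / 2 ^ k" for l
    using t by (intro divide_left_mono) auto
  show ?thesis
  proof (intro exI[of _ k] allI)
    fix l
    define n where "n = k + l"
    define o' where "o' i = dyad t k (i div 2 ^ l)" for i
    have o_in: "o' i \<in> {0..t}" "o' i \<le> dyad t n i" "dyad t n (Suc i) - o' i \<le> t / 2 ^ k" if i: "i < 2 ^ n" for i
    proof -
      have "i \<in> {(i div 2 ^ l) * 2 ^ l..<(i div 2 ^ l) * 2 ^ l + 2 ^ l}"
        using dividend_less_div_times[of "2^l" i] by (auto simp: mult.commute)
      note blk = dyad_block[OF t0 this, of k]
      have "i div 2 ^ l < 2 ^ k" using i by (simp add: n_def power_add less_mult_imp_div_less)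
      then show "o' i \<in> {0..t}" unfolding o'_def by (intro dyad_in t0) auto
      show "o' i \<le> dyad t n i" unfolding o'_def n_def by (rule blk)
      show "dyad t n (Suc i) - o' i \<le> t / 2 ^ k"
        unfolding o'_def n_def using blk(4) dyad_Suc_diff[of t k "i div 2 ^ l"] by linarith
    qed
    have "\<forall>\<^sub>F m in sequentially. \<forall>i\<in>{..<2^n}. whp M (\<theta> / 2 ^ n) (\<lambda>w. \<bar>trap_err t Y W J n m i w\<bar> \<le> c / 2 ^ n)"
      using c \<theta> by (intro eventually_ball_finite ballI conv0D trap_err_conv0[OF t Y(1) J]) auto
    \<comment> \<open>One m serves all 2^n cells; failure probability \<theta> / 2^n and error c /
      2^n per cell add up to \<theta> and c.\<close>
    then obtain m where m: "\<And>i. i \<in> {..<2^n} \<Longrightarrow> whp M (\<theta> / 2 ^ n) (\<lambda>w. \<bar>trap_err t Y W J n m i w\<bar> \<le> c / 2 ^ n)"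
      by (auto simp: eventually_sequentially)
    have err: "whp M \<theta> (\<lambda>w. \<forall>i\<in>{..<2^n}. \<bar>trap_err t Y W J n m i w\<bar> \<le> c / 2 ^ n)"
      using whp_ball[OF _ m, of "{..<2^n}" "\<lambda>i. i"] by simp
    define A where "A i w = (\<Sum>q=i*2^m..<i*2^m+2^m.
        (Y (dyad t (n+m) q) w - Y (dyad t n i) w) * incr t W (n+m) q w)" for i w
    \<comment> \<open>The weights of the fine increments in the two transforms. Here
      \<open>q div 2^m\<close> is the level-n cell containing fine cell q, so all times that occur
      are at most the left end of cell q, as adaptedness demands.\<close>
    define h1 where "h1 q w = Y (dyad t (n+m) q) w - Y (dyad t n (q div 2^m)) w" for q w
    define h2 where "h2 q w = (G (dyad t n (q div 2^m)) w - G (o' (q div 2^m)) w) * h1 q w" for q w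
    have q_facts: "dyad t n (q div 2 ^ m) \<le> dyad t (n+m) q" "o' (q div 2^m) \<le> dyad t (n+m) q"
      "0 \<le> o' (q div 2^m)" "dyad t (n+m) q \<in> {0..t}" "dyad t n (q div 2^m) \<in> {0..t}"
      "\<bar>dyad t (n+m) q - dyad t n (q div 2 ^ m)\<bar> < \<delta>" "q div 2^m < 2^n" if q: "q < 2 ^ (n + m)" for q
    proof -
      have "q \<in> {(q div 2 ^ m) * 2 ^ m..<(q div 2 ^ m) * 2 ^ m + 2 ^ m}"
        using dividend_less_div_times[of "2^m" q] by (auto simp: mult.commute)
      note blk = dyad_block[OF t0 this, of n]
      show qd: "q div 2 ^ m < 2 ^ n" using q by (simp add: power_add less_mult_imp_div_less)
      show le: "dyad t n (q div 2 ^ m) \<le> dyad t (n+m) q" by (rule blk)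
      show "o' (q div 2^m) \<le> dyad t (n+m) q" using o_in(2)[OF qd] le by simp
      show "0 \<le> o' (q div 2^m)" using o_in(1)[OF qd] by simp
      show "dyad t (n+m) q \<in> {0..t}" using q by (intro dyad_in t0) simp
      show "dyad t n (q div 2^m) \<in> {0..t}" using qd by (intro dyad_in t0) simp
      show "\<bar>dyad t (n+m) q - dyad t n (q div 2 ^ m)\<bar> < \<delta>"
        using blk(1,2) dyad_Suc_diff[of t n "q div 2^m"] k mesh[of l] unfolding n_def by linarith
    qed
    have h1F: "h1 q \<in> borel_measurable (F (dyad t (n+m) q))" if "q < 2 ^ (n + m)" for q
      unfolding h1_def using q_facts[OF that] adapted_measurable[OF Y(1)]
      by (intro borel_measurable_diff) auto
    have h2F: "h2 q \<in> borel_measurable (F (dyad t (n+m) q))" if "q < 2 ^ (n + m)" for q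
      unfolding h2_def using q_facts[OF that] adapted_measurable[OF G(1)] h1F[OF that]
      by (intro borel_measurable_diff borel_measurable_times) auto
    have small1: "\<bar>h1 q w\<bar> \<le> c" if "Osc w" "q < 2 ^ (n + m)" for q w
      using that q_facts[OF that(2)] unfolding h1_def Osc_def by blast
    have oscG: "\<bar>G s w - G (o' i) w\<bar> \<le> c" if "Osc w" "i < 2^n" "s \<in> {dyad t n i, dyad t n (Suc i)}" for i s w
    proof -
      have "s \<in> {0..t}" using that by (auto simp: dyad_le t0 Suc_leI)
      moreover have "\<bar>s - o' i\<bar> < \<delta>"
        using that(3) o_in[OF that(2)] k dyad_mono[of t i "Suc i" n] t0 by auto
      ultimately show ?thesis using that(1) o_in(1)[OF that(2)] unfolding Osc_def by blast
    qed
    have small2: "\<bar>h2 q w\<bar> \<le> c" if "Osc w" "q < 2 ^ (n + m)" for q w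
    proof -
      have "\<bar>h2 q w\<bar> \<le> c * c"
        unfolding h2_def abs_mult using small1[OF that] oscG[OF that(1)] q_facts(7)[OF that(2)] c
        by (intro mult_mono) auto
      also have "\<dots> \<le> c" using c by (simp add: mult_left_le)
      finally show ?thesis .
    qed
    have budget: "c\<^sup>2 * (dyad t (n+m) (2^(n+m)) - dyad t (n+m) 0) / (c\<^sup>2 * L) = \<theta>"
      using c t \<theta> by (simp add: L_def)
    have cL: "0 < c\<^sup>2 * L" using c L by simp
    have "whp M (2 * \<theta>) (\<lambda>w. \<forall>i<2^n * 2^m. \<bar>h1 i w\<bar> \<le> c)"
      by (rule whp_mono[OF Osc]) (auto simp: small1 power_add)
    from transform_whp[where p = "dyad t (n+m)" and n = "2^n" and m = "2^m", OF _ _ _ cL _ this] 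
    have tr1: "whp M (3 * \<theta>) (\<lambda>w. (\<Sum>i<2^n. (A i w)\<^sup>2) \<le> c\<^sup>2 * L)"
    proof (rule whp_mono)
      show "2 * \<theta> + c\<^sup>2 * (dyad t (n+m) (2^n * 2^m) - dyad t (n+m) 0) / (c\<^sup>2 * L) \<le> 3 * \<theta>"
        using budget by (simp add: power_add)
      fix w assume *: "(\<Sum>k<2^n. (\<Sum>i=k*2^m..<k*2^m+2^m. h1 i w * (W (dyad t (n+m) (Suc i)) w - W (dyad t (n+m) i) w))\<^sup>2) \<le> c\<^sup>2 * L"
      have "A k w = (\<Sum>i=k*2^m..<k*2^m+2^m. h1 i w * (W (dyad t (n+m) (Suc i)) w - W (dyad t (n+m) i) w))" for k
        unfolding A_def h1_def incr_def by (intro sum.cong refl) (simp only: block_div)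
      then show "(\<Sum>i<2^n. (A i w)\<^sup>2) \<le> c\<^sup>2 * L" using * by simp
    qed (use t c h1F in \<open>auto simp: dyad_less power_add\<close>)
    have "whp M (2 * \<theta>) (\<lambda>w. \<forall>i<1 * 2^(n+m). \<bar>h2 i w\<bar> \<le> c)"
      by (rule whp_mono[OF Osc]) (auto simp: small2)
    \<comment> \<open>With a single block, the sum of squares is the square of the whole weighted
      transform.\<close>
    from transform_whp[where p = "dyad t (n+m)" and n = 1 and m = "2^(n+m)", OF _ _ _ cL _ this]
    have tr2: "whp M (3 * \<theta>) (\<lambda>w. (\<Sum>i<2^n. (G (dyad t n i) w - G (o' i) w) * A i w)\<^sup>2 \<le> c\<^sup>2 * L)"
    proof (rule whp_mono)
      show "2 * \<theta> + c\<^sup>2 * (dyad t (n+m) (1 * 2^(n+m)) - dyad t (n+m) 0) / (c\<^sup>2 * L) \<le> 3 * \<theta>"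
        using budget by simp
      fix w assume *: "(\<Sum>k<1. (\<Sum>i=k*2^(n+m)..<k*2^(n+m)+2^(n+m). h2 i w * (W (dyad t (n+m) (Suc i)) w - W (dyad t (n+m) i) w))\<^sup>2) \<le> c\<^sup>2 * L"
      have "(\<Sum>i<2^n. (G (dyad t n i) w - G (o' i) w) * A i w)
          = (\<Sum>i<2^n. \<Sum>q=i*2^m..<i*2^m+2^m. h2 q w * incr t W (n+m) q w)"
        unfolding A_def sum_distrib_left
        by (intro sum.cong refl) (simp add: h2_def h1_def block_div mult.assoc)
      also have "\<dots> = (\<Sum>q<2^(n+m). h2 q w * incr t W (n+m) q w)"
        by (rule sum_blocks)
      finally show "(\<Sum>i<2^n. (G (dyad t n i) w - G (o' i) w) * A i w)\<^sup>2 \<le> c\<^sup>2 * L"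
        using * by (simp add: incr_def lessThan_atLeast0)
    qed (use t c h2F in \<open>auto simp: dyad_less\<close>)
    note all = whp_conj[OF whp_conj[OF whp_conj[OF tr1 tr2 order_refl] whp_conj[OF Osc err order_refl] order_refl]
        whp_conj[OF whp_conj[OF KY(2)[of n] KY(2)[of "n+m"] order_refl]
          whp_conj[OF KG(2)[of n] whp_conj[OF KW(2)[of n] KW(2)[of "n+m"] order_refl] order_refl] order_refl] order_refl]
    show "whp M \<eta> (\<lambda>w. \<bar>\<Sum>i<2^(k+l). (avg t G (k+l) i w - G (dyad t k (i div 2^l)) w)
        * trap_err t Y W J (k+l) 0 i w\<bar> \<le> \<epsilon>)"
      unfolding n_def[symmetric] o'_def[symmetric]
    proof (rule whp_mono[OF all], goal_cases)
      case 1
      show ?case by (simp add: \<theta>_def)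
    next
      case (2 w)
      then have "Osc w" by (elim conjE)
      have "\<bar>avg t G n i w - G (o' i) w\<bar> \<le> c" if "i < 2 ^ n" for i
      proof -
        have "\<bar>G (dyad t n i) w - G (o' i) w\<bar> \<le> c" "\<bar>G (dyad t n (Suc i)) w - G (o' i) w\<bar> \<le> c"
          using oscG[OF \<open>Osc w\<close> that] by auto
        then show ?thesis unfolding avg_def by (simp add: abs_le_iff field_simps)
      qed
      then have "\<bar>\<Sum>i<2^n. (avg t G n i w - G (o' i) w) * trap_err t Y W J n 0 i w\<bar>
          \<le> c * (1 + 2 * K + sqrt L + L)"
        using 2 K by (intro weighted_trap_err_bound[OF c K(1) L, where m = m and A = "\<lambda>i. A i w"])
          (auto simp: A_def)
      also have "\<dots> \<le> \<epsilon>" using cQ by (simp add: Q_def)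
      finally show ?case .
    qed
  qed
qed

text \<open>A discrete form of \<open>G \<circ> (Y \<circ> dW) = (G Y) \<circ> dW\<close>. The weights are frozen on a coarse partition, where
  the definition of \<open>J\<close> applies; the error of freezing them is controlled by replacing the increments of \<open>J\<close>
  by trapezoidal sums of a much finer level.\<close>

theorem stratonovich_associative:
  assumes t: "0 < t"
    and Y: "adapted F Y" "continuous_paths M Y" "stoch_bounded M (dyad_qv t Y)"
    and G: "adapted F G" "continuous_paths M G" "stoch_bounded M (dyad_qv t G)"
    and J: "\<And>s. s \<in> {0..t} \<Longrightarrow> has_stratonovich_integral M Y W s (J s)"
  shows "conv0 M (\<lambda>n w. \<Sum>i<2^n. avg t G n i w *
    (incr t J n i w - avg t Y n i w * incr t W n i w))"
  unfolding conv0_def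
proof (intro allI impI)
  fix \<epsilon> \<eta> :: real assume pos: "\<epsilon> > 0" "\<eta> > 0"
  let ?P = "\<lambda>n. whp M \<eta> (\<lambda>w. \<bar>\<Sum>i<2^n. avg t G n i w *
      (incr t J n i w - avg t Y n i w * incr t W n i w)\<bar> \<le> \<epsilon>)"
  have pos2: "\<epsilon>/2 > 0" "\<eta>/2 > 0" using pos by auto
  from weighted_trap_err_small[OF t Y G J pos2]
  obtain k where k: "\<And>l. whp M (\<eta>/2) (\<lambda>w. \<bar>\<Sum>i<2^(k+l). (avg t G (k+l) i w - G (dyad t k (i div 2^l)) w)
      * trap_err t Y W J (k+l) 0 i w\<bar> \<le> \<epsilon>/2)"
    by auto
  have "conv0 M (\<lambda>l w. \<Sum>a<2^k. trap_err t Y W J k l a w * G (dyad t k a) w)"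
  proof (intro conv0_sum conv0_mult_bounded)
    fix a :: nat assume "a \<in> {..<2^k}"
    then show "conv0 M (\<lambda>l. trap_err t Y W J k l a)"
      by (intro trap_err_conv0[OF t Y(1) J]) auto
    show "stoch_bounded M (\<lambda>l. G (dyad t k a))"
      using adapted_measurable_M[OF G(1)] t by (intro stoch_bounded_pathwise) auto
  qed
  from conv0D[OF this pos2]
  have "\<forall>\<^sub>F l in sequentially. whp M \<eta> (\<lambda>w. \<bar>\<Sum>i<2^(k+l). avg t G (k+l) i w *
      (incr t J (k+l) i w - avg t Y (k+l) i w * incr t W (k+l) i w)\<bar> \<le> \<epsilon>)"
  proof eventually_elim
    case (elim l)
    show ?case
    proof (rule whp_mono[OF whp_conj[OF elim k[of l], where \<eta> = \<eta>]])
      fix w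
      let ?r = "\<lambda>i. trap_err t Y W J (k+l) 0 i w"
      let ?G = "\<lambda>i. G (dyad t k (i div 2^l)) w"
      have "(\<Sum>i<2^(k+l). avg t G (k+l) i w * ?r i)
          = (\<Sum>i<2^(k+l). ?r i * ?G i) + (\<Sum>i<2^(k+l). (avg t G (k+l) i w - ?G i) * ?r i)"
        by (simp add: sum.distrib[symmetric] algebra_simps)
      also have "(\<Sum>i<2^(k+l). ?r i * ?G i) = (\<Sum>a<2^k. \<Sum>i=a*2^l..<a*2^l+2^l. ?r i * ?G i)"
        by (rule sum_blocks[symmetric])
      also have "\<dots> = (\<Sum>a<2^k. trap_err t Y W J k l a w * G (dyad t k a) w)"
      proof (rule sum.cong)
        fix a
        have "(\<Sum>i=a*2^l..<a*2^l+2^l. ?r i * ?G i) = (\<Sum>i=a*2^l..<a*2^l+2^l. ?r i * G (dyad t k a) w)"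
          by (intro sum.cong refl) (simp only: block_div)
        also have "\<dots> = trap_err t Y W J k l a w * G (dyad t k a) w"
          by (simp only: sum_distrib_right[symmetric] sum_trap_err_block)
        finally show "(\<Sum>i=a*2^l..<a*2^l+2^l. ?r i * ?G i) = trap_err t Y W J k l a w * G (dyad t k a) w" .
      qed simp
      finally have eq: "(\<Sum>i<2^(k+l). avg t G (k+l) i w * ?r i)
          = (\<Sum>a<2^k. trap_err t Y W J k l a w * G (dyad t k a) w)
          + (\<Sum>i<2^(k+l). (avg t G (k+l) i w - ?G i) * ?r i)" .
      assume "\<bar>\<Sum>a<2^k. trap_err t Y W J k l a w * G (dyad t k a) w\<bar> \<le> \<epsilon>/2 \<and>
          \<bar>\<Sum>i<2^(k+l). (avg t G (k+l) i w - ?G i) * ?r i\<bar> \<le> \<epsilon>/2"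
      then have "\<bar>\<Sum>i<2^(k+l). avg t G (k+l) i w * ?r i\<bar> \<le> \<epsilon>"
        unfolding eq by linarith
      then show "\<bar>\<Sum>i<2^(k+l). avg t G (k+l) i w *
          (incr t J (k+l) i w - avg t Y (k+l) i w * incr t W (k+l) i w)\<bar> \<le> \<epsilon>"
        by (simp only: trap_err_0)
    qed simp_all
  qed
  then have "\<forall>\<^sub>F l in sequentially. ?P (l + k)"
    by (simp only: add.commute)
  then show "eventually ?P sequentially"
    by (simp only: eventually_sequentially_seg[of ?P k])
qed

end

section \<open>The trapezoidal rule for the determinant\<close>

text \<open>The derivative of the product over \<open>S\<close> at a in direction h, written without
  division so that factors may vanish.\<close>

definition prod_deriv :: "'i set \<Rightarrow> ('i \<Rightarrow> real) \<Rightarrow> ('i \<Rightarrow> real) \<Rightarrow> real" where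
  "prod_deriv S a h = (\<Sum>i\<in>S. h i * (\<Prod>k\<in>S - {i}. a k))"

lemma prod_deriv_insert:
  assumes "finite S" "j \<notin> S"
  shows "prod_deriv (insert j S) a h = h j * prod a S + a j * prod_deriv S a h"
proof -
  have "(\<Prod>k\<in>insert j S - {i}. a k) = a j * (\<Prod>k\<in>S - {i}. a k)" if "i \<in> S" for i
  proof -
    have "insert j S - {i} = insert j (S - {i})" using assms that by auto
    then show ?thesis using assms by simp
  qed
  then have "(\<Sum>i\<in>S. h i * (\<Prod>k\<in>insert j S - {i}. a k)) = a j * prod_deriv S a h"
    by (simp add: prod_deriv_def sum_distrib_left algebra_simps)
  moreover have "insert j S - {j} = S" using assms by auto
  ultimately show ?thesis using assms by (simp add: prod_deriv_def)
qed

text \<open>The six estimates are carried through the induction together, since adding a factor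
  mixes them: the cubic bound for the trapezoidal defect needs the quadratic bound for the change of
  the derivative, which in turn needs the linear bounds.\<close>

lemma prod_trapezoid:
  fixes S :: "'i set"
  assumes "finite S" "0 \<le> R"
  shows "\<exists>C\<ge>0. \<forall>a b h d. 0 \<le> d \<longrightarrow> (\<forall>i\<in>S. \<bar>a i\<bar> \<le> R \<and> \<bar>b i\<bar> \<le> R \<and> b i = a i + h i \<and> \<bar>h i\<bar> \<le> d) \<longrightarrow>
     \<bar>prod a S\<bar> \<le> C \<and> \<bar>prod b S\<bar> \<le> C \<and> \<bar>prod_deriv S b h\<bar> \<le> C * d \<and> \<bar>prod b S - prod a S\<bar> \<le> C * d \<and>
     \<bar>prod_deriv S b h - prod_deriv S a h\<bar> \<le> C * d\<^sup>2 \<and>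
     \<bar>prod b S - prod a S - (prod_deriv S a h + prod_deriv S b h) / 2\<bar> \<le> C * d ^ 3"
  (is "\<exists>C\<ge>0. ?P S C")
  using assms(1)
proof (induction S rule: finite_induct)
  case empty
  show ?case by (intro exI[of _ 1]) (simp add: prod_deriv_def)
next
  case (insert j S)
  then obtain C where C: "C \<ge> 0" and IH: "?P S C"
    by blast
  show ?case
  \<comment> \<open>By the product rule at most two terms carry the increment of the new factor and
    one carries the factor itself, which is at most R; hence 2 + R.\<close>
  proof (rule exI[of _ "(2 + R) * C"], rule conjI, goal_cases)
    case 1
    show "0 \<le> (2 + R) * C" using C assms(2) by simp
  next
    case 2
    show ?case
    proof (intro allI impI)
    fix a b h :: "'i \<Rightarrow> real" and d :: real
    assume d: "0 \<le> d" and ab: "\<forall>i\<in>insert j S. \<bar>a i\<bar> \<le> R \<and> \<bar>b i\<bar> \<le> R \<and> b i = a i + h i \<and> \<bar>h i\<bar> \<le> d"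
    define A where "A = a j"
    define A' where "A' = b j"
    define k where "k = h j"
    define P where "P = prod a S"
    define P' where "P' = prod b S"
    define B where "B = prod_deriv S a h"
    define B' where "B' = prod_deriv S b h"
    define e where "e = P' - P - (B + B') / 2"
    have 1: "\<bar>A\<bar> \<le> R" "\<bar>A'\<bar> \<le> R" "\<bar>k\<bar> \<le> d" "A' = A + k"
      using ab by (auto simp: A_def A'_def k_def)
    have "\<forall>i\<in>S. \<bar>a i\<bar> \<le> R \<and> \<bar>b i\<bar> \<le> R \<and> b i = a i + h i \<and> \<bar>h i\<bar> \<le> d"
      using ab by blast
    from IH[rule_format, OF d this[rule_format]]
    have 2: "\<bar>P\<bar> \<le> C" "\<bar>P'\<bar> \<le> C" "\<bar>B'\<bar> \<le> C * d" "\<bar>P' - P\<bar> \<le> C * d" "\<bar>B' - B\<bar> \<le> C * d\<^sup>2" "\<bar>e\<bar> \<le> C * d ^ 3"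
      unfolding P_def P'_def B_def B'_def e_def by simp_all
    have R: "0 \<le> R" by fact
    have A2: "\<bar>A\<bar> \<le> 2 + R" "\<bar>A'\<bar> \<le> 2 + R" "0 \<le> 2 + R" using 1(1,2) R by linarith+
    have expand: "(2 + R) * C * d = d * C + d * C + R * (C * d)" by (simp add: algebra_simps)
    have b1: "\<bar>A * P\<bar> \<le> (2 + R) * C"
    proof -
      have "\<bar>A\<bar> * \<bar>P\<bar> \<le> (2 + R) * C" by (intro mult_mono A2 2 abs_ge_zero)
      then show ?thesis by (simp add: abs_mult)
    qed
    have b1': "\<bar>A' * P'\<bar> \<le> (2 + R) * C"
    proof -
      have "\<bar>A'\<bar> * \<bar>P'\<bar> \<le> (2 + R) * C" by (intro mult_mono A2 2 abs_ge_zero)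
      then show ?thesis by (simp add: abs_mult)
    qed
    have b2: "\<bar>k * P' + A' * B'\<bar> \<le> (2 + R) * C * d"
    proof -
      have "\<bar>k\<bar> * \<bar>P'\<bar> \<le> d * C" by (intro mult_mono 1 2 d abs_ge_zero)
      moreover have "\<bar>A'\<bar> * \<bar>B'\<bar> \<le> R * (C * d)" by (intro mult_mono 1 2 R abs_ge_zero)
      moreover have "0 \<le> d * C" using C d by simp
      ultimately show ?thesis
        using abs_triangle_ineq[of "k * P'" "A' * B'"] unfolding abs_mult expand by linarith
    qed
    have b3: "\<bar>A' * P' - A * P\<bar> \<le> (2 + R) * C * d"
    proof -
      have "\<bar>k\<bar> * \<bar>P\<bar> \<le> d * C" by (intro mult_mono 1 2 d abs_ge_zero)
      moreover have "\<bar>A'\<bar> * \<bar>P' - P\<bar> \<le> R * (C * d)" by (intro mult_mono 1 2 R abs_ge_zero)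
      moreover have "0 \<le> d * C" using C d by simp
      moreover have "A' * P' - A * P = k * P + A' * (P' - P)" using 1(4) by (simp add: algebra_simps)
      ultimately show ?thesis
        using abs_triangle_ineq[of "k * P" "A' * (P' - P)"] unfolding abs_mult expand by linarith
    qed
    have b4: "\<bar>(k * P' + A' * B') - (k * P + A * B)\<bar> \<le> (2 + R) * C * d\<^sup>2"
    proof -
      have "\<bar>k\<bar> * \<bar>P' - P\<bar> \<le> d * (C * d)" by (intro mult_mono 1 2 d abs_ge_zero)
      moreover have "\<bar>k\<bar> * \<bar>B'\<bar> \<le> d * (C * d)" by (intro mult_mono 1 2 d abs_ge_zero)
      moreover have "\<bar>A\<bar> * \<bar>B' - B\<bar> \<le> R * (C * d\<^sup>2)" by (intro mult_mono 1 2 R abs_ge_zero)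
      moreover have "(k * P' + A' * B') - (k * P + A * B) = k * (P' - P) + k * B' + A * (B' - B)"
        using 1(4) by (simp add: algebra_simps)
      moreover have "\<bar>k * (P' - P) + k * B' + A * (B' - B)\<bar> \<le> \<bar>k\<bar> * \<bar>P' - P\<bar> + \<bar>k\<bar> * \<bar>B'\<bar> + \<bar>A\<bar> * \<bar>B' - B\<bar>"
        unfolding abs_mult[symmetric] by linarith
      ultimately have "\<bar>(k * P' + A' * B') - (k * P + A * B)\<bar> \<le> d * (C * d) + d * (C * d) + R * (C * d\<^sup>2)"
        by linarith
      then show ?thesis by (simp add: power2_eq_square algebra_simps)
    qed
    have b5: "\<bar>A' * P' - A * P - ((k * P + A * B) + (k * P' + A' * B')) / 2\<bar> \<le> (2 + R) * C * d ^ 3"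
    proof -
      have P'_eq: "P' = P + (B + B') / 2 + e" by (simp add: e_def)
      \<comment> \<open>The terms of first and second order cancel: what is left is the old defect
        times the mean of the new factor, and a product of k with the change of the derivative,
        itself quadratic.\<close>
      have "A' * P' - A * P - ((k * P + A * B) + (k * P' + A' * B')) / 2
          = (A + A') / 2 * e - k * (B' - B) / 4"
        unfolding P'_eq 1(4) by (simp add: field_simps)
      moreover have "\<bar>(A + A') / 2\<bar> * \<bar>e\<bar> \<le> R * (C * d ^ 3)"
      proof (intro mult_mono 2 R abs_ge_zero)
        have "\<bar>A + A'\<bar> \<le> R + R" using 1(1,2) by linarith
        then show "\<bar>(A + A') / 2\<bar> \<le> R" by simp
      qed
      moreover have "\<bar>k\<bar> * \<bar>B' - B\<bar> \<le> d * (C * d\<^sup>2)" by (intro mult_mono 1 2 d abs_ge_zero)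
      moreover have "\<bar>(A + A') / 2 * e - k * (B' - B) / 4\<bar> \<le> \<bar>(A + A') / 2\<bar> * \<bar>e\<bar> + \<bar>k\<bar> * \<bar>B' - B\<bar>"
        unfolding abs_mult[symmetric] by linarith
      ultimately have "\<bar>A' * P' - A * P - ((k * P + A * B) + (k * P' + A' * B')) / 2\<bar> \<le> R * (C * d ^ 3) + d * (C * d\<^sup>2)"
        by linarith
      also have "\<dots> \<le> R * (C * d ^ 3) + 2 * (d * (C * d\<^sup>2))"
        using C d by simp
      also have "\<dots> = (2 + R) * C * d ^ 3"
        by (simp add: power2_eq_square power3_eq_cube algebra_simps)
      finally show ?thesis .
    qed
    show "\<bar>prod a (insert j S)\<bar> \<le> (2 + R) * C \<and> \<bar>prod b (insert j S)\<bar> \<le> (2 + R) * C \<and>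
     \<bar>prod_deriv (insert j S) b h\<bar> \<le> (2 + R) * C * d \<and>
     \<bar>prod b (insert j S) - prod a (insert j S)\<bar> \<le> (2 + R) * C * d \<and>
     \<bar>prod_deriv (insert j S) b h - prod_deriv (insert j S) a h\<bar> \<le> (2 + R) * C * d\<^sup>2 \<and>
     \<bar>prod b (insert j S) - prod a (insert j S)
       - (prod_deriv (insert j S) a h + prod_deriv (insert j S) b h) / 2\<bar> \<le> (2 + R) * C * d ^ 3"
      using b1 b1' b2 b3 b4 b5
      unfolding A_def A'_def P_def P'_def B_def B'_def k_def
        prod_deriv_insert[OF insert.hyps] prod.insert[OF insert.hyps]
      by (intro conjI)
    qed
  qed
qed

text \<open>The gradient of \<open>det\<close> at v. Replacing row i by a unit vector gives the
  cofactor as a determinant of the same size, which avoids minors and covers singular v.\<close>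

definition cofactor_matrix :: "real^'n^'n \<Rightarrow> real^'n^'n" where
  "cofactor_matrix v = (\<chi> i j. det (\<chi> k. if k = i then axis j 1 else v $ k))"

text \<open>Expanding row i of h in unit vectors and using linearity of \<open>det\<close> in that
  row identifies the pairing with the derivative of \<open>det\<close> in direction h.\<close>

lemma cofactor_matrix_inner:
  fixes v h :: "real^'n^'n"
  shows "cofactor_matrix v \<bullet> h = (\<Sum>i\<in>UNIV. det (\<chi> k. if k = i then h $ i else v $ k))"
proof -
  have "(\<Sum>j\<in>UNIV. cofactor_matrix v $ i $ j * h $ i $ j) = det (\<chi> k. if k = i then h $ i else v $ k)" for i
  proof -
    have hi: "h $ i = (\<Sum>j\<in>UNIV. h $ i $ j *s axis j 1)"
      by (rule basis_expansion[symmetric])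
    have "det (\<chi> k. if k = i then h $ i else v $ k)
        = det (\<chi> k. if k = i then (\<Sum>j\<in>UNIV. h $ i $ j *s axis j 1) else v $ k)"
      by (simp only: hi[symmetric])
    also have "\<dots> = (\<Sum>j\<in>UNIV. det (\<chi> k. if k = i then h $ i $ j *s axis j 1 else v $ k))"
      by (rule det_linear_row_sum[where a = "\<lambda>_ j. h $ i $ j *s axis j 1"]) simp
    also have "\<dots> = (\<Sum>j\<in>UNIV. h $ i $ j * cofactor_matrix v $ i $ j)"
      by (simp add: det_row_mul cofactor_matrix_def)
    finally show ?thesis by (simp add: mult.commute)
  qed
  then show ?thesis by (simp add: inner_vec_def)
qed

text \<open>The infinitesimal Liouville formula. Row i of \<open>A ** v\<close> is a combination of
  the rows of v; put in place of row i, only its own multiple \<open>A $ i $ i\<close> of that row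
  contributes, since the other terms repeat a row.\<close>

lemma cofactor_matrix_inner_mult:
  fixes A v :: "real^'n^'n"
  shows "cofactor_matrix v \<bullet> (A ** v) = trace A * det v"
proof -
  have "det (\<chi> k. if k = i then (A ** v) $ i else v $ k) = A $ i $ i * det v" for i
  proof -
    have row: "row k v = v $ k" for k by (simp add: row_def)
    have "(A ** v) $ i = (\<Sum>k\<in>UNIV. A $ i $ k *s row k v)"
      by (simp add: vec_eq_iff matrix_matrix_mult_def row sum_component)
    then show ?thesis
      using cramer_lemma_transpose[of i "A $ i" v] by (simp add: row cong: if_cong)
  qed
  then show ?thesis
    by (simp add: cofactor_matrix_inner trace_def sum_distrib_right)
qed

text \<open>The Leibniz formula reduces estimates for \<open>det\<close> and its derivative to
  \<open>prod_trapezoid\<close>, one permutation at a time.\<close>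

lemma cofactor_matrix_inner_permutations:
  fixes v h :: "real^'n^'n"
  shows "cofactor_matrix v \<bullet> h
    = (\<Sum>p | p permutes UNIV. of_int (sign p) * prod_deriv UNIV (\<lambda>i. v $ i $ p i) (\<lambda>i. h $ i $ p i))"
proof -
  have "(\<Prod>k\<in>UNIV. (\<chi> k. if k = i then h $ i else v $ k) $ k $ p k) = h $ i $ p i * (\<Prod>k\<in>UNIV - {i}. v $ k $ p k)"
    for i p
    by (subst prod.remove[of UNIV i]) (auto intro!: prod.cong)
  then have "cofactor_matrix v \<bullet> h = (\<Sum>i\<in>UNIV. \<Sum>p | p permutes UNIV.
      of_int (sign p) * (h $ i $ p i * (\<Prod>k\<in>UNIV - {i}. v $ k $ p k)))"
    unfolding cofactor_matrix_inner det_def by simp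
  also have "\<dots> = (\<Sum>p | p permutes UNIV. \<Sum>i\<in>UNIV.
      of_int (sign p) * (h $ i $ p i * (\<Prod>k\<in>UNIV - {i}. v $ k $ p k)))"
    by (rule sum.swap)
  finally show ?thesis by (simp add: prod_deriv_def sum_distrib_left)
qed

lemma det_entrywise_estimates:
  assumes "0 \<le> R"
  shows "\<exists>C\<ge>0. \<forall>(v::real^'n^'n) w d. 0 \<le> d \<longrightarrow>
    (\<forall>i j. \<bar>v $ i $ j\<bar> \<le> R \<and> \<bar>w $ i $ j\<bar> \<le> R \<and> \<bar>w $ i $ j - v $ i $ j\<bar> \<le> d) \<longrightarrow>
    \<bar>det w - det v\<bar> \<le> C * d \<and>
    \<bar>det w - det v - (cofactor_matrix v \<bullet> (w - v) + cofactor_matrix w \<bullet> (w - v)) / 2\<bar> \<le> C * d ^ 3"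
proof -
  from prod_trapezoid[OF finite[of "UNIV :: 'n set"] assms]
  obtain C where "0 \<le> C \<and> (\<forall>(a::'n \<Rightarrow> real) b h d. 0 \<le> d \<longrightarrow>
      (\<forall>i\<in>UNIV. \<bar>a i\<bar> \<le> R \<and> \<bar>b i\<bar> \<le> R \<and> b i = a i + h i \<and> \<bar>h i\<bar> \<le> d) \<longrightarrow>
     \<bar>prod a UNIV\<bar> \<le> C \<and> \<bar>prod b UNIV\<bar> \<le> C \<and> \<bar>prod_deriv UNIV b h\<bar> \<le> C * d \<and>
     \<bar>prod b UNIV - prod a UNIV\<bar> \<le> C * d \<and>
     \<bar>prod_deriv UNIV b h - prod_deriv UNIV a h\<bar> \<le> C * d\<^sup>2 \<and>
     \<bar>prod b UNIV - prod a UNIV - (prod_deriv UNIV a h + prod_deriv UNIV b h) / 2\<bar> \<le> C * d ^ 3)"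
    by (rule exE)
  note C = conjunct1[OF this] and est = conjunct2[OF this, rule_format]
  let ?P = "{p. p permutes (UNIV :: 'n set)}"
  define N where "N = real (card ?P)"
  show ?thesis
  proof (intro exI[of _ "N * C"] conjI allI impI)
    show "0 \<le> N * C" using C by (simp add: N_def)
    fix v w :: "real^'n^'n" and d :: real
    assume d: "0 \<le> d" and vw: "\<forall>i j. \<bar>v $ i $ j\<bar> \<le> R \<and> \<bar>w $ i $ j\<bar> \<le> R \<and> \<bar>w $ i $ j - v $ i $ j\<bar> \<le> d"
    define h where "h = w - v"
    have e: "\<bar>(\<Prod>i\<in>UNIV. w $ i $ p i) - (\<Prod>i\<in>UNIV. v $ i $ p i)\<bar> \<le> C * d"
      "\<bar>(\<Prod>i\<in>UNIV. w $ i $ p i) - (\<Prod>i\<in>UNIV. v $ i $ p i)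
        - (prod_deriv UNIV (\<lambda>i. v $ i $ p i) (\<lambda>i. h $ i $ p i)
           + prod_deriv UNIV (\<lambda>i. w $ i $ p i) (\<lambda>i. h $ i $ p i)) / 2\<bar> \<le> C * d ^ 3" for p
      using est[OF d, of "\<lambda>i. v $ i $ p i" "\<lambda>i. w $ i $ p i" "\<lambda>i. h $ i $ p i"] vw
      by (simp_all add: h_def)
    have sg: "\<bar>of_int (sign p) * x\<bar> = \<bar>x\<bar>" for p :: "'n \<Rightarrow> 'n" and x :: real
      by (simp add: abs_mult sign_def)
    have "\<bar>det w - det v\<bar> = \<bar>\<Sum>p\<in>?P. of_int (sign p) * ((\<Prod>i\<in>UNIV. w $ i $ p i) - (\<Prod>i\<in>UNIV. v $ i $ p i))\<bar>"
      by (simp add: det_def sum_subtractf[symmetric] algebra_simps)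
    also have "\<dots> \<le> (\<Sum>p\<in>?P. C * d)"
      by (intro order_trans[OF sum_abs] sum_mono) (simp only: sg e)
    finally show "\<bar>det w - det v\<bar> \<le> N * C * d" by (simp add: N_def)
    have "\<bar>det w - det v - (cofactor_matrix v \<bullet> (w - v) + cofactor_matrix w \<bullet> (w - v)) / 2\<bar>
      = \<bar>\<Sum>p\<in>?P. of_int (sign p) * ((\<Prod>i\<in>UNIV. w $ i $ p i) - (\<Prod>i\<in>UNIV. v $ i $ p i)
        - (prod_deriv UNIV (\<lambda>i. v $ i $ p i) (\<lambda>i. h $ i $ p i)
           + prod_deriv UNIV (\<lambda>i. w $ i $ p i) (\<lambda>i. h $ i $ p i)) / 2)\<bar>"
      unfolding h_def[symmetric] det_def cofactor_matrix_inner_permutations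
      by (simp add: sum_subtractf[symmetric] sum.distrib[symmetric] sum_divide_distrib
          right_diff_distrib distrib_left)
    also have "\<dots> \<le> (\<Sum>p\<in>?P. C * d ^ 3)"
      by (intro order_trans[OF sum_abs] sum_mono) (simp only: sg e)
    finally show "\<bar>det w - det v - (cofactor_matrix v \<bullet> (w - v) + cofactor_matrix w \<bullet> (w - v)) / 2\<bar> \<le> N * C * d ^ 3"
      by (simp add: N_def)
  qed
qed

lemma entry_le_norm: "\<bar>(v::real^'n^'m) $ i $ j\<bar> \<le> norm v"
  using component_le_norm_cart[of "v $ i" j] Finite_Cartesian_Product.norm_nth_le[of v i] by linarith

lemma det_trapezoid:
  obtains C where "0 \<le> C"
    "\<And>v w :: real^'n^'n. norm v \<le> R \<Longrightarrow> norm w \<le> R \<Longrightarrow> \<bar>det w - det v - ((1/2) *\<^sub>R (cofactor_matrix v + cofactor_matrix w)) \<bullet> (w - v)\<bar> \<le> C * norm (w - v) ^ 3"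
proof -
  obtain C where C: "C \<ge> 0" and est: "\<And>(v::real^'n^'n) w d. 0 \<le> d \<Longrightarrow>
    (\<forall>i j. \<bar>v $ i $ j\<bar> \<le> \<bar>R\<bar> \<and> \<bar>w $ i $ j\<bar> \<le> \<bar>R\<bar> \<and> \<bar>w $ i $ j - v $ i $ j\<bar> \<le> d) \<Longrightarrow>
    \<bar>det w - det v - (cofactor_matrix v \<bullet> (w - v) + cofactor_matrix w \<bullet> (w - v)) / 2\<bar> \<le> C * d ^ 3"
    using det_entrywise_estimates[of "\<bar>R\<bar>", where 'n = 'n] by auto
  show thesis
  proof (rule that[OF C])
    fix v w :: "real^'n^'n" assume vw: "norm v \<le> R" "norm w \<le> R"
    have "\<bar>v $ i $ j\<bar> \<le> \<bar>R\<bar> \<and> \<bar>w $ i $ j\<bar> \<le> \<bar>R\<bar> \<and> \<bar>w $ i $ j - v $ i $ j\<bar> \<le> norm (w - v)" for i j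
      using entry_le_norm[of v i j] entry_le_norm[of w i j] entry_le_norm[of "w - v" i j] vw by auto
    then show "\<bar>det w - det v - ((1/2) *\<^sub>R (cofactor_matrix v + cofactor_matrix w)) \<bullet> (w - v)\<bar> \<le> C * norm (w - v) ^ 3"
      using est[of "norm (w - v)" v w] by (simp add: inner_add_left add_divide_distrib)
  qed
qed

lemma cofactor_matrix_lipschitz:
  obtains C where "0 \<le> C"
    "\<And>v w :: real^'n^'n. norm v \<le> R \<Longrightarrow> norm w \<le> R \<Longrightarrow> norm (cofactor_matrix w - cofactor_matrix v) \<le> C * norm (w - v)"
proof -
  \<comment> \<open>The entries of a cofactor are determinants in which one row is a unit vector, so
    the entry bound must be at least 1.\<close>
  let ?R = "max \<bar>R\<bar> 1"
  obtain C where C: "C \<ge> 0" and est: "\<And>(v::real^'n^'n) w d. 0 \<le> d \<Longrightarrow>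
    (\<forall>i j. \<bar>v $ i $ j\<bar> \<le> ?R \<and> \<bar>w $ i $ j\<bar> \<le> ?R \<and> \<bar>w $ i $ j - v $ i $ j\<bar> \<le> d) \<Longrightarrow> \<bar>det w - det v\<bar> \<le> C * d"
    using det_entrywise_estimates[of ?R, where 'n = 'n, OF order_trans[OF zero_le_one max.cobounded2]] by blast
  define N where "N = real CARD('n)"
  show thesis
  proof (rule that[of "N * (N * C)"])
    show "0 \<le> N * (N * C)" using C by (simp add: N_def)
    fix v w :: "real^'n^'n" assume vw: "norm v \<le> R" "norm w \<le> R"
    have "\<bar>(cofactor_matrix w - cofactor_matrix v) $ i $ j\<bar> \<le> C * norm (w - v)" for i j
    proof -
      have "\<bar>v $ a $ b\<bar> \<le> \<bar>R\<bar>" "\<bar>w $ a $ b\<bar> \<le> \<bar>R\<bar>" "\<bar>w $ a $ b - v $ a $ b\<bar> \<le> norm (w - v)" for a b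
        using entry_le_norm[of v a b] entry_le_norm[of w a b] entry_le_norm[of "w - v" a b] vw by auto
      then show ?thesis
        unfolding cofactor_matrix_def vector_minus_component vec_lambda_beta
        by (intro est) (auto simp: axis_def le_max_iff_disj)
    qed
    then have "norm ((cofactor_matrix w - cofactor_matrix v) $ i) \<le> N * (C * norm (w - v))" for i
      using norm_le_l1_cart[of "(cofactor_matrix w - cofactor_matrix v) $ i"]
        sum_bounded_above[of "UNIV :: 'n set" "\<lambda>j. \<bar>(cofactor_matrix w - cofactor_matrix v) $ i $ j\<bar>" "C * norm (w - v)"]
      unfolding N_def by force
    then have "(\<Sum>i\<in>UNIV. norm ((cofactor_matrix w - cofactor_matrix v) $ i)) \<le> N * (N * (C * norm (w - v)))"
      using sum_bounded_above[of "UNIV :: 'n set" "\<lambda>i. norm ((cofactor_matrix w - cofactor_matrix v) $ i)"]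
      unfolding N_def by force
    moreover have "norm (cofactor_matrix w - cofactor_matrix v) \<le> (\<Sum>i\<in>UNIV. norm ((cofactor_matrix w - cofactor_matrix v) $ i))"
      unfolding norm_vec_def by (rule L2_set_le_sum) simp
    ultimately show "norm (cofactor_matrix w - cofactor_matrix v) \<le> N * (N * C) * norm (w - v)"
      by (simp add: mult.assoc)
  qed
qed

lemma locally_lipschitz_imp_continuous:
  fixes f :: "'a::real_normed_vector \<Rightarrow> 'b::real_normed_vector"
  assumes "\<And>R. \<exists>C\<ge>0. \<forall>v w :: 'a. norm v \<le> R \<longrightarrow> norm w \<le> R \<longrightarrow> norm (f w - f v) \<le> C * norm (w - v)"
  shows "continuous_on UNIV f"
  unfolding continuous_on_eq_continuous_at[OF open_UNIV]
proof
  fix x :: 'a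
  obtain C where C: "C \<ge> 0" "\<And>v w. norm v \<le> norm x + 1 \<Longrightarrow> norm w \<le> norm x + 1 \<Longrightarrow> norm (f w - f v) \<le> C * norm (w - v)"
    using assms[of "norm x + 1"] by blast
  have "\<forall>\<^sub>F y in at x. norm (f y - f x) \<le> C * norm (y - x)"
    unfolding eventually_at
  proof (intro exI[of _ 1] conjI ballI impI)
    fix y assume "y \<noteq> x \<and> dist y x < 1"
    then have "norm y \<le> norm x + 1"
      using norm_triangle_sub[of y x] by (simp add: dist_norm)
    then show "norm (f y - f x) \<le> C * norm (y - x)"
      using C(2)[of x y] by simp
  qed simp
  moreover have "((\<lambda>y. C * norm (y - x)) \<longlongrightarrow> 0) (at x)"
    by (auto intro!: tendsto_eq_intros)
  ultimately have "((\<lambda>y. f y - f x) \<longlongrightarrow> 0) (at x)"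
    by (rule Lim_null_comparison)
  then show "isCont f x"
    by (simp add: isCont_def LIM_zero_iff)
qed

section \<open>Liouville's formula\<close>

lemma borel_measurable_vec_nth2: "(\<lambda>x::real^'n^'m. x $ i $ j) \<in> borel_measurable borel"
  by (intro borel_measurable_continuous_onI continuous_intros)

text \<open>Convergence in probability passes to entries because an entry is bounded by the norm.
  This connects the matrix integrals with the scalar theorem
  \<open>stratonovich_associative\<close>.\<close>

lemma has_stratonovich_integral_component:
  fixes Y :: "real \<Rightarrow> 'w \<Rightarrow> real^'n^'m"
  assumes "finite_measure M" and I: "has_stratonovich_integral M Y B t I"
  shows "has_stratonovich_integral M (\<lambda>s w. Y s w $ a $ b) B t (\<lambda>w. I w $ a $ b)"
  unfolding has_stratonovich_integral_def
proof (intro conjI ballI allI impI)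
  interpret finite_measure M by fact
  have Y [measurable]: "\<And>s. s \<in> {0..t} \<Longrightarrow> Y s \<in> borel_measurable M"
    and B [measurable]: "\<And>s. s \<in> {0..t} \<Longrightarrow> B s \<in> borel_measurable M"
    and IM [measurable]: "I \<in> borel_measurable M"
    using I by (auto simp: has_stratonovich_integral_def)
  show "(\<lambda>w. Y s w $ a $ b) \<in> borel_measurable M" if "s \<in> {0..t}" for s
    using measurable_compose[OF Y[OF that] borel_measurable_vec_nth2] .
  show "B s \<in> borel_measurable M" if "s \<in> {0..t}" for s using B that .
  show "(\<lambda>w. I w $ a $ b) \<in> borel_measurable M"
    using measurable_compose[OF IM borel_measurable_vec_nth2] .
  fix \<epsilon> \<eta> :: real assume "\<epsilon> > 0" "\<eta> > 0"
  define Z where "Z n p w = trapezoid_sum Y B n p w - I w" for n p w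
  obtain \<rho> where \<rho>: "\<rho> > 0" "\<And>n p. is_partition t n p \<Longrightarrow> \<forall>i<n. p (Suc i) - p i < \<rho> \<Longrightarrow>
      measure M {w \<in> space M. \<epsilon> < norm (Z n p w)} < \<eta>"
    unfolding Z_def using has_stratonovich_integralE[OF I \<open>\<epsilon> > 0\<close> \<open>\<eta> > 0\<close>] by blast
  show "\<exists>\<rho>>0. \<forall>n p. is_partition t n p \<and> (\<forall>i<n. p (Suc i) - p i < \<rho>) \<longrightarrow>
      measure M {w \<in> space M. \<epsilon> < norm ((\<Sum>i<n. (B (p (Suc i)) w - B (p i) w) *\<^sub>R
        ((1/2) *\<^sub>R (Y (p i) w $ a $ b + Y (p (Suc i)) w $ a $ b))) - I w $ a $ b)} < \<eta>"
  proof (intro exI[of _ \<rho>] conjI allI impI \<rho>(1))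
    fix n p assume p: "is_partition t n p \<and> (\<forall>i<n. p (Suc i) - p i < \<rho>)"
    then have part: "is_partition t n p" by blast
    have mono: "i \<le> j \<Longrightarrow> j \<le> n \<Longrightarrow> p i \<le> p j" for i j
    proof (induction j rule: dec_induct)
      case (step j)
      then have "p j < p (Suc j)" using part by (simp add: is_partition_def)
      moreover have "p i \<le> p j" using step by simp
      ultimately show ?case by linarith
    qed simp
    have pin: "p i \<in> {0..t}" if "i \<le> n" for i
      using mono[of 0 i] mono[of i n] that part by (auto simp: is_partition_def)
    have [measurable]: "Y (p i) \<in> borel_measurable M" "B (p i) \<in> borel_measurable M" if "i \<le> n" for i
      using Y B pin[OF that] by auto
    have Zm: "Z n p \<in> borel_measurable M"
      unfolding Z_def trapezoid_sum_def
      by (intro borel_measurable_diff borel_measurable_sum borel_measurable_scaleR borel_measurable_add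
          borel_measurable_const IM Y B pin) auto
    have eq: "(\<Sum>i<n. (B (p (Suc i)) w - B (p i) w) *\<^sub>R
        ((1/2) *\<^sub>R (Y (p i) w $ a $ b + Y (p (Suc i)) w $ a $ b))) - I w $ a $ b = Z n p w $ a $ b" for w
      by (simp add: Z_def trapezoid_sum_def sum_component)
    have "measure M {w \<in> space M. \<epsilon> < norm (Z n p w $ a $ b)} \<le> measure M {w \<in> space M. \<epsilon> < norm (Z n p w)}"
    proof (rule finite_measure_mono)
      show "{w \<in> space M. \<epsilon> < norm (Z n p w $ a $ b)} \<subseteq> {w \<in> space M. \<epsilon> < norm (Z n p w)}"
        using entry_le_norm by (auto intro: less_le_trans)
      show "{w \<in> space M. \<epsilon> < norm (Z n p w)} \<in> sets M" using Zm by measurable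
    qed
    also have "\<dots> < \<eta>" using \<rho>(2) p by blast
    finally show "measure M {w \<in> space M. \<epsilon> < norm ((\<Sum>i<n. (B (p (Suc i)) w - B (p i) w) *\<^sub>R
        ((1/2) *\<^sub>R (Y (p i) w $ a $ b + Y (p (Suc i)) w $ a $ b))) - I w $ a $ b)} < \<eta>"
      unfolding eq .
  qed
qed

context prob_space
begin

text \<open>The interval [0,0] has the partition without cells: its sum is 0 and the mesh condition
  is vacuous, so \<open>I\<close> itself is within every \<epsilon> of 0 with high
  probability.\<close>

lemma stratonovich_integral_0:
  assumes I: "has_stratonovich_integral M Y B 0 I"
  shows "AE w in M. I w = 0"
proof -
  have [measurable]: "I \<in> borel_measurable M" using I by (simp add: has_stratonovich_integral_def)
  have "conv0 M (\<lambda>n w. norm (I w))"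
    unfolding conv0_def
  proof (intro allI impI always_eventually)
    fix \<epsilon> \<eta> :: real and n :: nat assume pos: "\<epsilon> > 0" "\<eta> > 0"
    obtain \<rho> where \<rho>: "\<And>n p. is_partition 0 n p \<Longrightarrow> \<forall>i<n. p (Suc i) - p i < \<rho> \<Longrightarrow>
        prob {w \<in> space M. \<epsilon> < norm (trapezoid_sum Y B n p w - I w)} < \<eta>"
      using has_stratonovich_integralE[OF I pos] by blast
    from \<rho>[of 0 "\<lambda>_. 0"] have "prob {w \<in> space M. \<epsilon> < norm (I w)} < \<eta>"
      by (simp add: is_partition_def trapezoid_sum_def)
    then show "whp M \<eta> (\<lambda>w. \<bar>norm (I w)\<bar> \<le> \<epsilon>)"
      unfolding whp_def by (intro bexI[of _ "{w \<in> space M. \<epsilon> < norm (I w)}"]) auto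
  qed
  from conv0_const_imp_AE_zero[OF this] show ?thesis by simp
qed

text \<open>Common scheme for the cubic, triple-product and drift errors: each is at most the
  oscillation of a continuous process at mesh scale times a quantity bounded in probability. The
  constant may depend on R, since paths stay in a fixed ball with high probability.\<close>

lemma conv0_oscillation:
  fixes X :: "real \<Rightarrow> 'a \<Rightarrow> 'b::euclidean_space"
  assumes meas: "\<And>s. s \<in> {0..t} \<Longrightarrow> X s \<in> borel_measurable M"
    and cont: "continuous_paths M X" and B: "stoch_bounded M B"
    and bnd: "\<And>R. R > 0 \<Longrightarrow> \<exists>C\<ge>0. \<forall>n. AE w in M. \<forall>c\<ge>0. (\<forall>s\<in>{0..t}. norm (X s w) \<le> R) \<longrightarrow>
      (\<forall>s\<in>{0..t}. \<forall>u\<in>{0..t}. \<bar>s - u\<bar> \<le> t / 2^n \<longrightarrow> norm (X s w - X u w) \<le> c) \<longrightarrow> \<bar>E n w\<bar> \<le> C * c * \<bar>B n w\<bar>"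
  shows "conv0 M E"
  unfolding conv0_def
proof (intro allI impI)
  fix \<epsilon> \<eta> :: real assume pos: "\<epsilon> > 0" "\<eta> > 0"
  then have \<eta>: "\<eta>/3 > 0" by simp
  obtain R where R: "R > 0" "whp M (\<eta>/3) (\<lambda>w. \<forall>s\<in>{0..t}. norm (X s w) \<le> R)"
    using whp_paths_bounded[OF meas cont \<eta>] by blast
  obtain K where K: "K > 0" "\<And>n. whp M (\<eta>/3) (\<lambda>w. \<bar>B n w\<bar> \<le> K)"
    using stoch_boundedE[OF B \<eta>] by blast
  obtain C where C: "C \<ge> 0" and CE: "\<And>n. AE w in M. \<forall>c\<ge>0. (\<forall>s\<in>{0..t}. norm (X s w) \<le> R) \<longrightarrow>
      (\<forall>s\<in>{0..t}. \<forall>u\<in>{0..t}. \<bar>s - u\<bar> \<le> t / 2^n \<longrightarrow> norm (X s w - X u w) \<le> c) \<longrightarrow> \<bar>E n w\<bar> \<le> C * c * \<bar>B n w\<bar>"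
    using bnd[OF R(1)] by blast
  \<comment> \<open>The added 1 keeps the denominator positive when C = 0.\<close>
  define c where "c = \<epsilon> / (C * K + 1)"
  have CK: "C * K + 1 > 0" using C K by (simp add: add_nonneg_pos)
  then have c: "c > 0" using pos by (simp add: c_def)
  have "C * c * K = \<epsilon> * (C * K / (C * K + 1))" by (simp add: c_def)
  also have "\<dots> \<le> \<epsilon> * 1"
    using pos C K CK by (intro mult_left_mono) (auto simp: divide_le_eq)
  finally have cK: "C * c * K \<le> \<epsilon>" by simp
  obtain \<delta> where \<delta>: "\<delta> > 0"
    "whp M (\<eta>/3) (\<lambda>w. \<forall>s\<in>{0..t}. \<forall>u\<in>{0..t}. \<bar>s - u\<bar> < \<delta> \<longrightarrow> norm (X s w - X u w) \<le> c)"
    using whp_paths_modulus[OF meas cont c \<eta>] by blast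
  have "\<forall>\<^sub>F n in sequentially. t / 2 ^ n < \<delta>" by (rule eventually_dyad_mesh[OF \<delta>(1)])
  then show "\<forall>\<^sub>F n in sequentially. whp M \<eta> (\<lambda>w. \<bar>E n w\<bar> \<le> \<epsilon>)"
  proof eventually_elim
    case (elim n)
    have "whp M \<eta> (\<lambda>w. (\<forall>s\<in>{0..t}. norm (X s w) \<le> R) \<and> \<bar>B n w\<bar> \<le> K \<and>
        (\<forall>s\<in>{0..t}. \<forall>u\<in>{0..t}. \<bar>s - u\<bar> < \<delta> \<longrightarrow> norm (X s w - X u w) \<le> c))"
      by (intro whp_conj[OF R(2) whp_conj[OF K(2) \<delta>(2) order_refl]]) simp
    then show ?case
    proof (rule whp_AE_mp)
      show "AE w in M. (\<forall>s\<in>{0..t}. norm (X s w) \<le> R) \<and> \<bar>B n w\<bar> \<le> K \<and>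
        (\<forall>s\<in>{0..t}. \<forall>u\<in>{0..t}. \<bar>s - u\<bar> < \<delta> \<longrightarrow> norm (X s w - X u w) \<le> c) \<longrightarrow> \<bar>E n w\<bar> \<le> \<epsilon>"
        using CE[of n]
      proof eventually_elim
        case inner: (elim w)
        show ?case
        proof (intro impI, elim conjE)
          assume h: "\<forall>s\<in>{0..t}. norm (X s w) \<le> R" "\<bar>B n w\<bar> \<le> K"
            "\<forall>s\<in>{0..t}. \<forall>u\<in>{0..t}. \<bar>s - u\<bar> < \<delta> \<longrightarrow> norm (X s w - X u w) \<le> c"
          have "\<forall>s\<in>{0..t}. \<forall>u\<in>{0..t}. \<bar>s - u\<bar> \<le> t / 2^n \<longrightarrow> norm (X s w - X u w) \<le> c"
            using h(3) elim by (meson le_less_trans)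
          then have "\<bar>E n w\<bar> \<le> C * c * \<bar>B n w\<bar>" using inner h(1) c by (meson less_imp_le)
          also have "\<dots> \<le> C * c * K" using h(2) C c by (intro mult_left_mono) auto
          finally show "\<bar>E n w\<bar> \<le> \<epsilon>" using cK by linarith
        qed
      qed
    qed
  qed
qed

lemma incr_osc:
  assumes "0 \<le> t" "i < 2 ^ n"
    and "\<forall>s\<in>{0..t}. \<forall>u\<in>{0..t}. \<bar>s - u\<bar> \<le> t / 2^n \<longrightarrow> norm (X s w - X u w) \<le> c"
  shows "norm (incr t X n i w) \<le> c"
proof -
  have "dyad t n (Suc i) \<in> {0..t}" "dyad t n i \<in> {0..t}"
    using assms by (intro dyad_in; simp)+
  moreover have "\<bar>dyad t n (Suc i) - dyad t n i\<bar> \<le> t / 2 ^ n"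
    unfolding dyad_Suc_diff using assms(1) by simp
  ultimately show ?thesis unfolding incr_def using assms(3) by blast
qed

text \<open>The largest increment of \<open>Z\<close> tends to 0, while the sum of the absolute
  products of the other two is at most the mean of their quadratic sums.\<close>

lemma conv0_triple_increments:
  fixes X Y Z :: "real \<Rightarrow> 'a \<Rightarrow> real"
  assumes t: "0 \<le> t" and X: "stoch_bounded M (dyad_qv t X)" and Y: "stoch_bounded M (dyad_qv t Y)"
    and Z: "\<And>s. s \<in> {0..t} \<Longrightarrow> Z s \<in> borel_measurable M" "continuous_paths M Z"
  shows "conv0 M (\<lambda>n w. \<Sum>i<2^n. incr t X n i w * incr t Y n i w * incr t Z n i w)"
    (is "conv0 M ?E")
proof (rule conv0_oscillation[OF Z stoch_bounded_add[OF X Y]])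
  fix R :: real
  show "\<exists>C\<ge>0. \<forall>n. AE w in M. \<forall>c\<ge>0. (\<forall>s\<in>{0..t}. norm (Z s w) \<le> R) \<longrightarrow>
      (\<forall>s\<in>{0..t}. \<forall>u\<in>{0..t}. \<bar>s - u\<bar> \<le> t / 2^n \<longrightarrow> norm (Z s w - Z u w) \<le> c) \<longrightarrow>
      \<bar>?E n w\<bar>
        \<le> C * c * \<bar>dyad_qv t X n w + dyad_qv t Y n w\<bar>"
  proof (rule exI[of _ 1], intro conjI allI impI AE_I2)
    fix n w and c :: real
    assume c: "0 \<le> c" and osc: "\<forall>s\<in>{0..t}. \<forall>u\<in>{0..t}. \<bar>s - u\<bar> \<le> t / 2^n \<longrightarrow> norm (Z s w - Z u w) \<le> c"
    have "\<bar>?E n w\<bar>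
        \<le> (\<Sum>i<2^n. \<bar>incr t X n i w * incr t Y n i w\<bar> * c)"
    proof (intro order_trans[OF sum_abs] sum_mono)
      fix i assume "i \<in> {..<2^n::nat}"
      then have "\<bar>incr t Z n i w\<bar> \<le> c" using incr_osc[where X = Z, OF t _ osc] by simp
      then show "\<bar>incr t X n i w * incr t Y n i w * incr t Z n i w\<bar>
          \<le> \<bar>incr t X n i w * incr t Y n i w\<bar> * c"
        unfolding abs_mult[of "_ * _"] by (rule mult_left_mono) simp
    qed
    also have "\<dots> = c * (\<Sum>i<2^n. \<bar>incr t X n i w * incr t Y n i w\<bar>)"
      by (simp add: sum_distrib_left mult.commute)
    also have "\<dots> \<le> c * ((dyad_qv t X n w + dyad_qv t Y n w) / 2)"
      by (intro mult_left_mono sum_abs_mult_le_qv c)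
    also have "\<dots> \<le> c * \<bar>dyad_qv t X n w + dyad_qv t Y n w\<bar>"
    proof (intro mult_left_mono c)
      have "z / 2 \<le> \<bar>z\<bar>" for z :: real by linarith
      then show "(dyad_qv t X n w + dyad_qv t Y n w) / 2 \<le> \<bar>dyad_qv t X n w + dyad_qv t Y n w\<bar>" .
    qed
    finally show "\<bar>?E n w\<bar>
        \<le> 1 * c * \<bar>dyad_qv t X n w + dyad_qv t Y n w\<bar>" by simp
  qed simp
qed

text \<open>A local Lipschitz condition suffices because the path stays in a ball with high
  probability. No second derivatives of \<phi> are involved, so the result covers processes
  \<open>\<phi> (X s w)\<close> that are not semimartingales.\<close>

lemma lipschitz_qv_bounded:
  fixes X :: "real \<Rightarrow> 'a \<Rightarrow> 'b::euclidean_space" and \<phi> :: "'b \<Rightarrow> 'c::real_normed_vector"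
  assumes t: "0 \<le> t" and meas: "\<And>s. s \<in> {0..t} \<Longrightarrow> X s \<in> borel_measurable M"
    and cont: "continuous_paths M X" and qv: "stoch_bounded M (dyad_qv t X)"
    and lip: "\<And>R. \<exists>C\<ge>0. \<forall>v w. norm v \<le> R \<longrightarrow> norm w \<le> R \<longrightarrow> norm (\<phi> w - \<phi> v) \<le> C * norm (w - v)"
  shows "stoch_bounded M (dyad_qv t (\<lambda>s w. \<phi> (X s w)))"
  unfolding stoch_bounded_def
proof (intro allI impI)
  fix \<eta> :: real assume "\<eta> > 0"
  then have \<eta>: "\<eta>/2 > 0" by simp
  obtain R where R: "whp M (\<eta>/2) (\<lambda>w. \<forall>s\<in>{0..t}. norm (X s w) \<le> R)"
    using whp_paths_bounded[OF meas cont \<eta>] by blast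
  obtain K where K: "\<And>n. whp M (\<eta>/2) (\<lambda>w. \<bar>dyad_qv t X n w\<bar> \<le> K)"
    using stoch_boundedE[OF qv \<eta>] by blast
  obtain C where C: "C \<ge> 0" "\<And>v w. norm v \<le> R \<Longrightarrow> norm w \<le> R \<Longrightarrow> norm (\<phi> w - \<phi> v) \<le> C * norm (w - v)"
    using lip[of R] by blast
  have "whp M \<eta> (\<lambda>w. \<bar>dyad_qv t (\<lambda>s w. \<phi> (X s w)) n w\<bar> \<le> C\<^sup>2 * K)" for n
  proof (rule whp_mono[OF whp_conj[OF R K[of n] order_refl]])
    fix w assume h: "(\<forall>s\<in>{0..t}. norm (X s w) \<le> R) \<and> \<bar>dyad_qv t X n w\<bar> \<le> K"
    have "dyad_qv t (\<lambda>s w. \<phi> (X s w)) n w \<le> (\<Sum>i<2^n. C\<^sup>2 * (norm (incr t X n i w))\<^sup>2)"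
      unfolding dyad_qv_def
    proof (rule sum_mono)
      fix i assume "i \<in> {..<2^n::nat}"
      then have "dyad t n i \<in> {0..t}" "dyad t n (Suc i) \<in> {0..t}"
        using t by (intro dyad_in; simp)+
      then have "norm (incr t (\<lambda>s w. \<phi> (X s w)) n i w) \<le> C * norm (incr t X n i w)"
        unfolding incr_def using h by (intro C(2)) auto
      then show "(norm (incr t (\<lambda>s w. \<phi> (X s w)) n i w))\<^sup>2 \<le> C\<^sup>2 * (norm (incr t X n i w))\<^sup>2"
        unfolding power_mult_distrib[symmetric] by (rule power_mono) simp
    qed
    also have "\<dots> = C\<^sup>2 * dyad_qv t X n w" by (simp add: dyad_qv_def sum_distrib_left)
    also have "\<dots> \<le> C\<^sup>2 * K" using h by (intro mult_left_mono) auto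
    finally show "\<bar>dyad_qv t (\<lambda>s w. \<phi> (X s w)) n w\<bar> \<le> C\<^sup>2 * K"
      by (simp add: dyad_qv_def sum_nonneg)
  qed simp
  then show "\<exists>K. \<forall>n. whp M \<eta> (\<lambda>w. \<bar>dyad_qv t (\<lambda>s w. \<phi> (X s w)) n w\<bar> \<le> K)" by blast
qed

end

text \<open>As \<open>D\<close> is only continuous, the differentiable function 1 + c H is used in
  its place, with H the indefinite integral of \<open>D\<close>; multiplied by exp (- c s) it has
  derivative 0.\<close>

lemma linear_integral_equation_exp:
  fixes D :: "real \<Rightarrow> real"
  assumes cont: "continuous_on {0..} D" and eq: "\<And>t. 0 \<le> t \<Longrightarrow> D t = 1 + c * integral {0..t} D"
    and t: "0 \<le> t"
  shows "D t = exp (c * t)"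
proof -
  define H where "H s = integral {0..s} D" for s
  have contT: "continuous_on {0..t} D" using cont by (rule continuous_on_subset) auto
  have "((\<lambda>s. exp (- c * s) * (1 + c * H s)) has_field_derivative 0) (at s within {0..t})" if s: "s \<in> {0..t}" for s
  proof -
    have "(H has_real_derivative D s) (at s within {0..t})"
      unfolding H_def by (rule integral_has_real_derivative[OF contT s])
    then have "((\<lambda>s. exp (- c * s) * (1 + c * H s)) has_field_derivative
        (exp (- c * s) * (c * D s) + exp (- c * s) * (- c) * (1 + c * H s))) (at s within {0..t})"
      by (auto intro!: derivative_eq_intros)
    moreover have "1 + c * H s = D s" using eq[of s] s by (simp add: H_def)
    ultimately show ?thesis by (simp add: mult.assoc)
  qed
  then obtain k where k: "\<And>s. s \<in> {0..t} \<Longrightarrow> exp (- c * s) * (1 + c * H s) = k"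
    using has_field_derivative_zero_constant[of "{0..t}" "\<lambda>s. exp (- c * s) * (1 + c * H s)"] by auto
  have "k = 1" using k[of 0] t by (simp add: H_def)
  then have "exp (- c * t) * D t = 1"
    using k[of t] t eq[OF t] by (simp add: H_def)
  then show ?thesis by (simp add: exp_minus field_simps)
qed

section \<open>Composed processes and the Lipschitz maps applied to them\<close>

lemma adapted_compose:
  assumes "adapted F X" "continuous_on UNIV \<phi>"
  shows "adapted F (\<lambda>s w. \<phi> (X s w))"
  unfolding adapted_def
proof (intro allI impI)
  fix s :: real assume "0 \<le> s"
  then have "X s \<in> borel_measurable (F s)" using assms(1) by (simp add: adapted_def)
  from measurable_compose[OF this borel_measurable_continuous_onI[OF assms(2)]]
  show "(\<lambda>w. \<phi> (X s w)) \<in> borel_measurable (F s)" .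
qed

lemma continuous_paths_compose:
  assumes "continuous_paths M X" "continuous_on UNIV \<phi>"
  shows "continuous_paths M (\<lambda>s w. \<phi> (X s w))"
  using assms(1) unfolding continuous_paths_def
proof eventually_elim
  case (elim w)
  show ?case by (rule continuous_on_compose2[OF assms(2) elim]) simp
qed

lemma adapted_Pair:
  fixes X :: "real \<Rightarrow> 'w \<Rightarrow> 'b::euclidean_space" and X' :: "real \<Rightarrow> 'w \<Rightarrow> 'c::euclidean_space"
  assumes "adapted F X" "adapted F X'"
  shows "adapted F (\<lambda>s w. (X s w, X' s w))"
  using assms unfolding adapted_def by (simp add: borel_measurable_Pair)

lemma continuous_paths_Pair:
  assumes "continuous_paths M X" "continuous_paths M X'"
  shows "continuous_paths M (\<lambda>s w. (X s w, X' s w))"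
  using assms unfolding continuous_paths_def
  by eventually_elim (rule continuous_on_Pair)

lemma cofactor_component_lipschitz:
  "\<exists>C\<ge>0. \<forall>x y :: real^'d^'d. norm x \<le> R \<longrightarrow> norm y \<le> R \<longrightarrow>
    norm (cofactor_matrix y $ a $ b - cofactor_matrix x $ a $ b) \<le> C * norm (y - x)"
proof -
  obtain C where C: "0 \<le> C" "\<And>x y :: real^'d^'d. norm x \<le> R \<Longrightarrow> norm y \<le> R \<Longrightarrow>
      norm (cofactor_matrix y - cofactor_matrix x) \<le> C * norm (y - x)"
    using cofactor_matrix_lipschitz[of R] by blast
  have "norm (cofactor_matrix y $ a $ b - cofactor_matrix x $ a $ b) \<le> C * norm (y - x)"
    if "norm x \<le> R" "norm y \<le> R" for x y :: "real^'d^'d"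
    using entry_le_norm[of "cofactor_matrix y - cofactor_matrix x" a b] C(2)[OF that] by simp
  with C(1) show ?thesis by blast
qed

lemma mult_component_lipschitz:
  "\<exists>C\<ge>0. \<forall>x y :: (real^'d^'d) \<times> (real^'d^'d). norm x \<le> R \<longrightarrow> norm y \<le> R \<longrightarrow>
    norm ((fst y ** snd y) $ a $ b - (fst x ** snd x) $ a $ b) \<le> C * norm (y - x)"
proof (intro exI[of _ "real CARD('d) * (2 * \<bar>R\<bar>)"] conjI allI impI)
  fix x y :: "(real^'d^'d) \<times> (real^'d^'d)" assume xy: "norm x \<le> R" "norm y \<le> R"
  have "\<bar>fst y $ a $ k * snd y $ k $ b - fst x $ a $ k * snd x $ k $ b\<bar> \<le> 2 * \<bar>R\<bar> * norm (y - x)" for k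
  proof -
    have fs: "norm (fst z) \<le> norm z" "norm (snd z) \<le> norm z" for z :: "(real^'d^'d) \<times> (real^'d^'d)"
      by (metis norm_fst_le prod.collapse, metis norm_snd_le prod.collapse)
    have e: "\<bar>fst z $ i $ j\<bar> \<le> norm z" "\<bar>snd z $ i $ j\<bar> \<le> norm z" for z :: "(real^'d^'d) \<times> (real^'d^'d)" and i j
      using fs[of z] entry_le_norm[of "fst z" i j] entry_le_norm[of "snd z" i j] by linarith+
    have "\<bar>fst y $ a $ k - fst x $ a $ k\<bar> \<le> norm (y - x)" "\<bar>snd y $ k $ b - snd x $ k $ b\<bar> \<le> norm (y - x)"
      using e[of "y - x"] by simp_all
    moreover have "\<bar>snd y $ k $ b\<bar> \<le> \<bar>R\<bar>" "\<bar>fst x $ a $ k\<bar> \<le> \<bar>R\<bar>"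
      using e(2)[of y k b] e(1)[of x a k] xy by linarith+
    ultimately have "\<bar>(fst y $ a $ k - fst x $ a $ k) * snd y $ k $ b\<bar> \<le> norm (y - x) * \<bar>R\<bar>"
      "\<bar>fst x $ a $ k * (snd y $ k $ b - snd x $ k $ b)\<bar> \<le> \<bar>R\<bar> * norm (y - x)"
      unfolding abs_mult by (intro mult_mono; simp)+
    moreover have "fst y $ a $ k * snd y $ k $ b - fst x $ a $ k * snd x $ k $ b
        = (fst y $ a $ k - fst x $ a $ k) * snd y $ k $ b + fst x $ a $ k * (snd y $ k $ b - snd x $ k $ b)"
      by (simp add: algebra_simps)
    ultimately show ?thesis by (simp add: algebra_simps)
  qed
  then have "(\<Sum>k\<in>UNIV. \<bar>fst y $ a $ k * snd y $ k $ b - fst x $ a $ k * snd x $ k $ b\<bar>)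
      \<le> real CARD('d) * (2 * \<bar>R\<bar> * norm (y - x))"
    by (rule sum_bounded_above)
  then have "\<bar>\<Sum>k\<in>UNIV. fst y $ a $ k * snd y $ k $ b - fst x $ a $ k * snd x $ k $ b\<bar>
      \<le> real CARD('d) * (2 * \<bar>R\<bar> * norm (y - x))"
    by (rule order_trans[OF sum_abs])
  then show "norm ((fst y ** snd y) $ a $ b - (fst x ** snd x) $ a $ b) \<le> real CARD('d) * (2 * \<bar>R\<bar>) * norm (y - x)"
    by (simp add: matrix_matrix_mult_def sum_subtractf mult.assoc)
qed simp

lemma continuous_matrix_mult: "continuous_on UNIV (\<lambda>x :: (real^'d^'d) \<times> (real^'d^'d). fst x ** snd x)"
  unfolding matrix_matrix_mult_def by (intro continuous_intros)

lemma dyad_qv_Pair: "dyad_qv t (\<lambda>s w. (X s w, X' s w)) n w = dyad_qv t X n w + dyad_qv t X' n w"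
  by (simp add: dyad_qv_def incr_def norm_Pair sum.distrib)

lemma integral_dyad_sum:
  fixes f :: "real \<Rightarrow> 'e::banach"
  assumes "0 \<le> t" "f integrable_on {0..t}" "N \<le> 2 ^ n"
  shows "(\<Sum>i<N. integral {dyad t n i..dyad t n (Suc i)} f) = integral {0..dyad t n N} f"
  using assms(3)
proof (induction N)
  case (Suc N)
  have "f integrable_on {0..dyad t n (Suc N)}"
    using assms(2) by (rule integrable_subinterval_real) (use Suc.prems assms(1) in \<open>auto intro: dyad_le\<close>)
  then have "integral {0..dyad t n N} f + integral {dyad t n N..dyad t n (Suc N)} f = integral {0..dyad t n (Suc N)} f"
    using assms(1) by (intro Henstock_Kurzweil_Integration.integral_combine dyad_nonneg dyad_mono) auto
  then show ?case using Suc by simp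
qed simp

text \<open>Abstracts the linear equation from the flow: \<open>A0\<close> and \<open>A j\<close>
  stand for \<open>Df_0(x)\<close> and \<open>Df_j(x)\<close>. The drift matrix is merely continuous
  in time, in line with a C^1 field \<open>f_0\<close>, whereas the \<open>A j\<close> have bounded
  quadratic sums, coming from Lipschitz Jacobians.\<close>

locale stochastic_liouville = filtered_prob M F for M :: "'w measure" and F +
  fixes m :: nat and W :: "nat \<Rightarrow> real \<Rightarrow> 'w \<Rightarrow> real"
    and A0 :: "real \<Rightarrow> 'w \<Rightarrow> real^'d^'d" and A :: "nat \<Rightarrow> real \<Rightarrow> 'w \<Rightarrow> real^'d^'d"
    and v :: "real \<Rightarrow> 'w \<Rightarrow> real^'d^'d" and J :: "nat \<Rightarrow> real \<Rightarrow> 'w \<Rightarrow> real^'d^'d"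
    and c :: real
  assumes bm: "\<And>j. j \<in> {1..m} \<Longrightarrow> brownian M F (W j)"
    and v_adapted: "adapted F v" and v_cont: "continuous_paths M v"
    and v_qv: "\<And>t. 0 < t \<Longrightarrow> stoch_bounded M (dyad_qv t v)"
    and A0_adapted: "adapted F A0" and A0_cont: "continuous_paths M A0"
    and A_adapted: "\<And>j. j \<in> {1..m} \<Longrightarrow> adapted F (A j)"
    and A_cont: "\<And>j. j \<in> {1..m} \<Longrightarrow> continuous_paths M (A j)"
    and A_qv: "\<And>j t. j \<in> {1..m} \<Longrightarrow> 0 < t \<Longrightarrow> stoch_bounded M (dyad_qv t (A j))"
    and J: "\<And>j t. j \<in> {1..m} \<Longrightarrow> 0 \<le> t \<Longrightarrow>
      has_stratonovich_integral M (\<lambda>s w. A j s w ** v s w) (W j) t (J j t)"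
    and eq: "\<And>t. 0 \<le> t \<Longrightarrow> AE w in M.
      v t w = mat 1 + integral {0..t} (\<lambda>s. A0 s w ** v s w) + (\<Sum>j=1..m. J j t w)"
    and trace_A0: "\<And>s w. trace (A0 s w) = c"
    and trace_A: "\<And>j s w. j \<in> {1..m} \<Longrightarrow> trace (A j s w) = 0"
begin

definition G where "G s w = cofactor_matrix (v s w)"
definition D where "D s w = det (v s w)"
definition I where "I s w = integral {0..s} (\<lambda>u. A0 u w ** v u w)"
definition Y where "Y j s w = A j s w ** v s w"

lemma v_meas: "0 \<le> s \<Longrightarrow> v s \<in> borel_measurable M"
  using adapted_measurable_M[OF v_adapted] .

lemma A0_meas: "0 \<le> s \<Longrightarrow> A0 s \<in> borel_measurable M"
  using adapted_measurable_M[OF A0_adapted] .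

lemma G_component:
  shows "adapted F (\<lambda>s w. G s w $ a $ b)" "continuous_paths M (\<lambda>s w. G s w $ a $ b)"
    and "0 < t \<Longrightarrow> stoch_bounded M (dyad_qv t (\<lambda>s w. G s w $ a $ b))"
proof -
  have cont: "continuous_on UNIV (\<lambda>x :: real^'d^'d. cofactor_matrix x $ a $ b)"
    by (rule locally_lipschitz_imp_continuous) (rule cofactor_component_lipschitz)
  show "adapted F (\<lambda>s w. G s w $ a $ b)"
    unfolding G_def by (rule adapted_compose[OF v_adapted cont])
  show "continuous_paths M (\<lambda>s w. G s w $ a $ b)"
    unfolding G_def by (rule continuous_paths_compose[OF v_cont cont])
  show "stoch_bounded M (dyad_qv t (\<lambda>s w. G s w $ a $ b))" if "0 < t"
    unfolding G_def using that v_meas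
    by (intro lipschitz_qv_bounded[OF _ _ v_cont v_qv cofactor_component_lipschitz]) auto
qed

lemma Y_component:
  assumes j: "j \<in> {1..m}"
  shows "adapted F (\<lambda>s w. Y j s w $ a $ b)" "continuous_paths M (\<lambda>s w. Y j s w $ a $ b)"
    and "0 < t \<Longrightarrow> stoch_bounded M (dyad_qv t (\<lambda>s w. Y j s w $ a $ b))"
proof -
  let ?X = "\<lambda>s w. (A j s w, v s w)" and ?\<phi> = "\<lambda>x :: (real^'d^'d) \<times> (real^'d^'d). (fst x ** snd x) $ a $ b"
  have Y: "(\<lambda>s w. Y j s w $ a $ b) = (\<lambda>s w. ?\<phi> (?X s w))" by (simp add: Y_def)
  have cont: "continuous_on UNIV ?\<phi>"
    by (intro continuous_intros continuous_matrix_mult)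
  have adX: "adapted F ?X" by (rule adapted_Pair[OF A_adapted[OF j] v_adapted])
  have cX: "continuous_paths M ?X" by (rule continuous_paths_Pair[OF A_cont[OF j] v_cont])
  show "adapted F (\<lambda>s w. Y j s w $ a $ b)"
    unfolding Y by (rule adapted_compose[OF adX cont])
  show "continuous_paths M (\<lambda>s w. Y j s w $ a $ b)"
    unfolding Y by (rule continuous_paths_compose[OF cX cont])
  assume t: "0 < t"
  have qv: "stoch_bounded M (dyad_qv t ?X)"
    using stoch_bounded_add[OF A_qv[OF j t] v_qv[OF t]] unfolding dyad_qv_Pair[symmetric] .
  show "stoch_bounded M (dyad_qv t (\<lambda>s w. Y j s w $ a $ b))"
    unfolding Y using t adapted_measurable_M[OF adX]
    by (intro lipschitz_qv_bounded[OF _ _ cX qv mult_component_lipschitz]) auto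
qed

text \<open>The cubic error of the trapezoidal rule in each cell is at most the oscillation of
  \<open>v\<close> times the squared increment, and the squared increments have sums bounded in
  probability.\<close>

lemma det_increments_conv0:
  assumes t: "0 < t"
  shows "conv0 M (\<lambda>n w. \<Sum>i<2^n. incr t D n i w - avg t G n i w \<bullet> incr t v n i w)"
    (is "conv0 M ?E")
proof (rule conv0_oscillation[OF _ v_cont v_qv[OF t]])
  fix R :: real
  obtain C where C: "0 \<le> C" "\<And>x y :: real^'d^'d. norm x \<le> R \<Longrightarrow> norm y \<le> R \<Longrightarrow>
      \<bar>det y - det x - ((1/2) *\<^sub>R (cofactor_matrix x + cofactor_matrix y)) \<bullet> (y - x)\<bar> \<le> C * norm (y - x) ^ 3"
    using det_trapezoid[of R] by blast
  show "\<exists>C\<ge>0. \<forall>n. AE w in M. \<forall>c\<ge>0. (\<forall>s\<in>{0..t}. norm (v s w) \<le> R) \<longrightarrow>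
      (\<forall>s\<in>{0..t}. \<forall>u\<in>{0..t}. \<bar>s - u\<bar> \<le> t / 2^n \<longrightarrow> norm (v s w - v u w) \<le> c) \<longrightarrow>
      \<bar>?E n w\<bar>
        \<le> C * c * \<bar>dyad_qv t v n w\<bar>"
  proof (rule exI[of _ C], intro conjI allI impI AE_I2)
    fix n w and c :: real
    assume c: "0 \<le> c" and bd: "\<forall>s\<in>{0..t}. norm (v s w) \<le> R"
      and osc: "\<forall>s\<in>{0..t}. \<forall>u\<in>{0..t}. \<bar>s - u\<bar> \<le> t / 2^n \<longrightarrow> norm (v s w - v u w) \<le> c"
    have "\<bar>?E n w\<bar>
        \<le> (\<Sum>i<2^n. C * c * (norm (incr t v n i w))\<^sup>2)"
    proof (intro order_trans[OF sum_abs] sum_mono)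
      fix i assume "i \<in> {..<2^n::nat}"
      then have i: "i < 2 ^ n" by simp
      have "dyad t n i \<in> {0..t}" "dyad t n (Suc i) \<in> {0..t}"
        using t i by (intro dyad_in; simp)+
      then have "\<bar>incr t D n i w - avg t G n i w \<bullet> incr t v n i w\<bar>
          \<le> C * norm (incr t v n i w) ^ 3"
        unfolding incr_def avg_def D_def G_def using bd by (intro C(2)) auto
      also have "\<dots> = C * (norm (incr t v n i w) * (norm (incr t v n i w))\<^sup>2)"
        by (simp add: power3_eq_cube power2_eq_square)
      also have "\<dots> \<le> C * (c * (norm (incr t v n i w))\<^sup>2)"
        using incr_osc[where X = v, OF _ i osc] t C(1)
        by (intro mult_left_mono mult_right_mono) auto
      finally show "\<bar>incr t D n i w - avg t G n i w \<bullet> incr t v n i w\<bar>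
          \<le> C * c * (norm (incr t v n i w))\<^sup>2" by (simp add: mult.assoc)
    qed
    also have "\<dots> = C * c * dyad_qv t v n w" by (simp add: dyad_qv_def sum_distrib_left)
    also have "\<dots> \<le> C * c * \<bar>dyad_qv t v n w\<bar>" using C(1) c by (intro mult_left_mono) auto
    finally show "\<bar>?E n w\<bar>
        \<le> C * c * \<bar>dyad_qv t v n w\<bar>" .
  qed (rule C(1))
qed (use v_meas in auto)

text \<open>The matrix inner product is a finite sum over entries, and associativity applies to each
  pair of entries of \<open>G\<close> and \<open>Y j\<close>.\<close>

lemma stratonovich_terms_conv0:
  assumes t: "0 < t" and j: "j \<in> {1..m}"
  shows "conv0 M (\<lambda>n w. \<Sum>i<2^n. avg t G n i w \<bullet>
    (incr t (J j) n i w - incr t (W j) n i w *\<^sub>R avg t (Y j) n i w))"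
    (is "conv0 M (\<lambda>n w. \<Sum>i<2^n. ?L n i w)")
proof -
  interpret brownian M F "W j" by (rule bm[OF j])
  let ?C = "\<lambda>n i a b w. avg t (\<lambda>s w. G s w $ a $ b) n i w * (incr t (\<lambda>s w. J j s w $ a $ b) n i w
    - avg t (\<lambda>s w. Y j s w $ a $ b) n i w * incr t (W j) n i w)"
  have "conv0 M (\<lambda>n w. \<Sum>a\<in>UNIV. \<Sum>b\<in>UNIV. \<Sum>i<2^n. ?C n i a b w)"
  proof (intro conv0_sum stratonovich_associative t Y_component j G_component)
    fix a b s assume "s \<in> {0..t}"
    then show "has_stratonovich_integral M (\<lambda>s w. Y j s w $ a $ b) (W j) s (\<lambda>w. J j s w $ a $ b)"
      unfolding Y_def using J[OF j]
      by (intro has_stratonovich_integral_component) (auto intro: finite_measure_axioms)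
  qed
  moreover have "(\<Sum>i<2^n. ?L n i w) = (\<Sum>a\<in>UNIV. \<Sum>b\<in>UNIV. \<Sum>i<2^n. ?C n i a b w)" for n w
  proof -
    have "?L n i w = (\<Sum>a\<in>UNIV. \<Sum>b\<in>UNIV. ?C n i a b w)" for i
      unfolding inner_vec_def avg_def incr_def
      by (intro sum.cong refl) (simp add: mult.commute)
    then have "(\<Sum>i<2^n. ?L n i w) = (\<Sum>i<2^n. \<Sum>a\<in>UNIV. \<Sum>b\<in>UNIV. ?C n i a b w)"
      by simp
    also have "\<dots> = (\<Sum>a\<in>UNIV. \<Sum>i<2^n. \<Sum>b\<in>UNIV. ?C n i a b w)"
      by (rule sum.swap)
    finally show ?thesis by (simp only: sum.swap[of _ UNIV "{..<2^n}"])
  qed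
  ultimately show ?thesis by simp
qed

text \<open>As \<open>A j\<close> is traceless, \<open>G\<close> is orthogonal to \<open>Y j\<close> at each time, so that only a product of
  increments is left of the averaged inner product.\<close>

lemma averages_inner:
  assumes "j \<in> {1..m}"
  shows "avg t G n i w \<bullet> avg t (Y j) n i w = - (1/4) * (incr t G n i w \<bullet> incr t (Y j) n i w)"
proof -
  have "G s w \<bullet> Y j s w = 0" for s
    by (simp add: G_def Y_def cofactor_matrix_inner_mult trace_A[OF assms])
  then show ?thesis
    by (simp add: avg_def incr_def inner_add_left inner_add_right inner_diff_left inner_diff_right
        field_simps)
qed

lemma traceless_terms_conv0:
  assumes t: "0 < t" and j: "j \<in> {1..m}"
  shows "conv0 M (\<lambda>n w. \<Sum>i<2^n. incr t (W j) n i w * (avg t G n i w \<bullet> avg t (Y j) n i w))"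
    (is "conv0 M ?L")
proof -
  interpret brownian M F "W j" by (rule bm[OF j])
  let ?C = "\<lambda>n i a b w. incr t (\<lambda>s w. G s w $ a $ b) n i w *
      incr t (\<lambda>s w. Y j s w $ a $ b) n i w * incr t (W j) n i w"
  have "conv0 M (\<lambda>n w. \<Sum>a\<in>UNIV. \<Sum>b\<in>UNIV. \<Sum>i<2^n. ?C n i a b w)"
    using t by (intro conv0_sum conv0_triple_increments G_component Y_component j cont_W W_measurable) auto
  then show ?thesis
  proof (rule conv0_dominated, intro AE_I2)
    fix n w
    have "?L n w = - (1/4) * (\<Sum>i<2^n. \<Sum>a\<in>UNIV. \<Sum>b\<in>UNIV. ?C n i a b w)"
      unfolding averages_inner[OF j] sum_distrib_left[of "- (1/4)"]
      by (intro sum.cong refl) (simp add: inner_vec_def incr_def sum_distrib_left sum_distrib_right mult.commute)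
    also have "(\<Sum>i<2^n. \<Sum>a\<in>UNIV. \<Sum>b\<in>UNIV. ?C n i a b w) = (\<Sum>a\<in>UNIV. \<Sum>i<2^n. \<Sum>b\<in>UNIV. ?C n i a b w)"
      by (rule sum.swap)
    also have "\<dots> = (\<Sum>a\<in>UNIV. \<Sum>b\<in>UNIV. \<Sum>i<2^n. ?C n i a b w)"
      by (simp only: sum.swap[of _ UNIV "{..<2^n}"])
    finally show "\<bar>?L n w\<bar> \<le> \<bar>\<Sum>a\<in>UNIV. \<Sum>b\<in>UNIV. \<Sum>i<2^n. ?C n i a b w\<bar>"
      by simp
  qed
qed

text \<open>Since the pairing of \<open>G s\<close> with \<open>A0 s ** v s\<close> is c times
  \<open>D s\<close> at each time, the error on a cell is the integral of (average of
  \<open>G\<close> minus \<open>G s\<close>) against the drift, bounded by the oscillation of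
  \<open>v\<close> times the cell length.\<close>

lemma drift_terms_conv0:
  assumes t: "0 < t"
  shows "conv0 M (\<lambda>n w. (\<Sum>i<2^n. avg t G n i w \<bullet> incr t I n i w) - c * integral {0..t} (\<lambda>s. D s w))"
    (is "conv0 M ?E")
proof (rule conv0_oscillation)
  \<comment> \<open>The pair is needed for a bound on the drift \<open>A0 s w ** v s w\<close>; of
    the oscillation only the part of \<open>v\<close> is used.\<close>
  let ?X = "\<lambda>s w. (v s w, A0 s w)"
  show "continuous_paths M ?X" by (rule continuous_paths_Pair[OF v_cont A0_cont])
  show "?X s \<in> borel_measurable M" if "s \<in> {0..t}" for s
    using that v_meas A0_meas by (intro borel_measurable_Pair) auto
  show "stoch_bounded M (\<lambda>n w. t)" by (rule stoch_bounded_pathwise) auto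
  fix R :: real assume "R > 0"
  obtain C where C: "0 \<le> C" "\<And>x y :: real^'d^'d. norm x \<le> R \<Longrightarrow> norm y \<le> R \<Longrightarrow>
      norm (cofactor_matrix y - cofactor_matrix x) \<le> C * norm (y - x)"
    using cofactor_matrix_lipschitz[of R] by blast
  \<comment> \<open>A bound for the drift while both factors stay in the ball of radius R, from
    compactness of the image under multiplication.\<close>
  obtain L where L: "0 \<le> L" "\<And>(x :: real^'d^'d) (y :: real^'d^'d). norm x \<le> R \<Longrightarrow> norm y \<le> R \<Longrightarrow> norm (y ** x) \<le> L"
  proof -
    have "compact ((\<lambda>x :: (real^'d^'d) \<times> (real^'d^'d). fst x ** snd x) ` (cball 0 R \<times> cball 0 R))"
      by (intro compact_continuous_image continuous_on_subset[OF continuous_matrix_mult] compact_Times) auto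
    from compact_imp_bounded[OF this]
    obtain L where L: "\<forall>z\<in>(\<lambda>x :: (real^'d^'d) \<times> (real^'d^'d). fst x ** snd x) ` (cball 0 R \<times> cball 0 R). norm z \<le> L"
      unfolding bounded_iff by (rule exE)
    have bnd: "norm (y ** x) \<le> \<bar>L\<bar>" if "norm x \<le> R" "norm y \<le> R" for x y :: "real^'d^'d"
    proof -
      have "y ** x \<in> (\<lambda>x :: (real^'d^'d) \<times> (real^'d^'d). fst x ** snd x) ` (cball 0 R \<times> cball 0 R)"
        using that by (intro image_eqI[of _ _ "(y, x)"]) auto
      from L[rule_format, OF this] show ?thesis by linarith
    qed
    show thesis by (rule that[OF abs_ge_zero bnd])
  qed
  show "\<exists>C\<ge>0. \<forall>n. AE w in M. \<forall>e\<ge>0. (\<forall>s\<in>{0..t}. norm (?X s w) \<le> R) \<longrightarrow>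
      (\<forall>s\<in>{0..t}. \<forall>u\<in>{0..t}. \<bar>s - u\<bar> \<le> t / 2^n \<longrightarrow> norm (?X s w - ?X u w) \<le> e) \<longrightarrow>
      \<bar>?E n w\<bar> \<le> C * e * \<bar>t\<bar>"
  proof (rule exI[of _ "C * L"], intro conjI allI)
    show "0 \<le> C * L" using C L by simp
    fix n
    show "AE w in M. \<forall>e\<ge>0. (\<forall>s\<in>{0..t}. norm (?X s w) \<le> R) \<longrightarrow>
      (\<forall>s\<in>{0..t}. \<forall>u\<in>{0..t}. \<bar>s - u\<bar> \<le> t / 2^n \<longrightarrow> norm (?X s w - ?X u w) \<le> e) \<longrightarrow>
      \<bar>?E n w\<bar> \<le> C * L * e * \<bar>t\<bar>"
      using v_cont[unfolded continuous_paths_def] A0_cont[unfolded continuous_paths_def]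
    proof eventually_elim
      case (elim w)
      define b where "b s = A0 s w ** v s w" for s
      have vc: "continuous_on {0..t} (\<lambda>s. v s w)" using elim(1) by (rule continuous_on_subset) auto
      have A0c: "continuous_on {0..t} (\<lambda>s. A0 s w)" using elim(2) by (rule continuous_on_subset) auto
      have bc: "continuous_on {0..t} b"
        unfolding b_def
        using continuous_on_compose2[OF continuous_matrix_mult continuous_on_Pair[OF A0c vc]] by simp
      have Dc: "continuous_on {0..t} (\<lambda>s. D s w)"
        unfolding D_def using continuous_on_compose2[OF continuous_det vc] by simp
      show ?case
      proof (intro allI impI)
        fix e :: real
        assume e: "0 \<le> e" and bd: "\<forall>s\<in>{0..t}. norm (?X s w) \<le> R"
          and osc: "\<forall>s\<in>{0..t}. \<forall>u\<in>{0..t}. \<bar>s - u\<bar> \<le> t / 2^n \<longrightarrow> norm (?X s w - ?X u w) \<le> e"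
        have vR: "norm (v s w) \<le> R" "norm (A0 s w) \<le> R" if "s \<in> {0..t}" for s
          using bd[rule_format, OF that] norm_fst_le[of "v s w" "A0 s w"] norm_snd_le[of "A0 s w" "v s w"]
          by linarith+
        have vosc: "norm (v s w - v u w) \<le> e" if "s \<in> {0..t}" "u \<in> {0..t}" "\<bar>s - u\<bar> \<le> t / 2^n" for s u
          using osc[rule_format, OF that] norm_fst_le[of "v s w - v u w" "A0 s w - A0 u w"] by simp
        have cell: "\<bar>avg t G n i w \<bullet> incr t I n i w
            - c * integral {dyad t n i..dyad t n (Suc i)} (\<lambda>s. D s w)\<bar> \<le> C * L * e * (t / 2 ^ n)" if i: "i < 2 ^ n" for i
        proof -
          let ?S = "{dyad t n i..dyad t n (Suc i)}"
          have le: "dyad t n i \<le> dyad t n (Suc i)" using t by (intro dyad_mono) auto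
          have end_in: "dyad t n i \<in> {0..t}" "dyad t n (Suc i) \<in> {0..t}"
            using t i by (intro dyad_in; simp)+
          then have sub: "?S \<subseteq> {0..t}" by auto
          have bi: "b integrable_on ?S" "b integrable_on {0..dyad t n (Suc i)}"
            using bc sub end_in by (auto intro!: integrable_continuous_real continuous_on_subset[OF bc])
          have Di: "(\<lambda>s. D s w) integrable_on ?S"
            using sub by (intro integrable_continuous_real continuous_on_subset[OF Dc])
          have "integral {0..dyad t n i} b + integral ?S b = integral {0..dyad t n (Suc i)} b"
            using t le bi(2) by (intro Henstock_Kurzweil_Integration.integral_combine) auto
          then have inc: "incr t I n i w = integral ?S b"
            unfolding incr_def I_def b_def by (simp add: algebra_simps)
          let ?g = "avg t G n i w"
          have gb: "(\<lambda>s. ?g \<bullet> b s) integrable_on ?S" "integral ?S (\<lambda>s. ?g \<bullet> b s) = ?g \<bullet> integral ?S b"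
            using integrable_linear[OF bi(1) bounded_linear_inner_right[of ?g]]
              integral_linear[OF bi(1) bounded_linear_inner_right[of ?g]]
            by (simp_all add: comp_def)
          have "?g \<bullet> incr t I n i w - c * integral ?S (\<lambda>s. D s w)
              = integral ?S (\<lambda>s. ?g \<bullet> b s - c * D s w)"
            unfolding inc gb(2)[symmetric] using gb(1) Di
            by (subst Henstock_Kurzweil_Integration.integral_diff) (auto intro: integrable_on_mult_right)
          moreover have "norm (integral ?S (\<lambda>s. ?g \<bullet> b s - c * D s w)) \<le> C * L * e * (dyad t n (Suc i) - dyad t n i)"
          proof (rule integral_bound[OF le])
            show "continuous_on ?S (\<lambda>s. ?g \<bullet> b s - c * D s w)"
              by (intro continuous_intros continuous_on_subset[OF bc sub] continuous_on_subset[OF Dc sub])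
            fix s assume s: "s \<in> ?S"
            then have st: "s \<in> {0..t}" using sub by auto
            have "G s w \<bullet> b s = c * D s w"
              by (simp add: G_def b_def D_def cofactor_matrix_inner_mult trace_A0)
            then have "?g \<bullet> b s - c * D s w = (?g - G s w) \<bullet> b s" by (simp add: inner_diff_left)
            also have "norm \<dots> \<le> norm (?g - G s w) * norm (b s)"
              by (simp add: Cauchy_Schwarz_ineq2)
            also have "\<dots> \<le> (C * e) * L"
            proof (rule mult_mono)
              have near: "norm (G u w - G s w) \<le> C * e" if "u \<in> {dyad t n i, dyad t n (Suc i)}" for u
              proof -
                have u: "u \<in> {0..t}" using that end_in by auto
                have "\<bar>u - s\<bar> \<le> t / 2 ^ n" using that s dyad_Suc_diff[of t n i] by auto
                then have "norm (v u w - v s w) \<le> e" by (intro vosc u st)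
                then show ?thesis
                  unfolding G_def using C(2)[OF vR(1)[OF st] vR(1)[OF u]] C(1)
                  by (meson mult_left_mono order_trans)
              qed
              have "?g - G s w = (1/2) *\<^sub>R ((G (dyad t n i) w - G s w) + (G (dyad t n (Suc i)) w - G s w))"
                by (simp add: avg_def scaleR_2[symmetric] algebra_simps flip: scaleR_add_left)
              also have "norm \<dots> \<le> (1/2) * (C * e + C * e)"
                unfolding norm_scaleR by (intro mult_mono norm_triangle_mono near) auto
              finally show "norm (?g - G s w) \<le> C * e" by simp
              show "norm (b s) \<le> L" unfolding b_def using vR[OF st] by (intro L(2))
            qed (use C(1) e L(1) in auto)
            finally show "norm (?g \<bullet> b s - c * D s w) \<le> C * L * e" by (simp add: mult_ac)
          qed
          ultimately show ?thesis by (simp only: dyad_Suc_diff real_norm_def)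
        qed
        have "integral {0..t} (\<lambda>s. D s w) = (\<Sum>i<2^n. integral {dyad t n i..dyad t n (Suc i)} (\<lambda>s. D s w))"
          using integral_dyad_sum[of t "\<lambda>s. D s w" "2^n" n] t Dc by (simp add: integrable_continuous_real)
        then have "?E n w
            = (\<Sum>i<2^n. avg t G n i w \<bullet> incr t I n i w
                - c * integral {dyad t n i..dyad t n (Suc i)} (\<lambda>s. D s w))"
          by (simp add: sum_subtractf sum_distrib_left)
        also have "\<bar>\<dots>\<bar> \<le> (\<Sum>i<(2::nat)^n. C * L * e * (t / 2 ^ n))"
          by (intro order_trans[OF sum_abs] sum_mono cell) auto
        also have "\<dots> = C * L * e * \<bar>t\<bar>" using t by simp
        finally show "\<bar>?E n w\<bar>
            \<le> C * L * e * \<bar>t\<bar>" .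
      qed
    qed
  qed
qed

text \<open>For every level n the four error terms add up, almost surely, to the defect of the
  claimed equation, which does not depend on n. Convergence to 0 in probability therefore forces it
  to vanish almost surely.\<close>

lemma det_integral_equation:
  assumes t: "0 < t"
  shows "AE w in M. D t w = D 0 w + c * integral {0..t} (\<lambda>s. D s w)"
proof -
  let ?E1 = "\<lambda>n w. \<Sum>i<2^n. incr t D n i w - avg t G n i w \<bullet> incr t v n i w"
  let ?E2 = "\<lambda>j n w. \<Sum>i<2^n. avg t G n i w \<bullet>
    (incr t (J j) n i w - incr t (W j) n i w *\<^sub>R avg t (Y j) n i w)"
  let ?E3 = "\<lambda>j n w. \<Sum>i<2^n. incr t (W j) n i w * (avg t G n i w \<bullet> avg t (Y j) n i w)"
  let ?E4 = "\<lambda>n w. (\<Sum>i<2^n. avg t G n i w \<bullet> incr t I n i w) - c * integral {0..t} (\<lambda>s. D s w)"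
  have "conv0 M (\<lambda>n w. ?E1 n w + ((\<Sum>j=1..m. ?E2 j n w) + (\<Sum>j=1..m. ?E3 j n w)) + ?E4 n w)"
    by (intro conv0_add conv0_sum det_increments_conv0 stratonovich_terms_conv0 traceless_terms_conv0 drift_terms_conv0 t)
  then have "conv0 M (\<lambda>n w. D t w - D 0 w - c * integral {0..t} (\<lambda>s. D s w))"
  proof (rule conv0_dominated)
    fix n
    \<comment> \<open>The equation holds off a null set depending on the time; at the finitely many
      grid points of level n it holds simultaneously.\<close>
    have "AE w in M. \<forall>i\<in>{..2^n}. v (dyad t n i) w = mat 1 + I (dyad t n i) w + (\<Sum>j=1..m. J j (dyad t n i) w)"
      using t unfolding I_def by (intro AE_ball_countable' eq) auto
    then show "AE w in M. \<bar>D t w - D 0 w - c * integral {0..t} (\<lambda>s. D s w)\<bar>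
      \<le> \<bar>?E1 n w + ((\<Sum>j=1..m. ?E2 j n w) + (\<Sum>j=1..m. ?E3 j n w)) + ?E4 n w\<bar>"
    proof eventually_elim
      case (elim w)
      let ?g = "\<lambda>i. avg t G n i w"
      have dv: "incr t v n i w = incr t I n i w + (\<Sum>j=1..m. incr t (J j) n i w)" if "i < 2 ^ n" for i
        using elim that by (simp add: incr_def sum_subtractf Suc_leI)
      have "(\<Sum>i<2^n. ?g i \<bullet> incr t v n i w)
          = (\<Sum>i<2^n. ?g i \<bullet> incr t I n i w) + (\<Sum>i<2^n. \<Sum>j=1..m. ?g i \<bullet> incr t (J j) n i w)"
        unfolding sum.distrib[symmetric]
        by (intro sum.cong refl) (simp add: dv inner_add_right inner_sum_right)
      also have "(\<Sum>i<2^n. \<Sum>j=1..m. ?g i \<bullet> incr t (J j) n i w) = (\<Sum>j=1..m. \<Sum>i<2^n. ?g i \<bullet> incr t (J j) n i w)"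
        by (rule sum.swap)
      also have "\<dots> = (\<Sum>j=1..m. ?E2 j n w) + (\<Sum>j=1..m. ?E3 j n w)"
        by (simp add: sum.distrib[symmetric] inner_diff_right)
      finally have "(\<Sum>i<2^n. ?g i \<bullet> incr t v n i w)
          = (\<Sum>i<2^n. ?g i \<bullet> incr t I n i w) + ((\<Sum>j=1..m. ?E2 j n w) + (\<Sum>j=1..m. ?E3 j n w))" .
      moreover have "(\<Sum>i<2^n. incr t D n i w) = D t w - D 0 w"
        unfolding incr_def by (subst sum_lessThan_telescope[of "\<lambda>i. D (dyad t n i) w"]) simp
      ultimately have "D t w - D 0 w - c * integral {0..t} (\<lambda>s. D s w)
          = ?E1 n w + ((\<Sum>j=1..m. ?E2 j n w) + (\<Sum>j=1..m. ?E3 j n w)) + ?E4 n w"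
        by (simp add: sum_subtractf)
      then show ?case by simp
    qed
  qed
  from conv0_const_imp_AE_zero[OF this] show ?thesis by eventually_elim simp
qed

text \<open>A common null set is obtained from a countable dense set of times; both sides of the
  integral equation are continuous in t, so it extends to all t. The initial value is 1 because the
  integrals over [0,0] vanish.\<close>

theorem det_eq_exp: "AE w in M. \<forall>t\<ge>0. det (v t w) = exp (c * t)"
proof -
  obtain T where T: "countable T" "T \<subseteq> {0..}" "{0..} \<subseteq> closure (T :: real set)"
    using separable[of "{0::real..}"] by blast
  have "AE w in M. D t w = D 0 w + c * integral {0..t} (\<lambda>s. D s w)" if "t \<in> T" for t
    using det_integral_equation[of t] T(2) that by (cases "t = 0") auto
  then have eqT: "AE w in M. \<forall>t\<in>T. D t w = D 0 w + c * integral {0..t} (\<lambda>s. D s w)"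
    by (intro AE_ball_countable' T(1))
  have "AE w in M. \<forall>j\<in>{1..m}. J j 0 w = 0"
    by (intro AE_ball_countable' stratonovich_integral_0[OF J]) auto
  with eq[OF order_refl] have "AE w in M. D 0 w = 1"
    by eventually_elim (simp add: D_def)
  with eqT v_cont[unfolded continuous_paths_def] show ?thesis
  proof eventually_elim
    case (elim w)
    have Dc: "continuous_on {0..} (\<lambda>s. D s w)"
      unfolding D_def using continuous_on_compose2[OF continuous_det elim(2)] by simp
    have "D t w = 1 + c * integral {0..t} (\<lambda>s. D s w)" if t: "0 \<le> t" for t
    proof -
      obtain a where a: "\<And>k. a k \<in> T" "a \<longlonglongrightarrow> t"
        using t T(3) by (metis atLeast_iff closure_sequential subsetD)
      \<comment> \<open>The interval extends beyond t because the approximating times may lie to the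
        right of t.\<close>
      have contS: "continuous_on {0..t+1} (\<lambda>s. D s w)" using Dc by (rule continuous_on_subset) auto
      let ?\<Psi> = "\<lambda>s. D s w - 1 - c * integral {0..s} (\<lambda>s. D s w)"
      have "continuous_on {0..t+1} ?\<Psi>"
        by (intro continuous_intros contS indefinite_integral_continuous_1 integrable_continuous_real)
      moreover have "\<forall>\<^sub>F k in sequentially. a k \<in> {0..t+1}"
      proof -
        have "\<forall>\<^sub>F k in sequentially. a k < t + 1" by (rule order_tendstoD(2)[OF a(2)]) simp
        then show ?thesis by eventually_elim (use a(1) T(2) in force)
      qed
      ultimately have "(\<lambda>k. ?\<Psi> (a k)) \<longlonglongrightarrow> ?\<Psi> t"
        using a(2) t by (intro continuous_on_tendsto_compose[where f = ?\<Psi> and s = "{0..t+1}"]) auto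
      moreover have "?\<Psi> (a k) = 0" for k using elim a(1) by simp
      ultimately have "?\<Psi> t = 0" by (simp add: LIMSEQ_const_iff)
      then show ?thesis by simp
    qed
    then show ?case
      using linear_integral_equation_exp[OF Dc] by (simp add: D_def)
  qed
qed

end

section \<open>The variational equation\<close>

text \<open>Mean value inequality: the operator norm of the derivative is at most the sum of the
  bounds for the partial derivatives.\<close>

lemma lipschitz_of_bounded_partial_derivs:
  fixes g :: "real^'d \<Rightarrow> real^'d"
  assumes diff: "\<And>y. g differentiable (at y)" and bnd: "\<And>i. bounded (range (partial_deriv i g))"
  shows "\<exists>C\<ge>0. \<forall>y z. norm (g z - g y) \<le> C * norm (z - y)"
proof -
  have "\<forall>i. \<exists>K. \<forall>y. norm (partial_deriv i g y) \<le> K"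
    using bnd unfolding bounded_iff by blast
  then obtain K where K: "\<And>i y. norm (partial_deriv i g y) \<le> K i" by metis
  have K0: "0 \<le> K i" for i using K[of i 0] norm_ge_zero order_trans by blast
  let ?C = "\<Sum>i\<in>UNIV. K i"
  have C: "0 \<le> ?C" by (intro sum_nonneg K0)
  have "norm (g z - g y) \<le> ?C * norm (z - y)" for y z
  proof (rule differentiable_bound)
    show "convex (UNIV :: (real^'d) set)" by simp
    fix w :: "real^'d"
    let ?g' = "frechet_derivative g (at w)"
    have g': "(g has_derivative ?g') (at w)" using diff by (simp add: frechet_derivative_works[symmetric])
    show "(g has_derivative ?g') (at w within UNIV)" using g' by simp
    show "onorm ?g' \<le> ?C"
    proof (rule onorm_le)
      fix h :: "real^'d"
      have lin: "linear ?g'" using g' by (rule has_derivative_linear)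
      have "?g' h = ?g' (\<Sum>i\<in>UNIV. h $ i *s axis i 1)" by (simp add: basis_expansion)
      also have "\<dots> = (\<Sum>i\<in>UNIV. h $ i *\<^sub>R partial_deriv i g w)"
        by (simp add: linear_sum[OF lin] linear_cmul[OF lin] partial_deriv_def scalar_mult_eq_scaleR)
      also have "norm \<dots> \<le> (\<Sum>i\<in>UNIV. \<bar>h $ i\<bar> * norm (partial_deriv i g w))"
        by (rule order_trans[OF norm_sum]) simp
      also have "\<dots> \<le> (\<Sum>i\<in>UNIV. norm h * K i)"
        by (intro sum_mono mult_mono K) (auto simp: component_le_norm_cart)
      also have "\<dots> = ?C * norm h" 
        unfolding sum_distrib_right by (simp add: mult.commute)
      finally show "norm (?g' h) \<le> ?C * norm h" .
    qed
  qed auto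
  with C show ?thesis by blast
qed

lemma norm_matrix_le: "norm (A :: real^'n^'m) \<le> (\<Sum>i\<in>UNIV. \<Sum>j\<in>UNIV. \<bar>A $ i $ j\<bar>)"
proof -
  have "norm A \<le> (\<Sum>i\<in>UNIV. norm (A $ i))"
    unfolding norm_vec_def by (rule L2_set_le_sum) simp
  also have "\<dots> \<le> (\<Sum>i\<in>UNIV. \<Sum>j\<in>UNIV. \<bar>A $ i $ j\<bar>)"
    by (intro sum_mono norm_le_l1_cart)
  finally show ?thesis .
qed

lemma jacobian_partial_deriv: "jacobian g (at y) = (\<chi> a i. partial_deriv i g y $ a)"
  by (simp add: jacobian_def matrix_def partial_deriv_def)

lemma C_kb_jacobian_continuous:
  assumes "C_kb k \<delta> g" "1 \<le> k"
  shows "continuous_on UNIV (\<lambda>y. jacobian g (at y))"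
proof -
  have "continuous_on UNIV (partial_derivs [i] g)" for i
    using assms by (auto simp: C_kb_def)
  then have "continuous_on UNIV (partial_deriv i g)" for i
    by (simp add: partial_derivs_def)
  then show ?thesis
    unfolding jacobian_partial_deriv by (intro continuous_on_vec_lambda continuous_on_component)
qed

text \<open>Bounded second-order partial derivatives make the first-order ones Lipschitz. It is for
  this that the diffusion fields are one order smoother than the drift: k + 1 \<ge> 2.\<close>

lemma C_kb_jacobian_lipschitz:
  fixes g :: "real^'d \<Rightarrow> real^'d"
  assumes g: "C_kb k \<delta> g" "2 \<le> k"
  shows "\<exists>C\<ge>0. \<forall>y z. norm (jacobian g (at z) - jacobian g (at y)) \<le> C * norm (z - y)"
proof -
  have "\<exists>C\<ge>0. \<forall>y z. norm (partial_deriv i g z - partial_deriv i g y) \<le> C * norm (z - y)" for i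
  proof (rule lipschitz_of_bounded_partial_derivs)
    have "\<forall>y. partial_derivs [i] g differentiable (at y)"
      using g unfolding C_kb_def by (metis One_nat_def Suc_1 Suc_le_lessD length_Cons list.size(3))
    then show "partial_deriv i g differentiable (at y)" for y by (simp add: partial_derivs_def)
    fix l
    \<comment> \<open>In \<open>partial_derivs\<close> the fold differentiates in direction i before
      l, so the list [i, l] denotes the l-th partial derivative of
      \<open>partial_deriv i g\<close>.\<close>
    have "length [i, l] \<le> k" "1 \<le> length [i, l]" using g(2) by auto
    then have "bounded (range (partial_derivs [i, l] g))"
      using g(1) unfolding C_kb_def by blast
    then show "bounded (range (partial_deriv l (partial_deriv i g)))" by (simp add: partial_derivs_def)
  qed
  then obtain C where C: "\<And>i. 0 \<le> C i" "\<And>i y z. norm (partial_deriv i g z - partial_deriv i g y) \<le> C i * norm (z - y)"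
    by metis
  have "norm (jacobian g (at z) - jacobian g (at y)) \<le> (\<Sum>a\<in>(UNIV :: 'd set). \<Sum>i\<in>UNIV. C i) * norm (z - y)" for y z
  proof -
    have "norm (jacobian g (at z) - jacobian g (at y)) \<le> (\<Sum>a\<in>(UNIV :: 'd set). \<Sum>i\<in>UNIV. C i * norm (z - y))"
    proof (intro order_trans[OF norm_matrix_le] sum_mono)
      fix a i
      show "\<bar>(jacobian g (at z) - jacobian g (at y)) $ a $ i\<bar> \<le> C i * norm (z - y)"
        using component_le_norm_cart[of "partial_deriv i g z - partial_deriv i g y" a] C(2)[of i z y]
        by (simp add: jacobian_partial_deriv)
    qed
    then show ?thesis by (simp only: sum_distrib_right)
  qed
  then show ?thesis using C(1) by (intro exI[of _ "\<Sum>a\<in>(UNIV :: 'd set). \<Sum>i\<in>UNIV. C i"]) (simp add: sum_nonneg)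
qed

text \<open>The squared norm of an increment is the sum of its squared coordinates, so the quadratic
  sum of a vector process is the finite sum of those of its scalar components.\<close>

lemma (in filtered_prob) semimartingale_components:
  fixes Z :: "real \<Rightarrow> 'w \<Rightarrow> 'b::euclidean_space"
  assumes Z: "\<forall>e\<in>Basis. continuous_semimartingale M F (\<lambda>t w. Z t w \<bullet> e)"
  shows "adapted F Z" "continuous_paths M Z" "0 < t \<Longrightarrow> stoch_bounded M (dyad_qv t Z)"
proof -
  show "adapted F Z"
    unfolding adapted_def
  proof (intro allI impI)
    fix s :: real assume "0 \<le> s"
    then have "\<forall>e\<in>Basis. (\<lambda>w. Z s w \<bullet> e) \<in> borel_measurable (F s)"
      using Z unfolding continuous_semimartingale_def adapted_def by blast
    then show "Z s \<in> borel_measurable (F s)" by (subst borel_measurable_euclidean_space)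
  qed
  have "AE w in M. continuous_on {0..} (\<lambda>t. Z t w \<bullet> e)" if "e \<in> Basis" for e
    using Z that unfolding continuous_semimartingale_def continuous_paths_def by blast
  then have "AE w in M. \<forall>e\<in>Basis. continuous_on {0..} (\<lambda>t. Z t w \<bullet> e)"
    by (intro AE_finite_allI) auto
  then show "continuous_paths M Z"
    unfolding continuous_paths_def by eventually_elim (subst continuous_on_componentwise)
  assume t: "0 < t"
  have "dyad_qv t Z n w = (\<Sum>e\<in>Basis. dyad_qv t (\<lambda>t w. Z t w \<bullet> e) n w)" for n w
  proof -
    have "(norm (incr t Z n i w))\<^sup>2 = (\<Sum>e\<in>Basis. (norm (incr t (\<lambda>t w. Z t w \<bullet> e) n i w))\<^sup>2)" for i
      unfolding power2_norm_eq_inner[of "incr t Z n i w"]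
        euclidean_inner[of "incr t Z n i w" "incr t Z n i w"]
      by (simp add: incr_def inner_diff_left power2_eq_square)
    then show ?thesis unfolding dyad_qv_def by (simp add: sum.swap[of _ Basis])
  qed
  then have "dyad_qv t Z = (\<lambda>n w. \<Sum>e\<in>Basis. dyad_qv t (\<lambda>t w. Z t w \<bullet> e) n w)"
    by (simp add: fun_eq_iff)
  then show "stoch_bounded M (dyad_qv t Z)"
    using Z t by (simp add: stoch_bounded_sum semimartingale_qv_bounded)
qed

text \<open>Joint independence is restricted to the two indices 0 (the past) and j (the increment);
  j \<ge> 1 keeps them distinct.\<close>

lemma (in filtered_prob) brownian_motions_component:
  assumes bm: "brownian_motions M F m W" and j: "j \<in> {1..m}"
  shows "brownian M F (W j)"
proof
  show "adapted F (W j)" "continuous_paths M (W j)"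
    using bm j by (auto simp: brownian_motions_def)
  fix s u :: real assume su: "0 \<le> s" "s < u"
  show "distributed M lborel (\<lambda>w. W j u w - W j s w) (normal_density 0 (sqrt (u - s)))"
    using bm j su unfolding brownian_motions_def by blast
  define E where "E = (\<lambda>j. if j = 0 then sets (F s)
      else {(\<lambda>w. W j u w - W j s w) -` A \<inter> space M | A. A \<in> sets borel})"
  have ind: "indep_sets E {0..m}"
    using bm su unfolding brownian_motions_def E_def by blast
  have E: "E 0 = sets (F s)" "E j = {(\<lambda>w. W j u w - W j s w) -` A \<inter> space M | A. A \<in> sets borel}"
    using j by (auto simp: E_def)
  have "indep_set (E 0) (E j)"
  proof (rule indep_setI)
    show "E 0 \<subseteq> events" "E j \<subseteq> events" using ind j by (auto simp: indep_sets_def)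
    fix a b assume ab: "a \<in> E 0" "b \<in> E j"
    have "prob (\<Inter>i\<in>{0, j}. if i = 0 then a else b) = (\<Prod>i\<in>{0, j}. prob (if i = 0 then a else b))"
      by (rule indep_setsD[OF ind]) (use ab j in auto)
    then show "prob (a \<inter> b) = prob a * prob b" using j by simp
  qed
  then show "indep_set (sets (F s)) {(\<lambda>w. W j u w - W j s w) -` A \<inter> space M | A. A \<in> sets borel}"
    by (simp only: E)
qed

theorem lemma3p2:
  fixes M :: "'w measure" and F :: "real \<Rightarrow> 'w measure"
    and m k :: nat and \<delta> c :: real
    and W :: "nat \<Rightarrow> real \<Rightarrow> 'w \<Rightarrow> real"
    and f :: "nat \<Rightarrow> real^'d \<Rightarrow> real^'d"
    and x0 :: "real^'d"
    and x :: "real \<Rightarrow> 'w \<Rightarrow> real^'d"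
    and v :: "real \<Rightarrow> 'w \<Rightarrow> real^'d^'d"
  assumes "filtered_prob_space M F"
    and "brownian_motions M F m W"
    and "k \<ge> 1" and "\<delta> > 0"
    and "C_kb k \<delta> (f 0)"
    and "\<And>j. j \<in> {1..m} \<Longrightarrow> C_kb (k + 1) \<delta> (f j)"
    and "C_kb k \<delta> (\<lambda>y. \<Sum>j=1..m. \<Sum>i\<in>UNIV. (f j y $ i) *\<^sub>R partial_deriv i (f j) y)"
    and "stratonovich_solution M F m W x0
           (\<lambda>t \<omega>. f 0 (x t \<omega>)) (\<lambda>j t \<omega>. f j (x t \<omega>)) x"
    and "stratonovich_solution M F m W (mat 1)
           (\<lambda>t \<omega>. jacobian (f 0) (at (x t \<omega>)) ** v t \<omega>)
           (\<lambda>j t \<omega>. jacobian (f j) (at (x t \<omega>)) ** v t \<omega>) v"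
    and "AE \<omega> in M. \<exists>\<Phi>. (lyapunov_root (\<lambda>t. v t \<omega>) \<longlongrightarrow> \<Phi>) at_top"
    and "\<And>y. trace (jacobian (f 0) (at y)) = c"
    and "\<And>j y. j \<in> {1..m} \<Longrightarrow> trace (jacobian (f j) (at y)) = 0"
  shows "AE \<omega> in M. (\<Sum>l\<in>#lyapunov_exponents (\<lambda>t. v t \<omega>). l) = ereal c"
proof -
  interpret prob_space M using assms(1) by (simp add: filtered_prob_space_def)
  interpret filtered_prob M F by unfold_locales (rule assms(1))
  have "\<forall>e\<in>Basis. continuous_semimartingale M F (\<lambda>t \<omega>. x t \<omega> \<bullet> e)"
    using assms(8) unfolding stratonovich_solution_def by (rule conjunct1)
  note x = semimartingale_components[OF this]
  have "\<forall>e\<in>Basis. continuous_semimartingale M F (\<lambda>t \<omega>. v t \<omega> \<bullet> e)"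
    using assms(9) unfolding stratonovich_solution_def by (rule conjunct1)
  note v = semimartingale_components[OF this]
  obtain J where "\<forall>t\<ge>0.
        (\<forall>j\<in>{1..m}. has_stratonovich_integral M (\<lambda>t \<omega>. jacobian (f j) (at (x t \<omega>)) ** v t \<omega>) (W j) t (J j t)) \<and>
        (AE \<omega> in M. v t \<omega> = mat 1 + integral {0..t} (\<lambda>s. jacobian (f 0) (at (x s \<omega>)) ** v s \<omega>) + (\<Sum>j=1..m. J j t \<omega>))"
    using conjunct2[OF assms(9)[unfolded stratonovich_solution_def]] by (rule exE)
  note J = conjunct1[OF this[rule_format], rule_format] and eq = conjunct2[OF this[rule_format]]
  have lip: "\<exists>C\<ge>0. \<forall>y z. norm (jacobian (f j) (at z) - jacobian (f j) (at y)) \<le> C * norm (z - y)"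
    if "j \<in> {1..m}" for j
    using assms(3) by (intro C_kb_jacobian_lipschitz[OF assms(6)[OF that]]) simp
  \<comment> \<open>Index 0 is included here, unlike in \<open>lip\<close>: \<open>f 0\<close> has
    one derivative less, and continuity of its Jacobian is what the drift term calls for.\<close>
  have cont: "continuous_on UNIV (\<lambda>y. jacobian (f j) (at y))" if "j \<in> {0..m}" for j
  proof (cases "j = 0")
    case True
    then show ?thesis using C_kb_jacobian_continuous[OF assms(5) assms(3)] by simp
  next
    case False
    then show ?thesis using that by (intro C_kb_jacobian_continuous[OF assms(6)]) auto
  qed
  have adJ: "adapted F (\<lambda>s \<omega>. jacobian (f j) (at (x s \<omega>)))" if "j \<in> {0..m}" for j
    by (rule adapted_compose[OF x(1) cont[OF that]])
  have cJ: "continuous_paths M (\<lambda>s \<omega>. jacobian (f j) (at (x s \<omega>)))" if "j \<in> {0..m}" for j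
    by (rule continuous_paths_compose[OF x(2) cont[OF that]])
  have qvJ: "stoch_bounded M (dyad_qv t (\<lambda>s \<omega>. jacobian (f j) (at (x s \<omega>))))"
    if "j \<in> {1..m}" "0 < t" for j t
  proof (rule lipschitz_qv_bounded[where \<phi> = "\<lambda>y. jacobian (f j) (at y)", OF _ _ x(2) x(3)[OF that(2)]])
    show "\<exists>C\<ge>0. \<forall>y z. norm y \<le> R \<longrightarrow> norm z \<le> R \<longrightarrow>
        norm (jacobian (f j) (at z) - jacobian (f j) (at y)) \<le> C * norm (z - y)" for R
      using lip[OF that(1)] by blast
  qed (use that(2) adapted_measurable_M[OF x(1)] in auto)
  interpret stochastic_liouville M F m W "\<lambda>s \<omega>. jacobian (f 0) (at (x s \<omega>))"
    "\<lambda>j s \<omega>. jacobian (f j) (at (x s \<omega>))" v J c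
    by (rule stochastic_liouville.intro[OF filtered_prob_axioms stochastic_liouville_axioms.intro])
      (use brownian_motions_component[OF assms(2)] v adJ cJ qvJ J eq assms(11,12) in auto)
  from det_eq_exp assms(10) show ?thesis
  proof eventually_elim
    case (elim \<omega>)
    then obtain \<Phi> where "(lyapunov_root (\<lambda>t. v t \<omega>) \<longlongrightarrow> \<Phi>) at_top" by blast
    then show ?case using elim(1) by (intro sum_lyapunov_exponents) auto
  qed
qed

end
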